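(* Let $r\ge2$ and $n\ge1$. The splitting field $\ell(\bar\psi[\mathfrak p^n]^{\mathrm{et}})$ of $\bar\psi^{\mathrm{et}}_{\mathfrak p^n}(X)$ over $\ell$ satisfies $$\operatorname{Gal}\big(\ell(\bar\psi[\mathfrak p^n]^{\mathrm{et}})/\ell\big)\cong\mathrm{GL}_{r-1}(A/\mathfrak p^n).$$
   Context: $A=\mathbb F_q[t]$, $\mathfrak p\in A$ monic irreducible with $\mathfrak p\neq t$, $|\mathfrak p|=q^{\deg\mathfrak p}$, $\kappa_{\mathfrak p}=A/\mathfrak p$, $\bar\kappa_{\mathfrak p}$ an algebraic closure, $\bar t$ the image of $t$ in $\kappa_{\mathfrak p}$. Let $g_1,\dots,g_{r-1}$ be algebraically independent indeterminates and $\ell=\bar\kappa_{\mathfrak p}(g_1,\dots,g_{r-1})$, an $A$-field via $A\to A/\mathfrak p\subset\ell$. Let $\bar\psi$ be the Drinfeld $A$-module over $\ell$ (of characteristic $\mathfrak p$) given by $\bar\psi_t(X)=\bar tX+g_1X^q+\dots+g_{r-1}X^{q^{r-1}}+X^{q^r}$. For $n\ge1$ write $\bar\psi_{\mathfrak p^n}(X)=\bar\psi^{\mathrm{et}}_{\mathfrak p^n}(X^{|\mathfrak p|^n})$, where $\bar\psi^{\mathrm{et}}_{\mathfrak p^n}(X)\in\ell[X]$ is a separable $\mathbb F_q$-linear polynomial of degree $|\mathfrak p|^{n(r-1)}$. *)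

theory Defs
  imports "HOL-Computational_Algebra.Polynomial" "HOL-Algebra.Group"
begin

definition is_subfield :: "'a::field set \<Rightarrow> bool" where
  "is_subfield F \<longleftrightarrow> 0 \<in> F \<and> 1 \<in> F \<and>
     (\<forall>x\<in>F. \<forall>y\<in>F. x + y \<in> F \<and> x * y \<in> F) \<and>
     (\<forall>x\<in>F. - x \<in> F \<and> inverse x \<in> F)"

definition gen_field :: "'a::field set \<Rightarrow> 'a set" where
  "gen_field S = \<Inter>{F. is_subfield F \<and> S \<subseteq> F}"

definition field_emb :: "('f::field \<Rightarrow> 'a::field) \<Rightarrow> bool" where
  "field_emb e \<longleftrightarrow> e 0 = 0 \<and> e 1 = 1 \<and> (\<forall>x y. e (x + y) = e x + e y \<and> e (x * y) = e x * e y)"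

definition alg_closure_of :: "('f::field \<Rightarrow> 'a::field) \<Rightarrow> 'a set" where
  "alg_closure_of e = {x. \<exists>p::'f poly. p \<noteq> 0 \<and> poly (map_poly e p) x = 0}"

definition alg_indep :: "'a::field set \<Rightarrow> (nat \<Rightarrow> 'a) \<Rightarrow> nat set \<Rightarrow> bool" where
  "alg_indep K g I \<longleftrightarrow> (\<forall>(S :: (nat \<Rightarrow> nat) set) c.
      finite S \<and> (\<forall>e\<in>S. \<forall>i. i \<notin> I \<longrightarrow> e i = 0) \<and> (\<forall>e\<in>S. c e \<in> K) \<and>
      (\<Sum>e\<in>S. c e * (\<Prod>i\<in>I. g i ^ e i)) = 0 \<longrightarrow> (\<forall>e\<in>S. c e = 0))"

definition drin_t :: "nat \<Rightarrow> nat \<Rightarrow> 'a::field \<Rightarrow> (nat \<Rightarrow> 'a) \<Rightarrow> 'a poly" where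
  "drin_t q r tb g = monom tb 1 + (\<Sum>i\<in>{1..<r}. monom (g i) (q ^ i)) + monom 1 (q ^ r)"

definition drin :: "('f::field \<Rightarrow> 'a::field) \<Rightarrow> 'a poly \<Rightarrow> 'f poly \<Rightarrow> 'a poly" where
  "drin e psit a = (\<Sum>k\<le>degree a. smult (e (coeff a k)) (((\<lambda>p. pcompose psit p) ^^ k) [:0, 1:]))"

definition drin_et :: "('f::field \<Rightarrow> 'a::field) \<Rightarrow> 'a poly \<Rightarrow> nat \<Rightarrow> 'f poly \<Rightarrow> nat \<Rightarrow> 'a poly" where
  "drin_et e psit q P n =
     (THE E. pcompose E (monom 1 (q ^ (degree P * n))) = drin e psit (P ^ n))"

definition Gal :: "'a::field set \<Rightarrow> 'a set \<Rightarrow> ('a \<Rightarrow> 'a) monoid" where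
  "Gal E L = \<lparr> carrier = {\<sigma>. bij_betw \<sigma> E E \<and>
        (\<forall>x\<in>E. \<forall>y\<in>E. \<sigma> (x + y) = \<sigma> x + \<sigma> y \<and> \<sigma> (x * y) = \<sigma> x * \<sigma> y) \<and>
        (\<forall>x\<in>L. \<sigma> x = x) \<and> (\<forall>x. x \<notin> E \<longrightarrow> \<sigma> x = x)},
     mult = (\<lambda>\<sigma> \<tau>. \<sigma> \<circ> \<tau>), one = id \<rparr>"

(* GL_d(A/Q) for A = F_q[t], Q \<noteq> 0: d x d matrices with entries reduced mod Q
   (representatives of A/Q), zero outside the index range; product reduced mod Q;
   invertible ones form the group. *)
definition mat_red :: "nat \<Rightarrow> 'f::field poly \<Rightarrow> (nat \<Rightarrow> nat \<Rightarrow> 'f poly) set" where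
  "mat_red d Q = {M. (\<forall>i j. M i j = M i j mod Q) \<and> (\<forall>i j. \<not>(i < d \<and> j < d) \<longrightarrow> M i j = 0)}"

definition mat_mult_mod :: "nat \<Rightarrow> 'f::field poly \<Rightarrow> (nat \<Rightarrow> nat \<Rightarrow> 'f poly) \<Rightarrow> (nat \<Rightarrow> nat \<Rightarrow> 'f poly) \<Rightarrow> (nat \<Rightarrow> nat \<Rightarrow> 'f poly)" where
  "mat_mult_mod d Q M N = (\<lambda>i j. if i < d \<and> j < d then (\<Sum>k<d. M i k * N k j) mod Q else 0)"

definition mat_one_mod :: "nat \<Rightarrow> 'f::field poly \<Rightarrow> (nat \<Rightarrow> nat \<Rightarrow> 'f poly)" where
  "mat_one_mod d Q = (\<lambda>i j. if i < d \<and> j < d \<and> i = j then 1 mod Q else 0)"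

definition GL_mod :: "nat \<Rightarrow> 'f::field poly \<Rightarrow> (nat \<Rightarrow> nat \<Rightarrow> 'f poly) monoid" where
  "GL_mod d Q = \<lparr> carrier = {M \<in> mat_red d Q. \<exists>N \<in> mat_red d Q.
        mat_mult_mod d Q M N = mat_one_mod d Q \<and> mat_mult_mod d Q N M = mat_one_mod d Q},
     mult = mat_mult_mod d Q, one = mat_one_mod d Q \<rparr>"

end

theory Submission
  imports Defs "HOL-Library.Function_Algebras" "HOL-Library.Multiset"
begin

text \<open>
  Write \<open>E\<close> for the etale part of \<open>\<psi>\<close> at \<open>P ^ n\<close>, \<open>V\<close> for its set of roots, \<open>k\<close> for the algebraic closure
  of the prime field and \<open>m = r - 1\<close>. Then \<open>V\<close> is free of rank \<open>m\<close> over \<open>A / P ^ n\<close>, so what has to be shown is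
  that every basis of \<open>V\<close> is the image of a fixed basis \<open>x\<close> under an automorphism over \<open>k(g)\<close>, i.e. that any two
  bases satisfy the same polynomial relations over \<open>k[g]\<close>.

  Let \<open>g0\<close> be a supersingular point, so that \<open>E\<close> specializes to a power of \<open>X\<close> and all torsion points reduce to
  \<open>0\<close>. Comparing coefficients in \<open>\<psi>\<^sub>t \<circ> E = E \<circ> \<psi>'\<^sub>t\<close>, where \<open>\<psi>'\<close> is the Frobenius twist of \<open>\<psi>\<close>, shows
  \<open>g - g0\<close> to lie in the ideal generated by \<open>x\<close> up to higher order terms. Hence \<open>x\<close> is a system of local
  coordinates of \<open>k[g, x]\<close> at \<open>(g0, 0)\<close>, and by dimension it is analytically independent over \<open>k\<close>.
  Now expand an element of the subring of a product of two fields generated by the pairs \<open>(g, g)\<close> and \<open>(x, x')\<close>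
  as a power series in \<open>(x, x')\<close>: if its first component vanishes, then so do all coefficients, and the second
  component lies in all powers of the ideal \<open>(g - g0, x')\<close>, whose intersection is \<open>0\<close>.

  A supersingular point exists since the coefficients \<open>H i\<close> of \<open>\<psi>\<^sub>P\<close> at the exponents \<open>q ^ (i * d)\<close> are
  algebraically independent, so that the specialization \<open>H i \<mapsto> 0\<close> extends to a place, which is finite at \<open>g\<close>.
\<close>

section \<open>Subrings, monomials and powers of ideals\<close>

text \<open>That automorphisms embed into matrices is formal; only their existence needs geometry.
  At \<open>g0\<close> all torsion points collapse to 0, so a power series in torsion coordinates
  cannot tell two bases apart. Completions are replaced by congruences modulo powers of an ideal
  (\<open>filt\<close>), which make sense in a field and also in the product of two fields, with its
  zero divisors. What a completion would supply, separatedness and dimension, both comes from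
  \<open>order_bound\<close>. Each x j satisfies a monic equation over k[g] whose lower coefficients
  vanish at \<open>g0\<close>. Hence an element of k[g] that lies in a high power of the ideal
  vanishes to high order at \<open>g0\<close>, up to a linear factor and a constant. The order of a
  nonzero polynomial is finite and at most its degree: finiteness gives separatedness after passing
  from k[g, x] to k[g], and the degree bound turns the dimension into a count of monomials. The
  auxiliary variable T makes this order that of a polynomial in one variable. The place yielding
  \<open>g0\<close> takes values in the large field \<open>'a\<close>. That these values lie in
  \<open>k\<close> is recovered afterwards, because \<psi>_t at \<open>g0\<close> commutes with a
  power of Frobenius.\<close>

definition is_subring :: "'r::comm_ring_1 set \<Rightarrow> bool" where
  "is_subring R \<longleftrightarrow> 0 \<in> R \<and> 1 \<in> R \<and> (\<forall>x\<in>R. \<forall>y\<in>R. x + y \<in> R \<and> x * y \<in> R) \<and> (\<forall>x\<in>R. - x \<in> R)"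

lemma is_subringD:
  assumes "is_subring R"
  shows "0 \<in> R" "1 \<in> R" "x \<in> R \<Longrightarrow> y \<in> R \<Longrightarrow> x + y \<in> R"
    "x \<in> R \<Longrightarrow> y \<in> R \<Longrightarrow> x * y \<in> R" "x \<in> R \<Longrightarrow> - x \<in> R"
    "x \<in> R \<Longrightarrow> y \<in> R \<Longrightarrow> x - y \<in> R" "x \<in> R \<Longrightarrow> x ^ n \<in> R"
proof -
  show "0 \<in> R" "1 \<in> R" "x \<in> R \<Longrightarrow> y \<in> R \<Longrightarrow> x + y \<in> R"
    "x \<in> R \<Longrightarrow> y \<in> R \<Longrightarrow> x * y \<in> R" "x \<in> R \<Longrightarrow> - x \<in> R"
    using assms by (auto simp: is_subring_def)
  show "x \<in> R \<Longrightarrow> y \<in> R \<Longrightarrow> x - y \<in> R"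
    using assms by (metis is_subring_def diff_conv_add_uminus)
  show "x \<in> R \<Longrightarrow> x ^ n \<in> R"
    using assms by (induction n) (auto simp: is_subring_def)
qed

lemma subring_sum:
  assumes "is_subring R" "\<And>i. i \<in> A \<Longrightarrow> f i \<in> R"
  shows "(\<Sum>i\<in>A. f i) \<in> R"
  using assms(2) by (induction A rule: infinite_finite_induct) (auto intro: is_subringD[OF assms(1)])

lemma subring_prod:
  assumes "is_subring R" "\<And>i. i \<in> A \<Longrightarrow> f i \<in> R"
  shows "(\<Prod>i\<in>A. f i) \<in> R"
  using assms(2) by (induction A rule: infinite_finite_induct) (auto intro: is_subringD[OF assms(1)])

lemma subfield_subring: "is_subfield F \<Longrightarrow> is_subring F"
  by (auto simp: is_subfield_def is_subring_def)

inductive_set ring_hull :: "'r::comm_ring_1 set \<Rightarrow> 'r set" for S where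
  base: "x \<in> S \<Longrightarrow> x \<in> ring_hull S"
| zero: "0 \<in> ring_hull S"
| one: "1 \<in> ring_hull S"
| uminus: "x \<in> ring_hull S \<Longrightarrow> - x \<in> ring_hull S"
| add: "x \<in> ring_hull S \<Longrightarrow> y \<in> ring_hull S \<Longrightarrow> x + y \<in> ring_hull S"
| mult: "x \<in> ring_hull S \<Longrightarrow> y \<in> ring_hull S \<Longrightarrow> x * y \<in> ring_hull S"

lemma subring_ring_hull: "is_subring (ring_hull S)"
  by (auto simp: is_subring_def intro: ring_hull.intros)

lemma ring_hull_subset: "is_subring R \<Longrightarrow> S \<subseteq> R \<Longrightarrow> ring_hull S \<subseteq> R"
proof
  fix x assume "is_subring R" "S \<subseteq> R" "x \<in> ring_hull S"
  from this(3,1,2) show "x \<in> R"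
    by (induction) (auto simp: is_subringD)
qed

text \<open>Gaussian elimination without division: an equation is cleared by cross-multiplying with
  a pivot, so the solution stays in the subring \<open>R\<close> rather than in its fraction field.
  It is used over k[g], which is not a field, and over \<open>k\<close>.\<close>

lemma homogeneous_system_solvable:
  fixes A :: "'b \<Rightarrow> 't \<Rightarrow> 'r::idom"
  assumes R: "is_subring R" and "finite T" "finite B" "card T < card B"
    and "\<And>b t. b \<in> B \<Longrightarrow> t \<in> T \<Longrightarrow> A b t \<in> R"
  shows "\<exists>c. (\<forall>b\<in>B. c b \<in> R) \<and> (\<exists>b\<in>B. c b \<noteq> 0) \<and> (\<forall>t\<in>T. (\<Sum>b\<in>B. c b * A b t) = 0)"
  using assms(2-)
proof (induction T arbitrary: A B rule: finite_induct)
  case empty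
  then obtain b where "b \<in> B" by fastforce
  then show ?case by (intro exI[of _ "\<lambda>_. 1"]) (auto simp: is_subringD[OF R])
next
  case (insert t0 T A B)
  show ?case
  proof (cases "\<forall>b\<in>B. A b t0 = 0")
    case True
    from insert.IH[of B A] insert.prems insert.hyps obtain c where
      "\<forall>b\<in>B. c b \<in> R" "\<exists>b\<in>B. c b \<noteq> 0" "\<forall>t\<in>T. (\<Sum>b\<in>B. c b * A b t) = 0"
      by (auto simp: less_Suc_eq)
    then show ?thesis using True by (intro exI[of _ c]) auto
  next
    case False
    then obtain b0 where b0: "b0 \<in> B" "A b0 t0 \<noteq> 0" by auto
    define B' where "B' = B - {b0}"
    have B': "finite B'" "B = insert b0 B'" "b0 \<notin> B'" using b0 insert.prems by (auto simp: B'_def)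
    define A' where "A' b t = A b0 t0 * A b t - A b t0 * A b0 t" for b t
    have "\<exists>c. (\<forall>b\<in>B'. c b \<in> R) \<and> (\<exists>b\<in>B'. c b \<noteq> 0) \<and> (\<forall>t\<in>T. (\<Sum>b\<in>B'. c b * A' b t) = 0)"
      using insert.prems insert.hyps B' b0
      by (intro insert.IH) (auto simp: A'_def intro!: is_subringD[OF R])
    then obtain c where c: "\<forall>b\<in>B'. c b \<in> R" "\<exists>b\<in>B'. c b \<noteq> 0" "\<forall>t\<in>T. (\<Sum>b\<in>B'. c b * A' b t) = 0"
      by blast
    \<comment> \<open>The value at the pivot index \<open>b0\<close> solves the equation
      \<open>t0\<close>; scaling the other values by the pivot avoids dividing by it.\<close>
    define c' where "c' b = (if b = b0 then - (\<Sum>b\<in>B'. c b * A b t0) else A b0 t0 * c b)" for b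
    have c'_sum: "(\<Sum>b\<in>B. c' b * A b t) = (\<Sum>b\<in>B'. c b * A' b t)" for t
    proof -
      have "(\<Sum>b\<in>B. c' b * A b t) = c' b0 * A b0 t + (\<Sum>b\<in>B'. c' b * A b t)"
        using B' by simp
      also have "(\<Sum>b\<in>B'. c' b * A b t) = (\<Sum>b\<in>B'. A b0 t0 * c b * A b t)"
        using B' by (intro sum.cong) (auto simp: c'_def)
      finally show ?thesis
        by (simp add: c'_def A'_def algebra_simps sum_subtractf sum_distrib_left)
    qed
    have "\<forall>b\<in>B. c' b \<in> R" using c(1) b0 insert.prems B'
      by (auto simp: c'_def intro!: is_subringD[OF R] subring_sum[OF R])
    moreover have "\<exists>b\<in>B. c' b \<noteq> 0" using c(2) b0 B' by (auto simp: c'_def)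
    moreover have "(\<Sum>b\<in>B. c' b * A b t) = 0" if "t \<in> insert t0 T" for t
      using that c(3) by (auto simp: c'_sum A'_def algebra_simps)
    ultimately show ?thesis by blast
  qed
qed

section \<open>Monomials with exponent functions, and boxes of exponents\<close>

definition mpow :: "'i set \<Rightarrow> ('i \<Rightarrow> 'r::comm_ring_1) \<Rightarrow> ('i \<Rightarrow> nat) \<Rightarrow> 'r" where
  "mpow I x e = (\<Prod>i\<in>I. x i ^ e i)"

definition exps :: "'i set \<Rightarrow> ('i \<Rightarrow> nat) set" where
  "exps I = {e. \<forall>i. i \<notin> I \<longrightarrow> e i = 0}"

definition tdeg :: "'i set \<Rightarrow> ('i \<Rightarrow> nat) \<Rightarrow> nat" where
  "tdeg I e = (\<Sum>i\<in>I. e i)"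

definition box :: "'i set \<Rightarrow> ('i \<Rightarrow> nat) \<Rightarrow> ('i \<Rightarrow> nat) set" where
  "box I f = {e \<in> exps I. \<forall>i\<in>I. e i < f i}"

lemma mpow_add: "mpow I x (e + f) = mpow I x e * mpow I x f"
  by (simp add: mpow_def power_add prod.distrib)

lemma mpow_0: "mpow I x (\<lambda>_. 0) = 1"
  by (simp add: mpow_def)

lemma tdeg_add: "tdeg I (e + f) = tdeg I e + tdeg I f"
  by (simp add: tdeg_def sum.distrib)

lemma exps_add: "e \<in> exps I \<Longrightarrow> f \<in> exps I \<Longrightarrow> e + f \<in> exps I"
  by (auto simp: exps_def)

lemma box_insert:
  assumes "i \<notin> I"
  shows "box (insert i I) f = (\<lambda>(e, v). e(i := v)) ` (box I f \<times> {..<f i})"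
proof (intro Set.set_eqI iffI)
  fix e assume e: "e \<in> box (insert i I) f"
  then have "e(i := 0) \<in> box I f" "e i < f i" using assms by (auto simp: box_def exps_def)
  then show "e \<in> (\<lambda>(e, v). e(i := v)) ` (box I f \<times> {..<f i})"
    by (intro image_eqI[of _ _ "(e(i := 0), e i)"]) auto
next
  fix e assume "e \<in> (\<lambda>(e, v). e(i := v)) ` (box I f \<times> {..<f i})"
  then show "e \<in> box (insert i I) f" using assms by (auto simp: box_def exps_def)
qed

lemma finite_card_box:
  assumes "finite I"
  shows "finite (box I f) \<and> card (box I f) = (\<Prod>i\<in>I. f i)"
  using assms
proof (induction I)
  case empty
  have "box {} f = {\<lambda>_. 0}" by (auto simp: box_def exps_def)
  then show ?case by simp
next
  case (insert i I)
  have "inj_on (\<lambda>(e, v). e(i := v)) (box I f \<times> {..<f i})"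
  proof (rule inj_onI, clarify)
    fix e v e' v' assume *: "e \<in> box I f" "e' \<in> box I f" "e(i := v) = e'(i := v')"
    have "v = v'" using *(3) by (metis fun_upd_same)
    moreover have "e = e'"
    proof
      fix j show "e j = e' j"
        using * insert.hyps by (cases "j = i") (auto simp: box_def exps_def dest: fun_cong[of _ _ j])
    qed
    ultimately show "e = e' \<and> v = v'" by simp
  qed
  then show ?case using insert by (simp add: box_insert card_image card_cartesian_product mult.commute)
qed

lemma le_tdeg: "finite I \<Longrightarrow> i \<in> I \<Longrightarrow> e i \<le> tdeg I e"
  unfolding tdeg_def by (rule member_le_sum) auto

lemma finite_tdeg_less: "finite I \<Longrightarrow> finite {e \<in> exps I. tdeg I e < l}"
  by (rule finite_subset[of _ "box I (\<lambda>_. l)"])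
     (use finite_card_box[of I "\<lambda>_. l"] in \<open>auto simp: box_def dest: le_tdeg intro: le_less_trans\<close>)

lemma finite_tdeg_eq: "finite I \<Longrightarrow> finite {e \<in> exps I. tdeg I e = l}"
  by (rule finite_subset[OF _ finite_tdeg_less[of I "Suc l"]]) auto

lemma mon_sum_mult:
  fixes x :: "'i \<Rightarrow> 'r::comm_ring_1"
  assumes K: "is_subring K" and S: "finite S" "finite S'" and T: "finite T" "\<And>e f. e \<in> S \<Longrightarrow> f \<in> S' \<Longrightarrow> e + f \<in> T"
    and c: "\<And>e. c e \<in> K" "\<And>e. d e \<in> K"
  shows "\<exists>b. (\<forall>e. b e \<in> K) \<and>
    (\<Sum>e\<in>S. c e * mpow I x e) * (\<Sum>e\<in>S'. d e * mpow I x e) = (\<Sum>e\<in>T. b e * mpow I x e)"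
proof -
  define b where "b h = (\<Sum>p\<in>{p \<in> S \<times> S'. fst p + snd p = h}. c (fst p) * d (snd p))" for h
  have "(\<Sum>e\<in>S. c e * mpow I x e) * (\<Sum>e\<in>S'. d e * mpow I x e)
      = (\<Sum>p\<in>S \<times> S'. c (fst p) * d (snd p) * mpow I x (fst p + snd p))"
    by (simp add: sum_product sum.cartesian_product mpow_add case_prod_unfold ac_simps)
  also have "\<dots> = (\<Sum>h\<in>T. \<Sum>p\<in>{p \<in> S \<times> S'. fst p + snd p = h}. c (fst p) * d (snd p) * mpow I x (fst p + snd p))"
    using S T by (intro sum.group[symmetric]) auto
  also have "\<dots> = (\<Sum>h\<in>T. b h * mpow I x h)"
    by (intro sum.cong refl) (auto simp: b_def sum_distrib_right intro!: sum.cong)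
  finally show ?thesis using c
    by (intro exI[of _ b]) (auto simp: b_def intro!: subring_sum[OF K] is_subringD[OF K])
qed

lemma ring_hull_mon_expansion:
  fixes x :: "'i \<Rightarrow> 'r::comm_ring_1"
  assumes K: "is_subring K" and I: "finite I" and y: "y \<in> ring_hull (K \<union> x ` I)"
  shows "\<exists>S c. finite S \<and> S \<subseteq> exps I \<and> (\<forall>e. c e \<in> K) \<and> y = (\<Sum>e\<in>S. c e * mpow I x e)"
  using y
proof (induction rule: ring_hull.induct)
  case (base y)
  show ?case
  proof (cases "y \<in> K")
    case True
    then show ?thesis
      by (intro exI[of _ "{\<lambda>_. 0}"] exI[of _ "\<lambda>_. y"]) (auto simp: exps_def mpow_0)
  next
    case False
    then obtain i where i: "i \<in> I" "y = x i" using base by auto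
    have "mpow I x (\<lambda>j. if j = i then 1 else 0) = (\<Prod>j\<in>I. if j = i then x j else 1)"
      unfolding mpow_def by (intro prod.cong) auto
    also have "\<dots> = x i" using i I by (subst prod.delta) auto
    finally show ?thesis using i
      by (intro exI[of _ "{\<lambda>j. if j = i then 1 else 0}"] exI[of _ "\<lambda>_. 1"]) (auto simp: exps_def is_subringD[OF K])
  qed
next
  case zero
  show ?case by (intro exI[of _ "{}"] exI[of _ "\<lambda>_. 0"]) (auto simp: is_subringD[OF K])
next
  case one
  show ?case by (intro exI[of _ "{\<lambda>_. 0}"] exI[of _ "\<lambda>_. 1"]) (auto simp: exps_def mpow_0 is_subringD[OF K])
next
  case (uminus y)
  then obtain S c where "finite S" "S \<subseteq> exps I" "\<forall>e. c e \<in> K" "y = (\<Sum>e\<in>S. c e * mpow I x e)" by blast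
  then show ?case by (intro exI[of _ S] exI[of _ "\<lambda>e. - c e"]) (auto simp: sum_negf is_subringD[OF K])
next
  case (add y z)
  then obtain S c S' c' where s: "finite S" "S \<subseteq> exps I" "\<forall>e. c e \<in> K" "y = (\<Sum>e\<in>S. c e * mpow I x e)"
    "finite S'" "S' \<subseteq> exps I" "\<forall>e. c' e \<in> K" "z = (\<Sum>e\<in>S'. c' e * mpow I x e)" by blast
  have "y = (\<Sum>e\<in>S \<union> S'. (if e \<in> S then c e else 0) * mpow I x e)"
    unfolding s by (rule sum.mono_neutral_cong_left) (use s in auto)
  moreover have "z = (\<Sum>e\<in>S \<union> S'. (if e \<in> S' then c' e else 0) * mpow I x e)"
    unfolding s by (rule sum.mono_neutral_cong_left) (use s in auto)
  ultimately have "y + z = (\<Sum>e\<in>S \<union> S'. ((if e \<in> S then c e else 0) + (if e \<in> S' then c' e else 0)) * mpow I x e)"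
    by (simp add: sum.distrib distrib_right)
  then show ?case using s
    by (intro exI[of _ "S \<union> S'"] exI[of _ "\<lambda>e. (if e \<in> S then c e else 0) + (if e \<in> S' then c' e else 0)"])
       (auto intro!: is_subringD[OF K])
next
  case (mult y z)
  then obtain S c S' c' where s: "finite S" "S \<subseteq> exps I" "\<forall>e. c e \<in> K" "y = (\<Sum>e\<in>S. c e * mpow I x e)"
    "finite S'" "S' \<subseteq> exps I" "\<forall>e. c' e \<in> K" "z = (\<Sum>e\<in>S'. c' e * mpow I x e)" by blast
  let ?T = "(\<lambda>(e, f). e + f) ` (S \<times> S')"
  have "\<exists>b. (\<forall>e. b e \<in> K) \<and> y * z = (\<Sum>e\<in>?T. b e * mpow I x e)"
    unfolding s(4,8) using s by (intro mon_sum_mult[OF K]) auto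
  then obtain b where b: "\<forall>e. b e \<in> K" "y * z = (\<Sum>e\<in>?T. b e * mpow I x e)" by blast
  have "finite ?T" "?T \<subseteq> exps I" using s by (auto intro!: exps_add)
  with b show ?case by blast
qed

text \<open>\<open>filt K Z l\<close> is the \<open>l\<close>-th power of the ideal generated by \<open>Z\<close> in the ring \<open>K[Z]\<close>.\<close>

inductive filt :: "'r::comm_ring_1 set \<Rightarrow> 'r set \<Rightarrow> nat \<Rightarrow> 'r \<Rightarrow> bool" for K Z where
  const: "c \<in> K \<Longrightarrow> filt K Z 0 c"
| gen: "z \<in> Z \<Longrightarrow> filt K Z 1 z"
| zero: "filt K Z l 0"
| add: "filt K Z l x \<Longrightarrow> filt K Z l y \<Longrightarrow> filt K Z l (x + y)"
| mult: "filt K Z l x \<Longrightarrow> filt K Z l' y \<Longrightarrow> filt K Z (l + l') (x * y)"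
| weaken: "filt K Z (Suc l) x \<Longrightarrow> filt K Z l x"

section \<open>Calculus of congruences modulo powers of an ideal\<close>

lemma filt_mono: "filt K Z l x \<Longrightarrow> l' \<le> l \<Longrightarrow> filt K Z l' x"
proof (induction "l - l'" arbitrary: l)
  case (Suc n)
  then obtain l0 where "l = Suc l0" "l' \<le> l0" by (cases l) auto
  with Suc show ?case by (metis Suc_diff_le diff_Suc_Suc filt.weaken nat.inject)
qed simp

lemma filt_power: "filt K Z 1 x \<Longrightarrow> K \<noteq> {} \<Longrightarrow> is_subring K \<Longrightarrow> filt K Z n (x ^ n)"
proof (induction n)
  case 0 then show ?case by (auto intro: filt.const simp: is_subringD)
next
  case (Suc n) then show ?case using filt.mult[of K Z 1 x n "x ^ n"] by simp
qed

context
  fixes K Z :: "'r::comm_ring_1 set"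
  assumes K: "is_subring K"
begin

lemma filt_uminus: "filt K Z l x \<Longrightarrow> filt K Z l (- x)"
  using filt.mult[of K Z 0 "-1" l x] filt.const[of "-1" K Z] is_subringD[OF K] by simp

lemma filt_diff: "filt K Z l x \<Longrightarrow> filt K Z l y \<Longrightarrow> filt K Z l (x - y)"
  using filt.add[of K Z l x "- y"] filt_uminus[of l y] by simp

lemma filt_sum: "(\<And>i. i \<in> A \<Longrightarrow> filt K Z l (f i)) \<Longrightarrow> filt K Z l (\<Sum>i\<in>A. f i)"
  by (induction A rule: infinite_finite_induct) (auto intro: filt.zero filt.add)

lemma filt_mult_left: "filt K Z 0 x \<Longrightarrow> filt K Z l y \<Longrightarrow> filt K Z l (x * y)"
  using filt.mult[of K Z 0 x l y] by simp

lemma filt_mult_right: "filt K Z l x \<Longrightarrow> filt K Z 0 y \<Longrightarrow> filt K Z l (x * y)"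
  using filt.mult[of K Z l x 0 y] by simp

lemma filt_cmult: "c \<in> K \<Longrightarrow> filt K Z l y \<Longrightarrow> filt K Z l (c * y)"
  by (intro filt_mult_left filt.const)

lemma filt_subring: "is_subring {x. filt K Z 0 x}"
  unfolding is_subring_def
  by (auto intro: filt.zero filt.const filt.add filt_uminus filt_mult_left is_subringD[OF K])

text \<open>The ring is \<open>K\<close> plus the ideal; for a product, xy - cd = (x - c) y + c (y -
  d).\<close>

lemma filt_0_split: "filt K Z l x \<Longrightarrow> \<exists>c\<in>K. filt K Z 1 (x - c)"
proof (induction rule: filt.induct)
  case (const c) then show ?case by (intro bexI[of _ c]) (auto intro: filt.zero)
next
  case (gen z) then show ?case by (intro bexI[of _ 0]) (auto intro: filt.gen[simplified] is_subringD[OF K])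
next
  case (zero l) then show ?case by (intro bexI[of _ 0]) (auto intro: filt.zero is_subringD[OF K])
next
  case (add l x y)
  then obtain c d where "c \<in> K" "d \<in> K" "filt K Z 1 (x - c)" "filt K Z 1 (y - d)" by blast
  then show ?case using filt.add[of K Z 1 "x - c" "y - d"]
    by (intro bexI[of _ "c + d"]) (auto intro: is_subringD[OF K] simp: algebra_simps)
next
  case (mult l x l' y)
  then obtain c d where cd: "c \<in> K" "d \<in> K" "filt K Z 1 (x - c)" "filt K Z 1 (y - d)" by blast
  have "filt K Z 0 y" using mult.hyps(2) filt_mono by blast
  then have "filt K Z 1 ((x - c) * y + c * (y - d))"
    using cd by (intro filt.add filt_mult_right filt_cmult) auto
  then show ?case using cd
    by (intro bexI[of _ "c * d"]) (auto intro: is_subringD[OF K] simp: algebra_simps)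
qed

lemma filt_mon:
  assumes "finite J" "\<And>j. j \<in> J \<Longrightarrow> x j \<in> Z"
  shows "filt K Z (tdeg J e) (mpow J x e)"
  using assms
proof (induction J rule: finite_induct)
  case empty then show ?case by (auto simp: tdeg_def mpow_def intro: filt.const is_subringD[OF K])
next
  case (insert j J)
  then have "filt K Z (e j) (x j ^ e j)" using K
    by (intro filt_power filt.gen) (auto dest: is_subringD)
  then show ?case using insert filt.mult[of K Z "e j" "x j ^ e j" "tdeg J e" "mpow J x e"]
    by (simp add: tdeg_def mpow_def)
qed

lemma filt_mon_sum:
  assumes "finite J" "\<And>j. j \<in> J \<Longrightarrow> x j \<in> Z" "\<And>e. e \<in> S \<Longrightarrow> c e \<in> K \<and> l \<le> tdeg J e"
  shows "filt K Z l (\<Sum>e\<in>S. c e * mpow J x e)"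
  using assms by (intro filt_sum filt_cmult filt_mono[OF filt_mon]) auto

text \<open>Nakayama: if the generators agree with combinations of the \<open>x j\<close> modulo the square of the
  ideal, then the monomials of degree \<open>l\<close> span the \<open>l\<close>-th graded piece.\<close>

lemma filt_leading_form:
  assumes J: "finite J" and xZ: "\<And>j. j \<in> J \<Longrightarrow> x j \<in> Z"
    and Z: "\<And>z. z \<in> Z \<Longrightarrow> \<exists>b. (\<forall>j\<in>J. filt K Z 0 (b j)) \<and> filt K Z 2 (z - (\<Sum>j\<in>J. x j * b j))"
  shows "filt K Z l a \<Longrightarrow> \<exists>c. (\<forall>e. c e \<in> K) \<and>
    filt K Z (Suc l) (a - (\<Sum>e | e \<in> exps J \<and> tdeg J e = l. c e * mpow J x e))"
proof (induction rule: filt.induct)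
  case (const c)
  have "{e \<in> exps J. tdeg J e = 0} = {\<lambda>_. 0}"
    using J by (auto simp: exps_def tdeg_def fun_eq_iff)
  then show ?case using const by (intro exI[of _ "\<lambda>_. c"]) (auto simp: mpow_0 intro: filt.zero)
next
  case (gen z)
  from Z[OF this] obtain b where b: "\<forall>j\<in>J. filt K Z 0 (b j)" "filt K Z 2 (z - (\<Sum>j\<in>J. x j * b j))" by blast
  have "\<forall>j\<in>J. \<exists>c. c \<in> K \<and> filt K Z 1 (b j - c)" using b filt_0_split by blast
  then obtain c where c: "\<forall>j\<in>J. c j \<in> K \<and> filt K Z 1 (b j - c j)" by metis
  define \<delta> :: "'a \<Rightarrow> 'a \<Rightarrow> nat" where "\<delta> j = (\<lambda>i. if i = j then 1 else 0)" for j
  have \<delta>: "mpow J x (\<delta> j) = x j" if "j \<in> J" for j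
  proof -
    have "mpow J x (\<delta> j) = (\<Prod>i\<in>J. if i = j then x i else 1)"
      unfolding mpow_def \<delta>_def by (intro prod.cong) auto
    then show ?thesis using that J by (simp add: prod.delta)
  qed
  have inj: "inj_on \<delta> J" by (auto simp: inj_on_def \<delta>_def fun_eq_iff split: if_splits)
  have img: "{e \<in> exps J. tdeg J e = 1} = \<delta> ` J"
  proof (intro Set.set_eqI iffI)
    fix e assume e: "e \<in> {e \<in> exps J. tdeg J e = 1}"
    then have "(\<Sum>i\<in>J. e i) = Suc 0" by (simp add: tdeg_def)
    then obtain j where j: "j \<in> J" "e j = 1" "\<forall>i\<in>J. i \<noteq> j \<longrightarrow> e i = 0"
      using J by (metis One_nat_def sum_eq_1_iff)
    then have "e = \<delta> j" using e by (auto simp: \<delta>_def exps_def fun_eq_iff)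
    then show "e \<in> \<delta> ` J" using j by blast
  next
    fix e assume "e \<in> \<delta> ` J"
    then obtain j where j: "j \<in> J" "e = \<delta> j" by blast
    then have "tdeg J e = 1" using J by (simp add: tdeg_def \<delta>_def sum.delta)
    then show "e \<in> {e \<in> exps J. tdeg J e = 1}" using j by (auto simp: exps_def \<delta>_def)
  qed
  define c' where "c' e = (if e \<in> \<delta> ` J then c (the_inv_into J \<delta> e) else 0)" for e
  have "(\<Sum>e | e \<in> exps J \<and> tdeg J e = 1. c' e * mpow J x e) = (\<Sum>j\<in>J. c j * x j)"
    unfolding img by (subst sum.reindex[OF inj]) (auto simp: c'_def the_inv_into_f_f[OF inj] \<delta> intro!: sum.cong)
  then have "z - (\<Sum>e | e \<in> exps J \<and> tdeg J e = 1. c' e * mpow J x e)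
     = (z - (\<Sum>j\<in>J. x j * b j)) + (\<Sum>j\<in>J. x j * (b j - c j))"
    by (simp add: algebra_simps sum_subtractf)
  moreover have "filt K Z 2 (x j * (b j - c j))" if "j \<in> J" for j
    using filt.mult[OF filt.gen[OF xZ[OF that]], of K 1 "b j - c j"] c that by (simp add: numeral_2_eq_2)
  then have "filt K Z 2 ((z - (\<Sum>j\<in>J. x j * b j)) + (\<Sum>j\<in>J. x j * (b j - c j)))"
    using b by (intro filt.add filt_sum)
  moreover have "c' e \<in> K" for e
    using c by (auto simp: c'_def the_inv_into_f_f[OF inj] is_subringD[OF K])
  ultimately have "filt K Z (Suc 1) (z - (\<Sum>e | e \<in> exps J \<and> tdeg J e = 1. c' e * mpow J x e))" "\<forall>e. c' e \<in> K"
    by (auto simp only: numeral_2_eq_2 One_nat_def)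
  then show ?case by blast
next
  case (zero l)
  then show ?case by (intro exI[of _ "\<lambda>_. 0"]) (auto intro: filt.zero is_subringD[OF K])
next
  case (add l a a')
  then obtain c c' where c: "\<forall>e. c e \<in> K" "\<forall>e. c' e \<in> K"
    "filt K Z (Suc l) (a - (\<Sum>e | e \<in> exps J \<and> tdeg J e = l. c e * mpow J x e))"
    "filt K Z (Suc l) (a' - (\<Sum>e | e \<in> exps J \<and> tdeg J e = l. c' e * mpow J x e))" by blast
  show ?case using c filt.add[OF c(3,4)]
    by (intro exI[of _ "\<lambda>e. c e + c' e"])
       (auto intro: is_subringD[OF K] simp: algebra_simps sum.distrib)
next
  case (mult l a l' a')
  then obtain c c' where c: "\<forall>e. c e \<in> K" "\<forall>e. c' e \<in> K"
    "filt K Z (Suc l) (a - (\<Sum>e | e \<in> exps J \<and> tdeg J e = l. c e * mpow J x e))"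
    "filt K Z (Suc l') (a' - (\<Sum>e | e \<in> exps J \<and> tdeg J e = l'. c' e * mpow J x e))" by blast
  let ?s = "\<Sum>e | e \<in> exps J \<and> tdeg J e = l. c e * mpow J x e"
  let ?s' = "\<Sum>e | e \<in> exps J \<and> tdeg J e = l'. c' e * mpow J x e"
  have "\<exists>b. (\<forall>e. b e \<in> K) \<and> ?s * ?s' = (\<Sum>e | e \<in> exps J \<and> tdeg J e = l + l'. b e * mpow J x e)"
    using c by (intro mon_sum_mult[OF K]) (auto simp: J finite_tdeg_eq exps_add tdeg_add)
  then obtain b where b: "\<forall>e. b e \<in> K" "?s * ?s' = (\<Sum>e | e \<in> exps J \<and> tdeg J e = l + l'. b e * mpow J x e)"
    by blast
  have "filt K Z l ?s" using c by (intro filt_mon_sum) (auto simp: J xZ)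
  then have "filt K Z (Suc (l + l')) ((a - ?s) * a' + ?s * (a' - ?s'))"
    using filt.mult[OF c(3) mult.hyps(2)] filt.mult[OF _ c(4), of l ?s] by (intro filt.add) auto
  then show ?case using b by (intro exI[of _ b]) (auto simp: algebra_simps)
next
  case (weaken l a)
  then show ?case by (intro exI[of _ "\<lambda>_. 0"]) (auto simp: is_subringD[OF K])
qed

text \<open>Truncated power series expansion, obtained by applying \<open>step\<close> to the
  remainder degree by degree. The exponent set \<open>S\<close> is a parameter because two versions
  are needed: with all exponents, and with those that survive a relation between leading
  forms.\<close>

lemma filt_expand:
  assumes J: "finite J" and xZ: "\<And>j. j \<in> J \<Longrightarrow> x j \<in> Z"
    and step: "\<And>l a. filt K Z l a \<Longrightarrow> \<exists>c. (\<forall>e. c e \<in> K) \<and>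
      filt K Z (Suc l) (a - (\<Sum>e | e \<in> S \<and> e \<in> exps J \<and> tdeg J e = l. c e * mpow J x e))"
    and a: "filt K Z 0 a"
  shows "\<exists>c. (\<forall>e. c e \<in> K) \<and> filt K Z l (a - (\<Sum>e | e \<in> S \<and> e \<in> exps J \<and> tdeg J e < l. c e * mpow J x e))"
proof (induction l)
  case 0
  then show ?case using a by (intro exI[of _ "\<lambda>_. 0"]) (auto simp: is_subringD[OF K])
next
  case (Suc l)
  let ?S = "\<lambda>l. {e. e \<in> S \<and> e \<in> exps J \<and> tdeg J e < l}" and ?T = "{e. e \<in> S \<and> e \<in> exps J \<and> tdeg J e = l}"
  from Suc obtain c where c: "\<forall>e. c e \<in> K" "filt K Z l (a - (\<Sum>e\<in>?S l. c e * mpow J x e))" by blast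
  from step[OF c(2)] obtain d where d: "\<forall>e. d e \<in> K"
    "filt K Z (Suc l) (a - (\<Sum>e\<in>?S l. c e * mpow J x e) - (\<Sum>e\<in>?T. d e * mpow J x e))" by blast
  define b where "b e = (if tdeg J e < l then c e else d e)" for e
  have "?S (Suc l) = ?S l \<union> ?T" by auto
  moreover have "finite (?S l)" "finite ?T" "?S l \<inter> ?T = {}"
    using finite_tdeg_less[OF J, of l] finite_tdeg_eq[OF J, of l] by (auto intro: finite_subset[rotated])
  ultimately have "(\<Sum>e\<in>?S (Suc l). b e * mpow J x e) = (\<Sum>e\<in>?S l. b e * mpow J x e) + (\<Sum>e\<in>?T. b e * mpow J x e)"
    by (simp add: sum.union_disjoint)
  also have "\<dots> = (\<Sum>e\<in>?S l. c e * mpow J x e) + (\<Sum>e\<in>?T. d e * mpow J x e)"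
    by (simp add: b_def)
  finally show ?case using c d by (intro exI[of _ b]) (auto simp: b_def algebra_simps)
qed

end

text \<open>Serves for the evaluation of a pair at one component and for the exchange of the two
  components.\<close>

lemma filt_hom:
  fixes h :: "'r::comm_ring_1 \<Rightarrow> 's::comm_ring_1"
  assumes h: "h 0 = 0" "\<And>x y. h (x + y) = h x + h y" "\<And>x y. h (x * y) = h x * h y"
    and KZ: "h ` K \<subseteq> K'" "h ` Z \<subseteq> Z'"
  shows "filt K Z l x \<Longrightarrow> filt K' Z' l (h x)"
proof (induction rule: filt.induct)
  case (weaken l x) then show ?case by (auto intro: filt.weaken)
qed (use KZ in \<open>auto simp: h intro: filt.intros(1-5) filt.gen[simplified]\<close>)

section \<open>Local coordinates at a point: intersection of the powers of the ideal\<close>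

lemma subring_image:
  assumes R: "is_subring R"
    and h: "h 0 = 0" "h 1 = 1" "\<And>x y. h (x + y) = h x + h y" "\<And>x y. h (x * y) = h x * h y" "\<And>x. h (- x) = - h x"
  shows "is_subring (h ` R)"
  unfolding is_subring_def
proof (intro conjI ballI)
  show "0 \<in> h ` R" "1 \<in> h ` R" using is_subringD(1,2)[OF R] h(1,2) by (metis imageI)+
next
  fix x y assume "x \<in> h ` R" "y \<in> h ` R"
  then show "x + y \<in> h ` R" "x * y \<in> h ` R"
    using is_subringD(3,4)[OF R] h(3,4) by (clarsimp, metis imageI)+
next
  fix x assume "x \<in> h ` R"
  then show "- x \<in> h ` R" using is_subringD(5)[OF R] h(5) by (clarsimp, metis imageI)
qed

lemma subring_const_polys: "is_subring k \<Longrightarrow> is_subring ((\<lambda>c. [:c:]) ` k)"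
  by (rule subring_image) auto

lemma poly_mon: "poly (mpow I G e) z = mpow I (\<lambda>i. poly (G i) z) e"
  by (simp add: mpow_def poly_prod)

text \<open>An element of the hull is a polynomial over \<open>k\<close> in the \<open>G i\<close>,
  and evaluation at 1 turns it into the same polynomial in the \<open>g i\<close>; algebraic
  independence kills its coefficients. Elements of k[g] therefore have unique lifts, whatever base
  point or weights the \<open>G i\<close> encode, and the order or degree of a lift is an invariant
  of the element.\<close>

lemma lift_inj:
  fixes g :: "nat \<Rightarrow> 'a::field"
  assumes k: "is_subfield k" and I: "finite I" and ind: "alg_indep k g I"
    and G: "\<And>i. i \<in> I \<Longrightarrow> poly (G i) 1 = g i"
    and F: "F \<in> ring_hull ((\<lambda>c. [:c:]) ` k \<union> G ` I)" "poly F 1 = 0"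
  shows "F = 0"
proof -
  let ?K = "(\<lambda>c. [:c:]) ` k"
  have K: "is_subring ?K" using k by (intro subring_const_polys subfield_subring)
  from ring_hull_mon_expansion[OF K I F(1)] obtain S c where
    S: "finite S" "S \<subseteq> exps I" "\<forall>e. c e \<in> ?K" "F = (\<Sum>e\<in>S. c e * mpow I G e)" by blast
  define c' where "c' e = coeff (c e) 0" for e
  have c': "c e = [:c' e:]" "c' e \<in> k" for e using S(3)[rule_format, of e] by (auto simp: c'_def)
  have "(\<Sum>e\<in>S. c' e * (\<Prod>i\<in>I. g i ^ e i)) = poly F 1"
    using G by (simp add: S(4) poly_sum c' mpow_def poly_prod)
  then have "finite S \<and> (\<forall>e\<in>S. \<forall>i. i \<notin> I \<longrightarrow> e i = 0) \<and> (\<forall>e\<in>S. c' e \<in> k) \<and>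
      (\<Sum>e\<in>S. c' e * (\<Prod>i\<in>I. g i ^ e i)) = 0"
    using S(1,2) F(2) c'(2) by (auto simp: exps_def)
  then have "\<forall>e\<in>S. c' e = 0"
    using ind unfolding alg_indep_def by blast
  then show ?thesis by (simp add: S(4) c')
qed

lemma base_expansion_unique:
  fixes b :: nat
  assumes "\<And>t. t < N \<Longrightarrow> e t < b" "\<And>t. t < N \<Longrightarrow> f t < b" "(\<Sum>t<N. e t * b ^ t) = (\<Sum>t<N. f t * b ^ t)" "t < N"
  shows "e t = f t"
  using assms
proof (induction N arbitrary: e f t)
  case (Suc N)
  have *: "(\<Sum>t<Suc N. e t * b ^ t) = e 0 + b * (\<Sum>t<N. e (Suc t) * b ^ t)" for e :: "nat \<Rightarrow> nat"
    by (subst sum.lessThan_Suc_shift) (simp add: sum_distrib_left ac_simps)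
  have eq: "e 0 + b * (\<Sum>t<N. e (Suc t) * b ^ t) = f 0 + b * (\<Sum>t<N. f (Suc t) * b ^ t)"
    using Suc.prems(3) by (simp only: *)
  then have "(e 0 + b * (\<Sum>t<N. e (Suc t) * b ^ t)) mod b = (f 0 + b * (\<Sum>t<N. f (Suc t) * b ^ t)) mod b"
    by simp
  then have e0: "e 0 = f 0" using Suc.prems(1,2)[of 0] by simp
  have "b > 0" using Suc.prems(1)[of 0] by simp
  then have "(\<Sum>t<N. e (Suc t) * b ^ t) = (\<Sum>t<N. f (Suc t) * b ^ t)" using eq e0 by simp
  then show ?case using Suc.IH[of "\<lambda>t. e (Suc t)" "\<lambda>t. f (Suc t)" "t - 1"] Suc.prems e0
    by (cases t) auto
qed simp

text \<open>The auxiliary variable records the order of vanishing at \<open>g0\<close>: it maps \<open>g i\<close> to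
  \<open>g0 i + (g i - g0 i) T\<close>, and \<open>T = 1\<close> recovers \<open>k[g]\<close>.\<close>

definition lifted :: "'a::field set \<Rightarrow> nat set \<Rightarrow> (nat \<Rightarrow> 'a) \<Rightarrow> (nat \<Rightarrow> 'a) \<Rightarrow> 'a poly set" where
  "lifted k I g g0 = ring_hull ((\<lambda>c. [:c:]) ` k \<union> (\<lambda>i. [:g0 i, g i - g0 i:]) ` I)"

text \<open>Geometrically, \<open>integral\<close> makes k[g, x] finite over k[g] with x = 0 as the
  only point above \<open>g0\<close>, since the equation of x j becomes x j ^ B = 0 at T = 0. The
  assumption \<open>param\<close> says that the x j span the cotangent space at that point. By
  \<open>cardI\<close> their number is the dimension.\<close>

locale local_coords =
  fixes k :: "'a::field set" and I J :: "nat set" and g x g0 :: "nat \<Rightarrow> 'a" and B :: nat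
  assumes k: "is_subfield k" and finI: "finite I" and finJ: "finite J" and cardI: "card I = card J" and J_ne: "J \<noteq> {}"
    and indep: "alg_indep k g I" and g0: "\<And>i. i \<in> I \<Longrightarrow> g0 i \<in> k"
    and integral: "\<And>j. j \<in> J \<Longrightarrow> \<exists>c. (\<forall>l<B. c l \<in> lifted k I g g0 \<and> [:0, 1:] dvd c l) \<and>
      x j ^ B = (\<Sum>l<B. poly (c l) 1 * x j ^ l)"
    and param: "\<And>i. i \<in> I \<Longrightarrow> \<exists>b. (\<forall>j\<in>J. filt k ((\<lambda>i. g i - g0 i) ` I \<union> x ` J) 0 (b j)) \<and>
      filt k ((\<lambda>i. g i - g0 i) ` I \<union> x ` J) 2 (g i - g0 i - (\<Sum>j\<in>J. x j * b j))"
begin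

section \<open>A filtration by the order of vanishing at the base point\<close>

abbreviation "Z \<equiv> (\<lambda>i. g i - g0 i) ` I \<union> x ` J"
abbreviation "Kt \<equiv> lifted k I g g0"
definition "kg = (\<lambda>F. poly F 1) ` Kt"
abbreviation "bx \<equiv> box J (\<lambda>_. B)"

text \<open>A filtration of k[g, x] that is read off from coefficients. Monomials with exponents
  below \<open>B\<close> span by \<open>integral\<close>. A factor x j counts 1 and an order of
  vanishing at \<open>g0\<close> counts \<open>B\<close>, the rate at which \<open>integral\<close>
  trades x j ^ B for a factor T. Coefficients need not be unique, so one good representation is all
  that is required.\<close>

definition U :: "nat \<Rightarrow> 'a set" where
  "U n = {\<Sum>e\<in>bx. poly (a e) 1 * mpow J x e | a. \<forall>e\<in>bx. a e \<in> Kt \<and> (\<exists>\<kappa>. [:0, 1:] ^ \<kappa> dvd a e \<and> n \<le> B * \<kappa> + tdeg J e)}"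

lemma U_E:
  assumes "u \<in> U n"
  obtains a where "\<forall>e\<in>bx. a e \<in> Kt \<and> (\<exists>\<kappa>. [:0, 1:] ^ \<kappa> dvd a e \<and> n \<le> B * \<kappa> + tdeg J e)"
    "u = (\<Sum>e\<in>bx. poly (a e) 1 * mpow J x e)"
  using assms unfolding U_def mem_Collect_eq by (elim exE conjE)

lemma k_subring: "is_subring k" using k by (rule subfield_subring)

lemma Kt_subring: "is_subring Kt" unfolding lifted_def by (rule subring_ring_hull)

lemma kg_subring: "is_subring kg"
  unfolding kg_def by (rule subring_image[OF Kt_subring]) auto

lemma kg_I: "F \<in> Kt \<Longrightarrow> poly F 1 \<in> kg"
  by (auto simp: kg_def)

lemma Kt_const: "c \<in> k \<Longrightarrow> [:c:] \<in> Kt"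
  unfolding lifted_def by (intro ring_hull.base) auto

lemma Kt_gen: "i \<in> I \<Longrightarrow> [:g0 i, g i - g0 i:] \<in> Kt"
  unfolding lifted_def by (intro ring_hull.base) auto

lemma Kt_inj: "F \<in> Kt \<Longrightarrow> poly F 1 = 0 \<Longrightarrow> F = 0"
  unfolding lifted_def by (rule lift_inj[OF k finI indep]) auto

lemma kg_filt: "y \<in> kg \<Longrightarrow> filt k Z 0 y"
proof -
  assume "y \<in> kg"
  then obtain F where F: "F \<in> Kt" "y = poly F 1" by (auto simp: kg_def)
  from F(1) have "filt k Z 0 (poly F 1)" unfolding lifted_def
  proof (induction rule: ring_hull.induct)
    case (base F)
    have "filt k Z 0 (g i)" if "i \<in> I" for i
      using filt.add[of k Z 0 "g i - g0 i" "g0 i"] that filt.weaken[of k Z 0 "g i - g0 i"]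
      by (auto intro: filt.gen[simplified] filt.const g0)
    with base show ?case by (auto intro: filt.const)
  qed (auto intro: is_subringD[OF filt_subring[OF k_subring], simplified])
  then show ?thesis using F by simp
qed

lemma B_pos: "B > 0"
proof (rule ccontr)
  assume "\<not> B > 0"
  moreover obtain j where "j \<in> J" using J_ne by auto
  ultimately show False using integral[of j] by auto
qed

lemma finite_bx: "finite bx" using finite_card_box[OF finJ] by blast

lemma zero_bx: "(\<lambda>_. 0) \<in> bx" using B_pos by (auto simp: box_def exps_def)

lemma bx_tdeg: "e \<in> bx \<Longrightarrow> tdeg J e \<le> card J * B"
  unfolding tdeg_def by (rule order.trans[OF sum_bounded_above[of _ _ B]]) (auto simp: box_def less_imp_le)

lemma U_add: "u \<in> U n \<Longrightarrow> v \<in> U n \<Longrightarrow> u + v \<in> U n"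
proof -
  assume uv: "u \<in> U n" "v \<in> U n"
  obtain a where a: "\<forall>e\<in>bx. a e \<in> Kt \<and> (\<exists>\<kappa>. [:0, 1:] ^ \<kappa> dvd a e \<and> n \<le> B * \<kappa> + tdeg J e)"
      "u = (\<Sum>e\<in>bx. poly (a e) 1 * mpow J x e)"
    using uv(1) by (rule U_E)
  obtain b where b: "\<forall>e\<in>bx. b e \<in> Kt \<and> (\<exists>\<kappa>. [:0, 1:] ^ \<kappa> dvd b e \<and> n \<le> B * \<kappa> + tdeg J e)"
      "v = (\<Sum>e\<in>bx. poly (b e) 1 * mpow J x e)"
    using uv(2) by (rule U_E)
  have "\<exists>\<kappa>. [:0, 1:] ^ \<kappa> dvd a e + b e \<and> n \<le> B * \<kappa> + tdeg J e" if "e \<in> bx" for e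
  proof -
    from a b that obtain k1 k2 where k12: "[:0, 1:] ^ k1 dvd a e" "n \<le> B * k1 + tdeg J e"
      "[:0, 1:] ^ k2 dvd b e" "n \<le> B * k2 + tdeg J e" by blast
    then have "[:0, 1:] ^ min k1 k2 dvd a e" "[:0, 1:] ^ min k1 k2 dvd b e"
      by (meson power_le_dvd min.cobounded1 min.cobounded2)+
    then show ?thesis using k12 by (intro exI[of _ "min k1 k2"]) (auto simp: min_def)
  qed
  then show ?thesis using a b unfolding U_def
    by (intro CollectI exI[of _ "\<lambda>e. a e + b e"]) (auto simp: sum.distrib distrib_right is_subringD[OF Kt_subring])
qed

lemma U_term:
  assumes "e \<in> bx" "a \<in> Kt" "[:0, 1:] ^ \<kappa> dvd a" "n \<le> B * \<kappa> + tdeg J e"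
  shows "poly a 1 * mpow J x e \<in> U n"
proof -
  define a' where "a' f = (if f = e then a else 0)" for f
  have "(\<Sum>f\<in>bx. poly (a' f) 1 * mpow J x f) = (\<Sum>f\<in>bx. if f = e then poly a 1 * mpow J x e else 0)"
    by (intro sum.cong) (auto simp: a'_def)
  also have "\<dots> = poly a 1 * mpow J x e" using assms finite_bx by simp
  finally have "poly a 1 * mpow J x e = (\<Sum>f\<in>bx. poly (a' f) 1 * mpow J x f)" by simp
  moreover have "\<exists>\<kappa>. [:0, 1:] ^ \<kappa> dvd a' f \<and> n \<le> B * \<kappa> + tdeg J f" for f
  proof (cases "f = e")
    case False
    \<comment> \<open>A zero coefficient is divisible by every power of T; the power
      \<open>n\<close> meets the bound because \<open>B\<close> is at least 1.\<close>
    then show ?thesis using B_pos by (intro exI[of _ n]) (auto simp: a'_def intro: trans_le_add1)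
  qed (use assms in \<open>auto simp: a'_def\<close>)
  ultimately show ?thesis using assms unfolding U_def
    by (intro CollectI exI[of _ a']) (auto simp: a'_def is_subringD[OF Kt_subring])
qed

lemma U_zero: "0 \<in> U n"
  using U_term[OF zero_bx, of 0 n n] B_pos by (simp add: is_subringD[OF Kt_subring] trans_le_add1)

lemma U_sum: "(\<And>i. i \<in> A \<Longrightarrow> f i \<in> U n) \<Longrightarrow> (\<Sum>i\<in>A. f i) \<in> U n"
  by (induction A rule: infinite_finite_induct) (auto intro: U_zero U_add)

lemma U_mult:
  assumes "u \<in> U n" and "\<And>e a \<kappa>. e \<in> bx \<Longrightarrow> a \<in> Kt \<Longrightarrow> [:0, 1:] ^ \<kappa> dvd a \<Longrightarrow> n \<le> B * \<kappa> + tdeg J e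
    \<Longrightarrow> y * (poly a 1 * mpow J x e) \<in> U n'"
  shows "y * u \<in> U n'"
proof -
  obtain a where a: "\<forall>e\<in>bx. a e \<in> Kt \<and> (\<exists>\<kappa>. [:0, 1:] ^ \<kappa> dvd a e \<and> n \<le> B * \<kappa> + tdeg J e)"
      "u = (\<Sum>e\<in>bx. poly (a e) 1 * mpow J x e)"
    using assms(1) by (rule U_E)
  show ?thesis unfolding a(2) sum_distrib_left using a(1) assms(2) by (intro U_sum) blast
qed

lemma mon_upd: "j \<in> J \<Longrightarrow> mpow J x (e(j := l)) = x j ^ l * mpow (J - {j}) x e"
  using finJ unfolding mpow_def by (subst prod.remove[of J j]) (auto intro!: prod.cong)

lemma mon_rem: "j \<in> J \<Longrightarrow> mpow J x e = x j ^ e j * mpow (J - {j}) x e"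
  using finJ unfolding mpow_def by (subst prod.remove[of J j]) auto

lemma tdeg_upd: "j \<in> J \<Longrightarrow> tdeg J (e(j := l)) + e j = tdeg J e + l"
proof -
  assume j: "j \<in> J"
  have "tdeg J (e(j := l)) = l + tdeg (J - {j}) e" "tdeg J e = e j + tdeg (J - {j}) e"
    using finJ j unfolding tdeg_def by (subst sum.remove[of J j]; auto intro!: sum.cong)+
  then show ?thesis by simp
qed

text \<open>If the exponent of x j reaches \<open>B\<close>, then \<open>integral\<close> replaces x
  j ^ B by terms x j ^ l with an extra factor T. The exponent goes from B - 1 in the old monomial to
  l while T adds \<open>B\<close>, a net gain of l + 1.\<close>

lemma U_x: assumes j: "j \<in> J" and u: "u \<in> U n" shows "x j * u \<in> U (Suc n)"
proof (rule U_mult[OF u])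
  fix e a \<kappa> assume h: "e \<in> bx" "a \<in> Kt" "[:0, 1:] ^ \<kappa> dvd a" "n \<le> B * \<kappa> + tdeg J e"
  have ej: "e j < B" using h j by (auto simp: box_def)
  show "x j * (poly a 1 * mpow J x e) \<in> U (Suc n)"
  proof (cases "Suc (e j) < B")
    case True
    have "x j * (poly a 1 * mpow J x e) = poly a 1 * mpow J x (e(j := Suc (e j)))"
      by (simp add: mon_upd mon_rem j)
    also have "\<dots> \<in> U (Suc n)"
      using h True j tdeg_upd[OF j, of e "Suc (e j)"] by (intro U_term[of _ _ \<kappa>]) (auto simp: box_def exps_def)
    finally show ?thesis .
  next
    case False
    then have eB: "Suc (e j) = B" using ej by simp
    obtain c where c: "\<forall>l<B. c l \<in> Kt \<and> [:0, 1:] dvd c l" "x j ^ B = (\<Sum>l<B. poly (c l) 1 * x j ^ l)"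
      using integral[OF j] by blast
    have "x j * (poly a 1 * mpow J x e) = poly a 1 * (x j ^ B * mpow (J - {j}) x e)"
      by (simp add: mon_rem[OF j] flip: eB)
    also have "\<dots> = (\<Sum>l<B. poly (a * c l) 1 * mpow J x (e(j := l)))"
      by (simp add: c(2) mon_upd[OF j] sum_distrib_left sum_distrib_right ac_simps)
    also have "\<dots> \<in> U (Suc n)"
    proof (rule U_sum)
      fix l assume l: "l \<in> {..<B}"
      have "[:0, 1:] ^ Suc \<kappa> dvd a * c l"
        using h c(1) l by (simp only: power_Suc2) (intro mult_dvd_mono, auto)
      moreover have "Suc n \<le> B * Suc \<kappa> + tdeg J (e(j := l))"
        using h tdeg_upd[OF j, of e l] eB by simp
      ultimately show "poly (a * c l) 1 * mpow J x (e(j := l)) \<in> U (Suc n)"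
        using h c(1) l j by (intro U_term[of _ _ "Suc \<kappa>"]) (auto simp: box_def exps_def is_subringD[OF Kt_subring])
    qed
    finally show ?thesis .
  qed
qed

text \<open>The lift of g i - g0 i is a multiple of T and so is worth \<open>B\<close>, of which 1
  is needed.\<close>

lemma U_g: assumes i: "i \<in> I" and u: "u \<in> U n" shows "(g i - g0 i) * u \<in> U (Suc n)"
proof (rule U_mult[OF u])
  fix e a \<kappa> assume h: "e \<in> bx" "a \<in> Kt" "[:0, 1:] ^ \<kappa> dvd a" "n \<le> B * \<kappa> + tdeg J e"
  have "[:0, g i - g0 i:] = [:g0 i, g i - g0 i:] - [:g0 i:]" by simp
  also have "\<dots> \<in> Kt" using i by (intro is_subringD[OF Kt_subring] Kt_gen Kt_const g0)
  finally have *: "[:0, g i - g0 i:] \<in> Kt" .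
  have "[:0, 1:] dvd [:0, g i - g0 i:]" by (rule dvdI[of _ _ "[:g i - g0 i:]"]) simp
  then have "[:0, 1:] ^ Suc \<kappa> dvd [:0, g i - g0 i:] * a"
    using h by (simp only: power_Suc) (intro mult_dvd_mono, auto)
  moreover have "Suc n \<le> B * Suc \<kappa> + tdeg J e" using h B_pos by simp
  ultimately have "poly ([:0, g i - g0 i:] * a) 1 * mpow J x e \<in> U (Suc n)"
    using h * by (intro U_term[of _ _ "Suc \<kappa>"] is_subringD[OF Kt_subring])
  then show "(g i - g0 i) * (poly a 1 * mpow J x e) \<in> U (Suc n)" by (simp add: ac_simps)
qed

lemma U_const: assumes c: "c \<in> k" and u: "u \<in> U n" shows "c * u \<in> U n"
proof (rule U_mult[OF u])
  fix e a \<kappa> assume h: "e \<in> bx" "a \<in> Kt" "[:0, 1:] ^ \<kappa> dvd a" "n \<le> B * \<kappa> + tdeg J e"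
  have "poly ([:c:] * a) 1 * mpow J x e \<in> U n"
    using h c by (intro U_term[of _ _ \<kappa>] is_subringD[OF Kt_subring] Kt_const dvd_mult) auto
  then show "c * (poly a 1 * mpow J x e) \<in> U n" by (simp add: ac_simps)
qed

lemma U_Suc: "u \<in> U (Suc n) \<Longrightarrow> u \<in> U n"
  unfolding U_def using Suc_leD by blast

lemma filt_mult_U: "filt k Z l y \<Longrightarrow> u \<in> U n \<Longrightarrow> y * u \<in> U (n + l)"
proof (induction arbitrary: u n rule: filt.induct)
  case (const c) then show ?case by (simp add: U_const)
next
  case (gen z) then show ?case by (auto simp: U_x U_g)
next
  case (zero l) then show ?case by (simp add: U_zero)
next
  case (add l x y) then show ?case by (simp add: distrib_right U_add)
next
  case (mult l x l' y)
  from mult.IH(1)[OF mult.IH(2)[OF mult.prems]] show ?case by (simp add: ac_simps)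
next
  case (weaken l x)
  from weaken.IH[OF weaken.prems] show ?case by (simp add: U_Suc)
qed

lemma filt_U: "filt k Z l y \<Longrightarrow> y \<in> U l"
  using filt_mult_U[of l y 1 0] U_term[OF zero_bx, of 1 0 0]
  by (auto simp: mpow_0 is_subringD[OF Kt_subring])

section \<open>Clearing denominators over k[g], and the intersection of the powers\<close>

text \<open>Sets of monomials that are linearly independent over k[g]; a maximal one is a basis of
  k(g, x) over k(g). The exponent 0 is forced in so that elements of k[g] have a coordinate of their
  own.\<close>

definition "indepS S \<longleftrightarrow> S \<subseteq> bx \<and> (\<lambda>_. 0) \<in> S \<and>
  (\<forall>b. (\<forall>e\<in>S. b e \<in> kg) \<and> (\<Sum>e\<in>S. b e * mpow J x e) = 0 \<longrightarrow> (\<forall>e\<in>S. b e = 0))"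

text \<open>Maximality of \<open>S\<close> gives every further monomial a relation in which its own
  coefficient is nonzero; \<open>D\<close> is the product of these coefficients. Thus
  \<open>D\<close> carries k[g, x] into the free k[g]-module on \<open>S\<close>.\<close>

lemma common_denominator:
  "\<exists>S D n. indepS S \<and> D \<in> kg \<and> D \<noteq> 0 \<and> (\<forall>e\<in>bx. \<forall>s\<in>S. n e s \<in> kg) \<and>
    (\<forall>e\<in>bx. D * mpow J x e = (\<Sum>s\<in>S. n e s * mpow J x s))"
proof -
  have "indepS {\<lambda>_. 0}" using zero_bx by (auto simp: indepS_def mpow_0)
  moreover have "\<forall>S. indepS S \<longrightarrow> card S < Suc (card bx)"
    using finite_bx by (auto simp: indepS_def less_Suc_eq_le intro: card_mono)
  ultimately obtain S where S: "indepS S" "\<forall>S'. indepS S' \<longrightarrow> card S' \<le> card S"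
    using ex_has_greatest_nat[of indepS "{\<lambda>_. 0}" card "Suc (card bx)"] by auto
  have Sbx: "S \<subseteq> bx" "finite S" "(\<lambda>_. 0) \<in> S"
    using S finite_bx by (auto simp: indepS_def intro: finite_subset)
  have "\<exists>\<alpha> \<beta>. \<alpha> \<in> kg \<and> \<alpha> \<noteq> 0 \<and> (\<forall>s\<in>S. \<beta> s \<in> kg) \<and> \<alpha> * mpow J x e = (\<Sum>s\<in>S. \<beta> s * mpow J x s)"
    if e: "e \<in> bx - S" for e
  proof -
    have "\<not> indepS (insert e S)" using S(2) e Sbx by (metis DiffD2 Suc_n_not_le_n card_insert_disjoint)
    then obtain b where b: "\<forall>f\<in>insert e S. b f \<in> kg" "(\<Sum>f\<in>insert e S. b f * mpow J x f) = 0" "\<exists>f\<in>insert e S. b f \<noteq> 0"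
      using e Sbx unfolding indepS_def by auto
    have sum: "b e * mpow J x e + (\<Sum>f\<in>S. b f * mpow J x f) = 0" using b(2) e Sbx by simp
    have "b e \<noteq> 0"
    proof
      assume "b e = 0"
      with sum have "\<forall>f\<in>S. b f = 0" using S(1) b(1) unfolding indepS_def by auto
      with b(3) \<open>b e = 0\<close> show False by auto
    qed
    moreover have "b e * mpow J x e = (\<Sum>s\<in>S. (- b s) * mpow J x s)"
      using sum by (simp add: sum_negf eq_neg_iff_add_eq_0)
    ultimately show ?thesis using b(1)
      by (intro exI[of _ "b e"] exI[of _ "\<lambda>s. - b s"]) (auto intro: is_subringD(5)[OF kg_subring])
  qed
  then have "\<forall>e\<in>bx - S. \<exists>\<alpha>. \<exists>\<beta>. \<alpha> \<in> kg \<and> \<alpha> \<noteq> 0 \<and> (\<forall>s\<in>S. \<beta> s \<in> kg) \<and> \<alpha> * mpow J x e = (\<Sum>s\<in>S. \<beta> s * mpow J x s)"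
    by blast
  from bchoice[OF this] obtain \<alpha> where "\<forall>e\<in>bx - S. \<exists>\<beta>. \<alpha> e \<in> kg \<and> \<alpha> e \<noteq> 0 \<and> (\<forall>s\<in>S. \<beta> s \<in> kg) \<and> \<alpha> e * mpow J x e = (\<Sum>s\<in>S. \<beta> s * mpow J x s)" ..
  from bchoice[OF this] obtain \<beta> where
    ab0: "\<forall>e\<in>bx - S. \<alpha> e \<in> kg \<and> \<alpha> e \<noteq> 0 \<and> (\<forall>s\<in>S. \<beta> e s \<in> kg) \<and> \<alpha> e * mpow J x e = (\<Sum>s\<in>S. \<beta> e s * mpow J x s)" ..
  then have ab: "\<And>e. e \<in> bx - S \<Longrightarrow> \<alpha> e \<in> kg" "\<And>e. e \<in> bx - S \<Longrightarrow> \<alpha> e \<noteq> 0"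
    "\<And>e s. e \<in> bx - S \<Longrightarrow> s \<in> S \<Longrightarrow> \<beta> e s \<in> kg"
    "\<And>e. e \<in> bx - S \<Longrightarrow> \<alpha> e * mpow J x e = (\<Sum>s\<in>S. \<beta> e s * mpow J x s)" by blast+
  define D where "D = (\<Prod>e\<in>bx - S. \<alpha> e)"
  define n where "n e s = (if e \<in> S then (if s = e then D else 0) else (\<Prod>f\<in>bx - S - {e}. \<alpha> f) * \<beta> e s)" for e s
  have D: "D \<in> kg" "D \<noteq> 0" unfolding D_def using ab finite_bx
    by (auto intro!: subring_prod[OF kg_subring] simp: prod_zero_iff)
  moreover have "n e s \<in> kg" if "e \<in> bx" "s \<in> S" for e s
    using that ab D unfolding n_def
    by (auto intro!: subring_prod[OF kg_subring] is_subringD[OF kg_subring])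
  moreover have "D * mpow J x e = (\<Sum>s\<in>S. n e s * mpow J x s)" if "e \<in> bx" for e
  proof (cases "e \<in> S")
    case True
    have "(\<Sum>s\<in>S. n e s * mpow J x s) = (\<Sum>s\<in>S. if s = e then D * mpow J x e else 0)"
      using True by (intro sum.cong) (auto simp: n_def)
    then show ?thesis using True Sbx by simp
  next
    case False
    have "D = (\<Prod>f\<in>bx - S - {e}. \<alpha> f) * \<alpha> e"
      unfolding D_def using finite_bx False that by (subst prod.remove[of _ e]) auto
    then have "D * mpow J x e = (\<Prod>f\<in>bx - S - {e}. \<alpha> f) * (\<Sum>s\<in>S. \<beta> e s * mpow J x s)"
      using ab(4)[of e] that False by (simp add: mult.assoc)
    then show ?thesis using False by (simp add: n_def sum_distrib_left mult.assoc)
  qed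
  ultimately show ?thesis using S(1) by blast
qed

text \<open>Box monomials have degree at most B * card J, so in a representation of level l every
  coefficient is divisible by T ^ j. After multiplication by \<open>D\<close> coordinates on
  \<open>S\<close> are unique, and the coordinate at exponent 0 shows that T ^ j divides the lift of
  \<open>D\<close> times \<open>F\<close>. The constant is the order of \<open>D\<close> at
  \<open>g0\<close>.\<close>

lemma order_bound:
  "\<exists>c0. \<forall>F l j. F \<in> Kt \<longrightarrow> F \<noteq> 0 \<longrightarrow> poly F 1 \<in> U l \<longrightarrow> B * (j + card J) \<le> l \<longrightarrow> j \<le> c0 + order 0 F"
proof -
  obtain S D n where S: "indepS S" and D: "D \<in> kg" "D \<noteq> 0" and n: "\<forall>e\<in>bx. \<forall>s\<in>S. n e s \<in> kg"
    "\<forall>e\<in>bx. D * mpow J x e = (\<Sum>s\<in>S. n e s * mpow J x s)"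
    using common_denominator by blast
  have Sbx: "S \<subseteq> bx" "finite S" "(\<lambda>_. 0) \<in> S"
    using S finite_bx by (auto simp: indepS_def intro: finite_subset)
  obtain FD where FD: "FD \<in> Kt" "D = poly FD 1" using D by (auto simp: kg_def)
  have "\<forall>e\<in>bx. \<exists>N\<in>Kt. n e (\<lambda>_. 0) = poly N 1" using n Sbx unfolding kg_def by blast
  then obtain N where N: "\<And>e. e \<in> bx \<Longrightarrow> N e \<in> Kt" "\<And>e. e \<in> bx \<Longrightarrow> n e (\<lambda>_. 0) = poly (N e) 1" by metis
  have "j \<le> order 0 FD + order 0 F" if h: "F \<in> Kt" "F \<noteq> 0" "poly F 1 \<in> U l" "B * (j + card J) \<le> l" for F l j
  proof -
    obtain a where a: "\<forall>e\<in>bx. a e \<in> Kt \<and> (\<exists>\<kappa>. [:0, 1:] ^ \<kappa> dvd a e \<and> l \<le> B * \<kappa> + tdeg J e)"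
      "poly F 1 = (\<Sum>e\<in>bx. poly (a e) 1 * mpow J x e)"
      using h(3) by (rule U_E)
    have adv: "[:0, 1:] ^ j dvd a e" if e: "e \<in> bx" for e
    proof -
      obtain \<kappa> where \<kappa>: "[:0, 1:] ^ \<kappa> dvd a e" "l \<le> B * \<kappa> + tdeg J e" using a(1)[rule_format, OF e] by (elim conjE exE)
      have "B * (j + card J) \<le> B * \<kappa> + card J * B"
        using \<kappa>(2) h(4) bx_tdeg[OF e] by linarith
      also have "\<dots> = B * (\<kappa> + card J)" by (simp add: algebra_simps)
      finally have "B * (j + card J) \<le> B * (\<kappa> + card J)" .
      then have "j \<le> \<kappa>" using B_pos by simp
      then show ?thesis using \<kappa>(1) by (rule power_le_dvd[rotated])
    qed
    \<comment> \<open>Coordinates of the difference of two expressions for \<open>D\<close> times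
      F(1); independence makes all of them 0, and the one at exponent 0 is what is wanted.\<close>
    define b where "b s = (\<Sum>e\<in>bx. poly (a e) 1 * n e s) - (if s = (\<lambda>_. 0) then D * poly F 1 else 0)" for s
    have "(\<Sum>s\<in>S. b s * mpow J x s) = (\<Sum>s\<in>S. (\<Sum>e\<in>bx. poly (a e) 1 * n e s) * mpow J x s)
        - (\<Sum>s\<in>S. if s = (\<lambda>_. 0) then D * poly F 1 else 0)"
      unfolding b_def left_diff_distrib sum_subtractf
      by (intro arg_cong2[of _ _ _ _ minus] refl sum.cong) (auto simp: mpow_0)
    also have "(\<Sum>s\<in>S. (\<Sum>e\<in>bx. poly (a e) 1 * n e s) * mpow J x s) = (\<Sum>e\<in>bx. poly (a e) 1 * (\<Sum>s\<in>S. n e s * mpow J x s))"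
      unfolding sum_distrib_right sum_distrib_left by (subst sum.swap) (simp only: mult.assoc)
    also have "\<dots> = (\<Sum>e\<in>bx. poly (a e) 1 * (D * mpow J x e))"
      using n(2) by (intro sum.cong) simp_all
    also have "\<dots> = D * poly F 1" by (simp only: a(2) sum_distrib_left mult.left_commute)
    also have "(\<Sum>s\<in>S. if s = (\<lambda>_. 0) then D * poly F 1 else 0) = D * poly F 1" using Sbx by simp
    finally have "(\<Sum>s\<in>S. b s * mpow J x s) = 0" by simp
    moreover have "b s \<in> kg" if "s \<in> S" for s
    proof -
      have "(\<Sum>e\<in>bx. poly (a e) 1 * n e s) \<in> kg" using n(1) a(1) that
        by (intro subring_sum[OF kg_subring] is_subringD(4)[OF kg_subring]) (auto intro: kg_I)
      moreover have "D * poly F 1 \<in> kg" using D h by (intro is_subringD(4)[OF kg_subring] kg_I)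
      ultimately show ?thesis unfolding b_def
        by (cases "s = (\<lambda>_. 0)") (simp_all add: is_subringD(6)[OF kg_subring])
    qed
    moreover have "(\<forall>e\<in>S. b e \<in> kg) \<and> (\<Sum>e\<in>S. b e * mpow J x e) = 0 \<longrightarrow> (\<forall>e\<in>S. b e = 0)" for b
      using S unfolding indepS_def by (elim conjE allE)
    note this[of b]
    ultimately have "\<forall>e\<in>S. b e = 0" by blast
    then have "b (\<lambda>_. 0) = 0" using Sbx(3) by (rule bspec)
    then have eq: "poly (FD * F) 1 = poly (\<Sum>e\<in>bx. a e * N e) 1"
      using N by (simp add: b_def FD poly_sum)
    have "FD * F - (\<Sum>e\<in>bx. a e * N e) \<in> Kt"
      using FD(1) h(1) a(1) N(1)
      by (intro is_subringD(4,6)[OF Kt_subring] subring_sum[OF Kt_subring]) auto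
    then have "FD * F = (\<Sum>e\<in>bx. a e * N e)" 
      using Kt_inj[of "FD * F - (\<Sum>e\<in>bx. a e * N e)"] eq by simp
    then have "[:0, 1:] ^ j dvd FD * F" using adv by (auto intro!: dvd_sum dvd_mult2)
    moreover have "FD * F \<noteq> 0" using D(2) FD(2) h(2) by auto
    ultimately have "j \<le> order 0 (FD * F)" by (metis order_divides minus_zero)
    then show ?thesis using \<open>FD * F \<noteq> 0\<close> by (simp add: order_mult)
  qed
  then show ?thesis by blast
qed

text \<open>The powers of \<open>c\<close>, multiplied by \<open>D\<close>, lie in a free
  k[g]-module of rank card S, so 1 + card S of them are dependent. After the lowest power of
  \<open>c\<close> is cancelled, the lowest coefficient of this equation is a multiple of
  \<open>c\<close>, much like a norm.\<close>

lemma algebraic_cofactor: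
  assumes c: "filt k Z 0 c" and c0: "c \<noteq> 0"
  obtains v \<gamma> where "filt k Z 0 v" "\<gamma> \<in> kg" "\<gamma> \<noteq> 0" "c * v = \<gamma>"
proof -
  obtain S D n where S: "indepS S" and D: "D \<in> kg" "D \<noteq> 0" and n: "\<forall>e\<in>bx. \<forall>s\<in>S. n e s \<in> kg"
    "\<forall>e\<in>bx. D * mpow J x e = (\<Sum>s\<in>S. n e s * mpow J x s)"
    using common_denominator by blast
  have Sbx: "S \<subseteq> bx" "finite S" using S finite_bx by (auto simp: indepS_def intro: finite_subset)
  have cpow: "filt k Z 0 (c ^ t)" for t
    using is_subringD(7)[OF filt_subring[OF k_subring], of c Z t] c by simp
  have "\<exists>A. (\<forall>s\<in>S. A s \<in> kg) \<and> D * c ^ t = (\<Sum>s\<in>S. A s * mpow J x s)" for t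
  proof -
    obtain a where a: "\<forall>e\<in>bx. a e \<in> Kt" "c ^ t = (\<Sum>e\<in>bx. poly (a e) 1 * mpow J x e)"
      by (rule U_E[OF filt_U[OF cpow, of t]]) blast
    have "D * c ^ t = (\<Sum>e\<in>bx. poly (a e) 1 * (D * mpow J x e))"
      by (simp only: a(2) sum_distrib_left mult.left_commute)
    also have "\<dots> = (\<Sum>e\<in>bx. poly (a e) 1 * (\<Sum>s\<in>S. n e s * mpow J x s))"
      using n(2) by (intro sum.cong) simp_all
    also have "\<dots> = (\<Sum>s\<in>S. (\<Sum>e\<in>bx. poly (a e) 1 * n e s) * mpow J x s)"
      unfolding sum_distrib_right sum_distrib_left by (subst sum.swap) (simp only: mult.assoc)
    finally show ?thesis using a(1) n(1)
      by (intro exI[of _ "\<lambda>s. \<Sum>e\<in>bx. poly (a e) 1 * n e s"])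
         (auto intro!: is_subringD(4)[OF kg_subring] subring_sum[OF kg_subring] intro: kg_I)
  qed
  then obtain A where "\<forall>t. (\<forall>s\<in>S. A t s \<in> kg) \<and> D * c ^ t = (\<Sum>s\<in>S. A t s * mpow J x s)"
    using choice[of "\<lambda>t A. (\<forall>s\<in>S. A s \<in> kg) \<and> D * c ^ t = (\<Sum>s\<in>S. A s * mpow J x s)"] by blast
  then have A: "\<And>t s. s \<in> S \<Longrightarrow> A t s \<in> kg" "\<And>t. D * c ^ t = (\<Sum>s\<in>S. A t s * mpow J x s)" by blast+
  have "\<exists>\<gamma>. (\<forall>t\<in>{..card S}. \<gamma> t \<in> kg) \<and> (\<exists>t\<in>{..card S}. \<gamma> t \<noteq> 0) \<and> (\<forall>s\<in>S. (\<Sum>t\<in>{..card S}. \<gamma> t * A t s) = 0)"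
    using A Sbx by (intro homogeneous_system_solvable[OF kg_subring]) auto
  then obtain \<gamma> where \<gamma>: "\<forall>t\<le>card S. \<gamma> t \<in> kg" "\<exists>t\<le>card S. \<gamma> t \<noteq> 0" "\<forall>s\<in>S. (\<Sum>t\<le>card S. \<gamma> t * A t s) = 0"
    by auto
  have "D * (\<Sum>t\<le>card S. \<gamma> t * c ^ t) = (\<Sum>t\<le>card S. \<gamma> t * (\<Sum>s\<in>S. A t s * mpow J x s))"
    by (simp only: sum_distrib_left[of D] A(2)[symmetric] mult.left_commute)
  also have "\<dots> = (\<Sum>s\<in>S. (\<Sum>t\<le>card S. \<gamma> t * A t s) * mpow J x s)"
    unfolding sum_distrib_right sum_distrib_left by (subst sum.swap) (simp only: mult.assoc)
  also have "\<dots> = 0" using \<gamma>(3) by (intro sum.neutral ballI) (simp only: mult_zero_left)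
  finally have "D * (\<Sum>t\<le>card S. \<gamma> t * c ^ t) = 0" .
  then have sum0: "(\<Sum>t\<le>card S. \<gamma> t * c ^ t) = 0"
    by (rule mult_eq_0_iff[THEN iffD1, THEN disjE]) (erule D(2)[THEN notE], assumption)
  \<comment> \<open>Coefficients below \<open>t0\<close> vanish, so c ^ t0 factors out of the
    equation and can be cancelled.\<close>
  define t0 where "t0 = (LEAST t. t \<le> card S \<and> \<gamma> t \<noteq> 0)"
  have t0: "t0 \<le> card S" "\<gamma> t0 \<noteq> 0" "\<And>t. t < t0 \<Longrightarrow> \<gamma> t = 0"
  proof -
    have "t0 \<le> card S \<and> \<gamma> t0 \<noteq> 0" unfolding t0_def using \<gamma>(2) by (rule LeastI_ex)
    then show "t0 \<le> card S" "\<gamma> t0 \<noteq> 0" by auto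
    show "\<gamma> t = 0" if "t < t0" for t
      using not_less_Least[of t "\<lambda>t. t \<le> card S \<and> \<gamma> t \<noteq> 0"] that \<open>t0 \<le> card S\<close> unfolding t0_def[symmetric]
      by auto
  qed
  define w where "w = (\<Sum>t\<in>{t0<..card S}. \<gamma> t * c ^ (t - t0 - 1))"
  have "(\<Sum>t\<le>card S. \<gamma> t * c ^ t) = (\<Sum>t\<in>insert t0 {t0<..card S}. \<gamma> t * c ^ t)"
  proof (rule sum.mono_neutral_right)
    show "insert t0 {t0<..card S} \<subseteq> {..card S}" using t0(1) by auto
    show "\<forall>t\<in>{..card S} - insert t0 {t0<..card S}. \<gamma> t * c ^ t = 0"
    proof
      fix t assume "t \<in> {..card S} - insert t0 {t0<..card S}"
      then have "t < t0" by auto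
      then show "\<gamma> t * c ^ t = 0" by (simp add: t0(3))
    qed
  qed simp
  also have "\<dots> = \<gamma> t0 * c ^ t0 + (\<Sum>t\<in>{t0<..card S}. \<gamma> t * c ^ t)" by simp
  also have "(\<Sum>t\<in>{t0<..card S}. \<gamma> t * c ^ t) = (\<Sum>t\<in>{t0<..card S}. c ^ t0 * (c * (\<gamma> t * c ^ (t - t0 - 1))))"
  proof (intro sum.cong refl)
    fix t assume "t \<in> {t0<..card S}"
    then have "c ^ t = c ^ (t0 + Suc (t - t0 - 1))" by simp
    then show "\<gamma> t * c ^ t = c ^ t0 * (c * (\<gamma> t * c ^ (t - t0 - 1)))" by (simp only: power_add power_Suc ac_simps)
  qed
  also have "\<gamma> t0 * c ^ t0 + \<dots> = c ^ t0 * (\<gamma> t0 + c * w)"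
    by (simp add: w_def sum_distrib_left distrib_left ac_simps)
  finally have "\<gamma> t0 + c * w = 0" using sum0 c0 by simp
  then have \<gamma>0: "\<gamma> t0 = c * (- w)" by (simp add: eq_neg_iff_add_eq_0)
  have "filt k Z 0 (- w)" unfolding w_def using \<gamma>(1)
    by (intro filt_uminus[OF k_subring] filt_sum[OF k_subring] filt_mult_left[OF k_subring] kg_filt cpow) auto
  moreover have "\<gamma> t0 \<in> kg" using \<gamma>(1) t0(1) by blast
  ultimately show ?thesis using t0(2) \<gamma>0[symmetric] by (rule that)
qed

text \<open>The cofactor moves a nonzero element of all powers of the ideal to a nonzero element of
  k[g], still in all powers, and \<open>order_bound\<close> then bounds every j by a fixed
  number.\<close>

theorem krull:
  assumes c: "\<And>l. filt k Z l c"
  shows "c = 0"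
proof (rule ccontr)
  assume c0: "c \<noteq> 0"
  obtain v \<gamma> where v: "filt k Z 0 v" "\<gamma> \<in> kg" "\<gamma> \<noteq> 0" "c * v = \<gamma>"
    using algebraic_cofactor[OF c c0] by blast
  have fl: "filt k Z l \<gamma>" for l
    unfolding v(4)[symmetric] using c v(1) by (rule filt_mult_right[OF k_subring])
  obtain F where F: "F \<in> Kt" "poly F 1 = \<gamma>" using v(2) by (auto simp: kg_def)
  then have "F \<noteq> 0" using v(3) by auto
  obtain c0 where "\<And>l j. B * (j + card J) \<le> l \<Longrightarrow> j \<le> c0 + order 0 F"
    using order_bound F \<open>F \<noteq> 0\<close> filt_U[OF fl] by metis
  from this[OF order_refl, of "Suc (c0 + order 0 F)"] show False by simp
qed


end

section \<open>Analytic independence of local coordinates\<close>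

context local_coords
begin

lemma xZ: "j \<in> J \<Longrightarrow> x j \<in> Z" by auto

lemma filt_Z: "z \<in> Z \<Longrightarrow> \<exists>b. (\<forall>j\<in>J. filt k Z 0 (b j)) \<and> filt k Z 2 (z - (\<Sum>j\<in>J. x j * b j))"
proof (cases "z \<in> x ` J")
  case True
  then obtain j where j: "j \<in> J" "z = x j" by auto
  have "(\<Sum>i\<in>J. x i * (if i = j then 1 else 0)) = (\<Sum>i\<in>J. if i = j then x j else 0)"
    by (intro sum.cong) auto
  then have "z - (\<Sum>i\<in>J. x i * (if i = j then 1 else 0)) = 0" using j finJ by simp
  then show ?thesis
    by (intro exI[of _ "\<lambda>i. if i = j then 1 else 0"]) (auto intro: filt.zero filt.const is_subringD[OF k_subring])
next
  case False
  assume "z \<in> Z"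
  with False param show ?thesis by auto
qed

text \<open>If a form of degree \<open>i\<close> in the \<open>x j\<close> lies in the next power of the ideal, its leading monomial
  \<open>e0\<close> becomes redundant, so the graded pieces grow like those of a ring of dimension \<open>card J - 1\<close>.\<close>

lemma reduced_leading_form:
  fixes w :: "(nat \<Rightarrow> nat) \<Rightarrow> nat"
  assumes e0: "e0 \<in> exps J" "tdeg J e0 = i"
    and w: "\<And>e f. w (e + f) = w e + w f"
    and d: "\<And>e. d e \<in> k"
    and red: "filt k Z (Suc i) (mpow J x e0 - (\<Sum>e | e \<in> exps J \<and> tdeg J e = i \<and> w e < w e0. d e * mpow J x e))"
  shows "filt k Z l a \<Longrightarrow> \<exists>c. (\<forall>e. c e \<in> k) \<and>
     filt k Z (Suc l) (a - (\<Sum>e | e \<in> {e. \<not> e0 \<le> e} \<and> e \<in> exps J \<and> tdeg J e = l. c e * mpow J x e))"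
proof -
  define Sl where "Sl = {e. e \<in> {e. \<not> e0 \<le> e} \<and> e \<in> exps J \<and> tdeg J e = l}"
  define Rd where "Rd y \<longleftrightarrow> (\<exists>c. (\<forall>e. c e \<in> k) \<and> filt k Z (Suc l) (y - (\<Sum>e\<in>Sl. c e * mpow J x e)))" for y
  have finSl: "finite Sl" unfolding Sl_def using finite_tdeg_eq[OF finJ, of l] by (auto intro: finite_subset[rotated])
  have Rd0: "Rd y" if "filt k Z (Suc l) y" for y
    unfolding Rd_def using that by (intro exI[of _ "\<lambda>_. 0"]) (auto simp: is_subringD[OF k_subring])
  have Rd_add: "Rd (y + y')" if "Rd y" "Rd y'" for y y'
  proof -
    from that obtain c c' where c: "\<forall>e. c e \<in> k" "\<forall>e. c' e \<in> k" "filt k Z (Suc l) (y - (\<Sum>e\<in>Sl. c e * mpow J x e))"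
      "filt k Z (Suc l) (y' - (\<Sum>e\<in>Sl. c' e * mpow J x e))" unfolding Rd_def by blast
    from filt.add[OF c(3,4)] show ?thesis unfolding Rd_def using c(1,2)
      by (intro exI[of _ "\<lambda>e. c e + c' e"]) (auto simp: is_subringD[OF k_subring] algebra_simps sum.distrib)
  qed
  have Rd_cmult: "Rd (b * y)" if "b \<in> k" "Rd y" for b y
  proof -
    from that obtain c where c: "\<forall>e. c e \<in> k" "filt k Z (Suc l) (y - (\<Sum>e\<in>Sl. c e * mpow J x e))" unfolding Rd_def by blast
    have "b * (y - (\<Sum>e\<in>Sl. c e * mpow J x e)) = b * y - (\<Sum>e\<in>Sl. (b * c e) * mpow J x e)"
      by (simp add: right_diff_distrib sum_distrib_left mult.assoc)
    with filt_cmult[OF k_subring \<open>b \<in> k\<close> c(2)] c(1) \<open>b \<in> k\<close> show ?thesis unfolding Rd_def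
      by (intro exI[of _ "\<lambda>e. b * c e"]) (auto simp: is_subringD[OF k_subring])
  qed
  have Rd_sum: "Rd (\<Sum>e\<in>A. f e)" if "\<And>e. e \<in> A \<Longrightarrow> Rd (f e)" for A :: "(nat \<Rightarrow> nat) set" and f
    using that by (induction A rule: infinite_finite_induct) (auto intro: Rd_add Rd0 filt.zero)
  have Rd_mon: "Rd (mpow J x e)" if "e \<in> exps J" "tdeg J e = l" for e
    using that
  proof (induction "w e" arbitrary: e rule: less_induct)
    case less
    show ?case
    proof (cases "e0 \<le> e")
      case False
      then have "e \<in> Sl" using less by (auto simp: Sl_def)
      have "(\<Sum>f\<in>Sl. (if f = e then 1 else 0) * mpow J x f) = (\<Sum>f\<in>Sl. if f = e then mpow J x e else 0)"
        by (intro sum.cong) auto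
      then have "mpow J x e - (\<Sum>f\<in>Sl. (if f = e then 1 else 0) * mpow J x f) = 0"
        using finSl \<open>e \<in> Sl\<close> by simp
      then show ?thesis unfolding Rd_def
        by (intro exI[of _ "\<lambda>f. if f = e then 1 else 0"]) (auto simp: is_subringD[OF k_subring] intro: filt.zero)
    next
      case True
      \<comment> \<open>Here x ^ e is x ^ e0 times x ^ f. Multiplying \<open>red\<close> by x ^ f
        trades it for monomials of the same degree and smaller weight, to which the induction on the
        weight applies.\<close>
      define f where "f = (\<lambda>t. e t - e0 t)"
      have ef: "e = e0 + f" using True by (auto simp: f_def le_fun_def fun_eq_iff)
      have f: "f \<in> exps J" using less.prems by (auto simp: f_def exps_def)
      have tf: "i + tdeg J f = l" using less.prems e0 by (simp add: ef tdeg_add)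
      let ?A = "{h. h \<in> exps J \<and> tdeg J h = i \<and> w h < w e0}"
      have "filt k Z (Suc i + tdeg J f) ((mpow J x e0 - (\<Sum>h\<in>?A. d h * mpow J x h)) * mpow J x f)"
        using red filt_mon[OF k_subring finJ xZ] by (rule filt.mult)
      also have "(mpow J x e0 - (\<Sum>h\<in>?A. d h * mpow J x h)) * mpow J x f = mpow J x e - (\<Sum>h\<in>?A. d h * mpow J x (h + f))"
        by (simp add: ef mpow_add left_diff_distrib sum_distrib_right mult.assoc)
      finally have "Rd (mpow J x e - (\<Sum>h\<in>?A. d h * mpow J x (h + f)))" using tf by (intro Rd0) simp
      moreover have "Rd (\<Sum>h\<in>?A. d h * mpow J x (h + f))"
      proof (rule Rd_sum)
        fix h assume "h \<in> ?A"
        then have "w (h + f) < w e" "h + f \<in> exps J" "tdeg J (h + f) = l"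
          using f tf by (auto simp: ef w exps_add tdeg_add)
        then show "Rd (d h * mpow J x (h + f))" using less.hyps d by (intro Rd_cmult) auto
      qed
      ultimately have "Rd ((mpow J x e - (\<Sum>h\<in>?A. d h * mpow J x (h + f))) + (\<Sum>h\<in>?A. d h * mpow J x (h + f)))"
        by (rule Rd_add)
      then show ?thesis by simp
    qed
  qed
  assume a: "filt k Z l a"
  obtain c where c: "\<forall>e. c e \<in> k" "filt k Z (Suc l) (a - (\<Sum>e | e \<in> exps J \<and> tdeg J e = l. c e * mpow J x e))"
    using filt_leading_form[OF k_subring finJ xZ filt_Z a] by blast
  have "Rd (\<Sum>e | e \<in> exps J \<and> tdeg J e = l. c e * mpow J x e)"
    using c(1) Rd_mon by (intro Rd_sum Rd_cmult) auto
  from Rd_add[OF Rd0[OF c(2)] this] have "Rd a" by simp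
  then show ?thesis unfolding Rd_def Sl_def .
qed

text \<open>Some coordinate t stays below \<open>e0 t\<close> while each of the others takes at most
  l values: a union of slabs of one dimension less.\<close>

lemma card_not_above:
  assumes "e0 \<in> exps J" "l > 0"
  shows "card {e. e \<in> {e. \<not> e0 \<le> e} \<and> e \<in> exps J \<and> tdeg J e < l} \<le> tdeg J e0 * l ^ (card J - 1)"
proof -
  let ?b = "\<lambda>t. box J (\<lambda>s. if s = t then e0 t else l)"
  have "{e. e \<in> {e. \<not> e0 \<le> e} \<and> e \<in> exps J \<and> tdeg J e < l} \<subseteq> (\<Union>t\<in>J. ?b t)"
  proof safe
    fix e assume e: "\<not> e0 \<le> e" "e \<in> exps J" "tdeg J e < l"
    then obtain t where t: "e t < e0 t" by (auto simp: le_fun_def not_le)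
    then have "t \<in> J" using assms(1) by (cases "t \<in> J") (auto simp: exps_def)
    moreover have "e s < l" if "s \<in> J" for s using le_less_trans[OF le_tdeg[OF finJ that] e(3)] .
    then have "e \<in> ?b t" using e(2) t by (auto simp: box_def)
    ultimately show "e \<in> (\<Union>t\<in>J. ?b t)" by blast
  qed
  then have "card {e. e \<in> {e. \<not> e0 \<le> e} \<and> e \<in> exps J \<and> tdeg J e < l} \<le> card (\<Union>t\<in>J. ?b t)"
    using finite_card_box[OF finJ] finJ by (intro card_mono) auto
  also have "\<dots> \<le> (\<Sum>t\<in>J. card (?b t))" using finJ by (rule card_UN_le)
  also have "\<dots> = (\<Sum>t\<in>J. e0 t * l ^ (card J - 1))"
  proof (intro sum.cong refl)
    fix t assume t: "t \<in> J"
    have "(\<Prod>s\<in>J. if s = t then e0 t else l) = e0 t * (\<Prod>s\<in>J - {t}. l)"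
      using finJ t by (subst prod.remove[of J t]) (auto intro!: prod.cong)
    then show "card (?b t) = e0 t * l ^ (card J - 1)"
      using finite_card_box[OF finJ, of "\<lambda>s. if s = t then e0 t else l"] t finJ by simp
  qed
  finally show ?thesis by (simp add: tdeg_def sum_distrib_right)
qed

lemma degree_lift_mpow: "degree (mpow I (\<lambda>i. [:g0 i, g i - g0 i:]) a) \<le> tdeg I a"
proof -
  have "degree (mpow I (\<lambda>i. [:g0 i, g i - g0 i:]) a) \<le> (\<Sum>i\<in>I. degree ([:g0 i, g i - g0 i:] ^ a i))"
    unfolding mpow_def using degree_prod_sum_le[OF finI, of "\<lambda>i. [:g0 i, g i - g0 i:] ^ a i"] by (simp add: o_def)
  also have "\<dots> \<le> (\<Sum>i\<in>I. a i)"
  proof (rule sum_mono)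
    fix i
    show "degree ([:g0 i, g i - g0 i:] ^ a i) \<le> a i"
      using degree_power_le[of "[:g0 i, g i - g0 i:]" "a i"] by (auto split: if_splits)
  qed
  finally show ?thesis by (simp add: tdeg_def)
qed

text \<open>A relation with lowest form of degree i leaves at most i * l' ^ (m - 1) monomials modulo
  the power l' of the ideal, whereas N ^ m monomials in g are available. With l' proportional to N,
  some nonzero combination \<open>F\<close> of the latter lies in that power; by
  \<open>order_bound\<close> its order at \<open>g0\<close> exceeds m * N, although its degree does
  not.\<close>

theorem analytically_independent:
  assumes c: "\<And>e. c e \<in> k" and h: "filt k Z l (\<Sum>e | e \<in> exps J \<and> tdeg J e < l. c e * mpow J x e)"
    and e: "e \<in> exps J" "tdeg J e < l"
  shows "c e = 0"
proof (rule ccontr)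
  assume ce: "c e \<noteq> 0"
  let ?P = "\<lambda>i. \<exists>e\<in>exps J. tdeg J e = i \<and> c e \<noteq> 0"
  define i where "i = (LEAST i. ?P i)"
  have Pi: "?P i" unfolding i_def by (rule LeastI[of ?P "tdeg J e"]) (use e ce in auto)
  have il: "i \<le> tdeg J e" unfolding i_def by (rule Least_le) (use e ce in auto)
  have below: "c f = 0" if "f \<in> exps J" "tdeg J f < i" for f
    using not_less_Least[of "tdeg J f" ?P] that unfolding i_def by auto
  \<comment> \<open>An additive weight that orders the exponents of degree i totally: their entries
    are at most i, hence digits in base i + 1. Additivity makes the order compatible with products
    of monomials.\<close>
  define w where "w f = (\<Sum>t\<in>J. f t * Suc i ^ t)" for f :: "nat \<Rightarrow> nat"
  have w_add: "w (f + f') = w f + w f'" for f f' by (simp add: w_def distrib_right sum.distrib)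
  have w_inj: "f = f'" if f: "f \<in> exps J" "f' \<in> exps J" "tdeg J f = i" "tdeg J f' = i" "w f = w f'" for f f'
  proof
    fix t
    obtain N where N: "J \<subseteq> {..<N}" using finJ finite_nat_iff_bounded by blast
    have ext: "w u = (\<Sum>t<N. u t * Suc i ^ t)" if "u \<in> exps J" for u
      unfolding w_def by (rule sum.mono_neutral_left) (use N that in \<open>auto simp: exps_def\<close>)
    have bd: "u t < Suc i" if "u \<in> exps J" "tdeg J u = i" for u t
      using le_tdeg[OF finJ, of t u] that by (cases "t \<in> J") (auto simp: exps_def)
    show "f t = f' t"
    proof (cases "t < N")
      case True
      then show ?thesis using base_expansion_unique[of N f "Suc i" f' t] f bd ext by auto
    next
      case False
      then have "t \<notin> J" using N by auto
      then show ?thesis using f by (auto simp: exps_def)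
    qed
  qed
  let ?E = "{e \<in> exps J. tdeg J e = i \<and> c e \<noteq> 0}"
  have finE: "finite ?E" using finite_tdeg_eq[OF finJ, of i] by (auto intro: finite_subset[rotated])
  have "?E \<noteq> {}" using Pi by auto
  then have "Max (w ` ?E) \<in> w ` ?E" using finE by (intro Max_in) auto
  then obtain e0 where e0: "e0 \<in> ?E" "Max (w ` ?E) = w e0" by (rule imageE)
  have e0_max: "w f \<le> w e0" if "f \<in> ?E" for f
    using Max_ge[of "w ` ?E" "w f"] that finE by (simp add: e0(2))
  \<comment> \<open>The lowest form, solved for its heaviest monomial \<open>e0\<close>.\<close>
  define d where "d f = - (c f / c e0)" for f
  have d: "d f \<in> k" for f
    unfolding d_def divide_inverse using c k is_subringD(4,5)[OF k_subring]
    by (auto simp: is_subfield_def)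
  let ?A = "{f. f \<in> exps J \<and> tdeg J f = i \<and> w f < w e0}"
  have red: "filt k Z (Suc i) (mpow J x e0 - (\<Sum>f\<in>?A. d f * mpow J x f))"
  proof -
    let ?L = "{e. e \<in> exps J \<and> tdeg J e < l}" and ?H = "{f. f \<in> exps J \<and> i < tdeg J f \<and> tdeg J f < l}"
    have fin: "finite ?L" using finite_tdeg_less[OF finJ, of l] .
    have "(\<Sum>f\<in>?L. c f * mpow J x f) = (\<Sum>f\<in>insert e0 ?A \<union> ?H. c f * mpow J x f)"
    proof (rule sum.mono_neutral_right[OF fin])
      show "insert e0 ?A \<union> ?H \<subseteq> ?L" using e0 il e by auto
      show "\<forall>f\<in>?L - (insert e0 ?A \<union> ?H). c f * mpow J x f = 0"
      proof
        fix f assume f: "f \<in> ?L - (insert e0 ?A \<union> ?H)"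
        have "c f = 0"
        proof (rule ccontr)
          assume "c f \<noteq> 0"
          then have "tdeg J f = i" using below[of f] f by (auto simp: not_less)
          then have "w f \<le> w e0" "f \<noteq> e0" "\<not> w f < w e0" using e0_max[of f] f \<open>c f \<noteq> 0\<close> by auto
          then show False using w_inj[of f e0] f e0(1) \<open>tdeg J f = i\<close> by auto
        qed
        then show "c f * mpow J x f = 0" by simp
      qed
    qed
    also have "\<dots> = (\<Sum>f\<in>insert e0 ?A. c f * mpow J x f) + (\<Sum>f\<in>?H. c f * mpow J x f)"
      using fin e0 il e by (intro sum.union_disjoint) (auto intro: finite_subset[of _ ?L])
    also have "(\<Sum>f\<in>insert e0 ?A. c f * mpow J x f) = c e0 * mpow J x e0 + (\<Sum>f\<in>?A. c f * mpow J x f)"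
      using fin il e by (intro sum.insert) (auto intro: finite_subset[of _ ?L])
    finally have "c e0 * mpow J x e0 + (\<Sum>f\<in>?A. c f * mpow J x f)
      = (\<Sum>f\<in>?L. c f * mpow J x f) - (\<Sum>f\<in>?H. c f * mpow J x f)" by simp
    moreover have "filt k Z (Suc i) \<dots>"
    proof (rule filt_diff[OF k_subring])
      show "filt k Z (Suc i) (\<Sum>f\<in>?L. c f * mpow J x f)" by (rule filt_mono[OF h]) (use il e in simp)
      show "filt k Z (Suc i) (\<Sum>f\<in>?H. c f * mpow J x f)"
        by (rule filt_mon_sum[OF k_subring finJ xZ]) (use c in auto)
    qed
    ultimately have "filt k Z (Suc i) (c e0 * mpow J x e0 + (\<Sum>f\<in>?A. c f * mpow J x f))" by simp
    moreover have "inverse (c e0) \<in> k" using c k by (auto simp: is_subfield_def)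
    ultimately have "filt k Z (Suc i) (inverse (c e0) * (c e0 * mpow J x e0 + (\<Sum>f\<in>?A. c f * mpow J x f)))"
      by (intro filt_cmult[OF k_subring])
    also have "inverse (c e0) * (c e0 * mpow J x e0 + (\<Sum>f\<in>?A. c f * mpow J x f)) = mpow J x e0 - (\<Sum>f\<in>?A. d f * mpow J x f)"
    proof -
      have "inverse (c e0) * (c e0 * mpow J x e0) = mpow J x e0" using e0(1) by simp
      moreover have "inverse (c e0) * (\<Sum>f\<in>?A. c f * mpow J x f) = - (\<Sum>f\<in>?A. d f * mpow J x f)"
        unfolding sum_distrib_left sum_negf[symmetric] by (intro sum.cong) (auto simp: d_def divide_inverse)
      ultimately show ?thesis by (simp add: distrib_left)
    qed
    finally show ?thesis .
  qed
  note step = reduced_leading_form[where w = w, OF _ _ w_add d red]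
  obtain c0 where c0: "\<And>F l j. F \<in> Kt \<Longrightarrow> F \<noteq> 0 \<Longrightarrow> poly F 1 \<in> U l \<Longrightarrow> B * (j + card J) \<le> l \<Longrightarrow> j \<le> c0 + order 0 F"
    using order_bound by blast
  define m where "m = card J"
  have m: "m > 0" using J_ne finJ by (auto simp: m_def card_gt_0_iff)
  \<comment> \<open>The number j is chosen so that j \<le> c0 + order contradicts order \<le> m * N,
    and l' is the level at which \<open>order_bound\<close> speaks about j. \<open>C\<close>
    satisfies l' \<le> C * N, and N lies just above i * C ^ (m - 1), so that i * (C * N) ^ (m - 1) <
    N ^ m.\<close>
  define C where "C = B * (c0 + 2 * m + 1)"
  define N where "N = i * C ^ (m - 1) + 1"
  define j where "j = c0 + m * N + 1"
  define l' where "l' = B * (j + m)"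
  have N: "N \<ge> 1" by (simp add: N_def)
  have "j + m \<le> (c0 + 2 * m + 1) * N"
    using N by (cases N) (auto simp: j_def algebra_simps)
  then have lC: "l' \<le> C * N" unfolding l'_def C_def mult.assoc by (rule mult_left_mono) simp
  have l'0: "l' > 0" using B_pos m by (simp add: l'_def)
  let ?T = "{f. f \<in> {f. \<not> e0 \<le> f} \<and> f \<in> exps J \<and> tdeg J f < l'}"
  have "card ?T \<le> i * l' ^ (m - 1)" using card_not_above[of e0 l'] e0(1) l'0 by (simp add: m_def)
  also have "\<dots> \<le> i * (C * N) ^ (m - 1)" using lC by (intro mult_left_mono power_mono) auto
  also have "\<dots> = (i * C ^ (m - 1)) * N ^ (m - 1)" by (simp add: power_mult_distrib)
  also have "\<dots> < N * N ^ (m - 1)" by (intro mult_strict_right_mono) (auto simp: N_def)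
  also have "\<dots> = N ^ m" using m by (metis Suc_diff_1 power_Suc)
  also have "\<dots> = card (box I (\<lambda>_. N))" using finite_card_box[OF finI, of "\<lambda>_. N"] cardI by (simp add: m_def)
  finally have card: "card ?T < card (box I (\<lambda>_. N))" .
  have gf: "filt k Z 0 (g i)" if "i \<in> I" for i
    using that kg_I[OF Kt_gen[OF that]] by (intro kg_filt) simp
  have monf: "filt k Z 0 (mpow I g a)" for a
    unfolding mpow_def using gf subring_prod[OF filt_subring[OF k_subring], of I "\<lambda>i. g i ^ a i" Z]
      is_subringD(7)[OF filt_subring[OF k_subring]] by auto
  have "\<forall>a. \<exists>A. (\<forall>e. A e \<in> k) \<and> filt k Z l' (mpow I g a - (\<Sum>e\<in>?T. A e * mpow J x e))"
  proof
    fix a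
    show "\<exists>A. (\<forall>e. A e \<in> k) \<and> filt k Z l' (mpow I g a - (\<Sum>e\<in>?T. A e * mpow J x e))"
      by (rule filt_expand[OF k_subring finJ xZ _ monf]) (use step e0 in auto)
  qed
  from choice[OF this] obtain A where A: "\<And>a e. A a e \<in> k"
    "\<And>a. filt k Z l' (mpow I g a - (\<Sum>e\<in>?T. A a e * mpow J x e))" by blast
  have finT: "finite ?T" using finite_tdeg_less[OF finJ, of l'] by (auto intro: finite_subset[rotated])
  let ?b = "box I (\<lambda>_. N)"
  have finb: "finite ?b" using finite_card_box[OF finI] by blast
  \<comment> \<open>There are more monomials in g than exponents in their truncated expansions, so
    some combination over \<open>k\<close> has all expansion coefficients 0.\<close>
  obtain \<gamma> where \<gamma>: "\<forall>a\<in>?b. \<gamma> a \<in> k" "\<exists>a\<in>?b. \<gamma> a \<noteq> 0" "\<forall>t\<in>?T. (\<Sum>a\<in>?b. \<gamma> a * A a t) = 0"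
    using homogeneous_system_solvable[OF k_subring finT finb card, of A] A(1) by blast
  define F where "F = (\<Sum>a\<in>?b. [:\<gamma> a:] * mpow I (\<lambda>i. [:g0 i, g i - g0 i:]) a)"
  have F: "F \<in> Kt" unfolding F_def mpow_def using \<gamma>(1)
    by (intro subring_sum[OF Kt_subring] is_subringD(4)[OF Kt_subring] subring_prod[OF Kt_subring]
          is_subringD(7)[OF Kt_subring] Kt_const Kt_gen) auto
  have F1: "poly F 1 = (\<Sum>a\<in>?b. \<gamma> a * mpow I g a)" by (simp add: F_def poly_sum poly_mon)
  have "poly F 1 \<noteq> 0"
  proof
    assume "poly F 1 = 0"
    then have "finite ?b \<and> (\<forall>e\<in>?b. \<forall>i. i \<notin> I \<longrightarrow> e i = 0) \<and> (\<forall>e\<in>?b. \<gamma> e \<in> k) \<and>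
      (\<Sum>e\<in>?b. \<gamma> e * (\<Prod>i\<in>I. g i ^ e i)) = 0"
      using finb \<gamma>(1) by (simp add: F1 mpow_def) (auto simp: box_def exps_def)
    then have "\<forall>e\<in>?b. \<gamma> e = 0" using indep unfolding alg_indep_def by blast
    with \<gamma>(2) show False by blast
  qed
  then have F0: "F \<noteq> 0" by auto
  have "filt k Z l' (\<Sum>a\<in>?b. \<gamma> a * (mpow I g a - (\<Sum>e\<in>?T. A a e * mpow J x e)))"
    using \<gamma>(1) A(2) by (intro filt_sum[OF k_subring] filt_cmult[OF k_subring]) auto
  also have "(\<Sum>a\<in>?b. \<gamma> a * (mpow I g a - (\<Sum>e\<in>?T. A a e * mpow J x e)))
     = poly F 1 - (\<Sum>a\<in>?b. \<gamma> a * (\<Sum>e\<in>?T. A a e * mpow J x e))"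
    by (simp add: F1 right_diff_distrib sum_subtractf)
  also have "(\<Sum>a\<in>?b. \<gamma> a * (\<Sum>e\<in>?T. A a e * mpow J x e)) = (\<Sum>e\<in>?T. (\<Sum>a\<in>?b. \<gamma> a * A a e) * mpow J x e)"
    unfolding sum_distrib_right sum_distrib_left by (subst sum.swap) (simp only: mult.assoc)
  also have "\<dots> = 0" using \<gamma>(3) by (intro sum.neutral ballI) (simp only: mult_zero_left)
  finally have "poly F 1 \<in> U l'" by (intro filt_U) simp
  from c0[OF F F0 this, of j] have "j \<le> c0 + order 0 F" by (simp add: l'_def m_def)
  also have "order 0 F \<le> degree F" using F0 by (rule order_degree)
  also have "degree F \<le> m * N" unfolding F_def
  proof (rule degree_sum_le[OF finb])
    fix a assume a: "a \<in> ?b"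
    have "degree ([:\<gamma> a:] * mpow I (\<lambda>i. [:g0 i, g i - g0 i:]) a) \<le> tdeg I a"
      using degree_smult_le[of "\<gamma> a"] degree_lift_mpow[of a] by (simp add: le_trans)
    also have "\<dots> \<le> m * N" unfolding tdeg_def m_def cardI[symmetric]
      by (rule order.trans[OF sum_bounded_above[of _ _ N]]) (use a in \<open>auto simp: box_def less_imp_le\<close>)
    finally show "degree ([:\<gamma> a:] * mpow I (\<lambda>i. [:g0 i, g i - g0 i:]) a) \<le> m * N" .
  qed
  finally show False by (simp add: j_def)
qed

end

section \<open>Extension of places\<close>

text \<open>A ring homomorphism defined on a subring is represented by its graph.\<close>

definition partial_hom :: "('a::field \<times> 'b::field) set \<Rightarrow> bool" where
  "partial_hom \<Gamma> \<longleftrightarrow> (1, 1) \<in> \<Gamma> \<and>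
    (\<forall>x x' y y'. (x, x') \<in> \<Gamma> \<longrightarrow> (y, y') \<in> \<Gamma> \<longrightarrow> (x + y, x' + y') \<in> \<Gamma> \<and> (x * y, x' * y') \<in> \<Gamma>) \<and>
    (\<forall>x x'. (x, x') \<in> \<Gamma> \<longrightarrow> (- x, - x') \<in> \<Gamma>) \<and> (\<forall>x'. (0, x') \<in> \<Gamma> \<longrightarrow> x' = 0)"

lemma partial_homD:
  assumes "partial_hom \<Gamma>"
  shows "(1, 1) \<in> \<Gamma>" "(0, 0) \<in> \<Gamma>"
    "(x, x') \<in> \<Gamma> \<Longrightarrow> (y, y') \<in> \<Gamma> \<Longrightarrow> (x + y, x' + y') \<in> \<Gamma>"
    "(x, x') \<in> \<Gamma> \<Longrightarrow> (y, y') \<in> \<Gamma> \<Longrightarrow> (x * y, x' * y') \<in> \<Gamma>"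
    "(x, x') \<in> \<Gamma> \<Longrightarrow> (- x, - x') \<in> \<Gamma>"
    "(x, x') \<in> \<Gamma> \<Longrightarrow> (y, y') \<in> \<Gamma> \<Longrightarrow> (x - y, x' - y') \<in> \<Gamma>"
    "(x, x') \<in> \<Gamma> \<Longrightarrow> (x ^ n, x' ^ n) \<in> \<Gamma>"
    "(x, x') \<in> \<Gamma> \<Longrightarrow> (x, x'') \<in> \<Gamma> \<Longrightarrow> x' = x''"
    "(0, x') \<in> \<Gamma> \<Longrightarrow> x' = 0"
proof -
  show 1: "(1, 1) \<in> \<Gamma>" and 2: "(x, x') \<in> \<Gamma> \<Longrightarrow> (y, y') \<in> \<Gamma> \<Longrightarrow> (x + y, x' + y') \<in> \<Gamma>"
   and 3: "(x, x') \<in> \<Gamma> \<Longrightarrow> (y, y') \<in> \<Gamma> \<Longrightarrow> (x * y, x' * y') \<in> \<Gamma>"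
   and 4: "(x, x') \<in> \<Gamma> \<Longrightarrow> (- x, - x') \<in> \<Gamma>" and 5: "(0, x') \<in> \<Gamma> \<Longrightarrow> x' = 0" for x y x' y'
    using assms unfolding partial_hom_def by blast+
  show "(0, 0) \<in> \<Gamma>" using 2[OF 1 4[OF 1]] by simp
  show 6: "(x - y, x' - y') \<in> \<Gamma>" if "(x, x') \<in> \<Gamma>" "(y, y') \<in> \<Gamma>" for x y x' y'
    using 2[OF that(1) 4[OF that(2)]] by simp
  show "(x ^ n, x' ^ n) \<in> \<Gamma>" if "(x, x') \<in> \<Gamma>"
    using 1 3[OF that] by (induction n) auto
  show "x' = x''" if "(x, x') \<in> \<Gamma>" "(x, x'') \<in> \<Gamma>"
    using 6[OF that] 5 by fastforce
qed

lemma partial_hom_sum: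
  assumes "partial_hom \<Gamma>" "\<And>i. i \<in> A \<Longrightarrow> (f i, f' i) \<in> \<Gamma>"
  shows "(\<Sum>i\<in>A. f i, \<Sum>i\<in>A. f' i) \<in> \<Gamma>"
  using assms(2) by (induction A rule: infinite_finite_induct) (auto intro: partial_homD[OF assms(1)])

section \<open>Maximal partial homomorphisms are places\<close>

context
  fixes M :: "('a::field \<times> 'b::alg_closed_field) set"
  assumes M: "partial_hom M" and M_max: "\<And>\<Gamma>. partial_hom \<Gamma> \<Longrightarrow> M \<subseteq> \<Gamma> \<Longrightarrow> \<Gamma> = M"
begin

text \<open>Localisation at \<open>b\<close> extends the homomorphism, so by maximality it adds
  nothing. The domain is therefore a local ring whose maximal ideal is the kernel.\<close>

lemma max_hom_inverse:
  assumes b: "(b, b') \<in> M" "b' \<noteq> 0"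
  shows "(inverse b, inverse b') \<in> M"
proof -
  have b0: "b \<noteq> 0" using b partial_homD(9)[OF M] by auto
  define \<Gamma> where "\<Gamma> = {(a * inverse b ^ n, a' * inverse b' ^ n) | a a' n. (a, a') \<in> M}"
  have \<Gamma>I: "(a * inverse b ^ n, a' * inverse b' ^ n) \<in> \<Gamma>" if "(a, a') \<in> M" for a a' n
    using that unfolding \<Gamma>_def by blast
  have sub: "M \<subseteq> \<Gamma>" using \<Gamma>I[where n = 0] by auto
  have cancel: "b ^ n * inverse b ^ (n + m) = inverse b ^ m" "b' ^ n * inverse b' ^ (n + m) = inverse b' ^ m" for n m
    using b b0 by (simp_all add: power_add mult.assoc[symmetric] flip: power_mult_distrib)
  have "partial_hom \<Gamma>" unfolding partial_hom_def
  proof (intro conjI allI impI)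
    show "(1, 1) \<in> \<Gamma>" using sub partial_homD(1)[OF M] by blast
  next
    fix x x' y y' assume "(x, x') \<in> \<Gamma>" "(y, y') \<in> \<Gamma>"
    then obtain a a' n c c' m where ac: "(a, a') \<in> M" "(c, c') \<in> M"
      "x = a * inverse b ^ n" "x' = a' * inverse b' ^ n" "y = c * inverse b ^ m" "y' = c' * inverse b' ^ m"
      unfolding \<Gamma>_def by blast
    have "(a * b ^ m + c * b ^ n, a' * b' ^ m + c' * b' ^ n) \<in> M"
      using ac b by (intro partial_homD(3,4,7)[OF M])
    from \<Gamma>I[OF this, of "n + m"] show "(x + y, x' + y') \<in> \<Gamma>"
      using cancel[of n m] cancel[of m n] by (simp add: ac distrib_right mult.assoc add.commute)
    have "(a * c, a' * c') \<in> M" using ac by (intro partial_homD(4)[OF M])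
    from \<Gamma>I[OF this, of "n + m"] show "(x * y, x' * y') \<in> \<Gamma>" by (simp add: ac power_add ac_simps)
  next
    fix x x' assume "(x, x') \<in> \<Gamma>"
    then obtain a a' n where ac: "(a, a') \<in> M" "x = a * inverse b ^ n" "x' = a' * inverse b' ^ n"
      unfolding \<Gamma>_def by blast
    from \<Gamma>I[OF partial_homD(5)[OF M ac(1)], of n] show "(- x, - x') \<in> \<Gamma>" by (simp add: ac)
  next
    fix x' assume "(0, x') \<in> \<Gamma>"
    then obtain a a' n where ac: "(a, a') \<in> M" "0 = a * inverse b ^ n" "x' = a' * inverse b' ^ n"
      unfolding \<Gamma>_def by blast
    then have "a = 0" using b0 by simp
    then show "x' = 0" using ac partial_homD(9)[OF M] by simp
  qed
  then have "\<Gamma> = M" using sub by (rule M_max)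
  then show ?thesis using \<Gamma>I[OF partial_homD(1)[OF M], of 1] by simp
qed

text \<open>\<open>p'\<close> is the reduction of \<open>p\<close>, a polynomial with coefficients
  in the domain of \<open>M\<close>; the two are kept as a pair since \<open>M\<close> is a
  graph.\<close>

definition "lift_pair p p' \<longleftrightarrow> (\<forall>i. (coeff p i, coeff p' i) \<in> M)"

lemma lift_pair_add: "lift_pair p p' \<Longrightarrow> lift_pair s s' \<Longrightarrow> lift_pair (p + s) (p' + s')"
  unfolding lift_pair_def by (simp add: partial_homD(3)[OF M])

lemma lift_pair_uminus: "lift_pair p p' \<Longrightarrow> lift_pair (- p) (- p')"
  unfolding lift_pair_def by (simp add: partial_homD(5)[OF M])

lemma lift_pair_mult: "lift_pair p p' \<Longrightarrow> lift_pair s s' \<Longrightarrow> lift_pair (p * s) (p' * s')"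
  unfolding lift_pair_def coeff_mult
  by (intro allI partial_hom_sum[OF M] partial_homD(4)[OF M]) auto

lemma lift_pair_monom: "(c, c') \<in> M \<Longrightarrow> lift_pair (monom c n) (monom c' n)"
  unfolding lift_pair_def by (auto simp: partial_homD(2)[OF M])

lemma max_hom_extend:
  assumes root: "\<And>p p'. lift_pair p p' \<Longrightarrow> poly p y = 0 \<Longrightarrow> poly p' \<eta> = 0"
  shows "(y, \<eta>) \<in> M"
proof -
  define \<Gamma> where "\<Gamma> = {(poly p y, poly p' \<eta>) | p p'. lift_pair p p'}"
  have \<Gamma>I: "(poly p y, poly p' \<eta>) \<in> \<Gamma>" if "lift_pair p p'" for p p' using that unfolding \<Gamma>_def by blast
  have sub: "M \<subseteq> \<Gamma>"
  proof
    fix z assume "z \<in> M"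
    then show "z \<in> \<Gamma>" using \<Gamma>I[OF lift_pair_monom[of "fst z" "snd z" 0]] by (simp add: poly_monom)
  qed
  have "partial_hom \<Gamma>" unfolding partial_hom_def
  proof (intro conjI allI impI)
    show "(1, 1) \<in> \<Gamma>" using sub partial_homD(1)[OF M] by blast
  next
    fix x x' z z' assume "(x, x') \<in> \<Gamma>" "(z, z') \<in> \<Gamma>"
    then obtain p p' s s' where ac: "lift_pair p p'" "lift_pair s s'"
      "x = poly p y" "x' = poly p' \<eta>" "z = poly s y" "z' = poly s' \<eta>"
      unfolding \<Gamma>_def by blast
    show "(x + z, x' + z') \<in> \<Gamma>" using \<Gamma>I[OF lift_pair_add[OF ac(1,2)]] by (simp add: ac)
    show "(x * z, x' * z') \<in> \<Gamma>" using \<Gamma>I[OF lift_pair_mult[OF ac(1,2)]] by (simp add: ac)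
  next
    fix x x' assume "(x, x') \<in> \<Gamma>"
    then obtain p p' where ac: "lift_pair p p'" "x = poly p y" "x' = poly p' \<eta>"
      unfolding \<Gamma>_def by blast
    show "(- x, - x') \<in> \<Gamma>" using \<Gamma>I[OF lift_pair_uminus[OF ac(1)]] by (simp add: ac)
  next
    fix x' assume "(0, x') \<in> \<Gamma>"
    then show "x' = 0" using root unfolding \<Gamma>_def by auto
  qed
  then have "\<Gamma> = M" using sub by (rule M_max)
  then show ?thesis using \<Gamma>I[OF lift_pair_monom[OF partial_homD(1)[OF M], of 1]] by (simp add: poly_monom)
qed

text \<open>The constant term has nonzero residue and the other coefficients have residue 0, so such
  a \<open>p\<close> says that the maximal ideal generates the unit ideal once \<open>y\<close> is
  adjoined to the domain. The degree bound drives the descent below.\<close>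

definition "unit_rel y n \<longleftrightarrow> (\<exists>p. degree p \<le> n \<and> poly p y = 0 \<and> (\<exists>u. u \<noteq> 0 \<and> (coeff p 0, u) \<in> M) \<and>
  (\<forall>i>0. (coeff p i, 0) \<in> M))"

text \<open>Polynomials over the domain that vanish at \<open>y\<close> reduce to a set
  \<open>J\<close>. If \<open>J\<close> is zero, then \<open>y\<close> may be sent to 0. A nonzero
  constant in \<open>J\<close> is a \<open>unit_rel\<close>. Otherwise an element of least degree
  divides all of \<open>J\<close>, and any root of it in the algebraically closed target is a
  legitimate value for \<open>y\<close>.\<close>

lemma max_hom_dichotomy: "y \<in> Domain M \<or> (\<exists>n. unit_rel y n)"
proof -
  define J where "J = {p'. \<exists>p. lift_pair p p' \<and> poly p y = 0}"
  show ?thesis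
  proof (cases "J \<subseteq> {0}")
    case True
    have "(y, 0) \<in> M"
    proof (rule max_hom_extend)
      fix p p' assume "lift_pair p p'" "poly p y = 0"
      then have "p' \<in> J" unfolding J_def by blast
      then show "poly p' 0 = 0" using True by auto
    qed
    then show ?thesis by blast
  next
    case False
    then obtain j where j: "j \<in> J" "j \<noteq> 0" by blast
    define n where "n = (LEAST n. \<exists>j\<in>J. j \<noteq> 0 \<and> degree j = n)"
    have "\<exists>j\<in>J. j \<noteq> 0 \<and> degree j = n" unfolding n_def
      by (rule LeastI_ex) (use j in blast)
    then obtain j0 where j0: "j0 \<in> J" "j0 \<noteq> 0" "degree j0 = n" by blast
    then have lc0: "coeff j0 n \<noteq> 0" using leading_coeff_neq_0[of j0] by simp
    have min: "n \<le> degree j" if "j \<in> J" "j \<noteq> 0" for j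
      unfolding n_def by (rule Least_le) (use that in blast)
    obtain p0 where p0: "lift_pair p0 j0" "poly p0 y = 0" using j0 unfolding J_def by blast
    show ?thesis
    proof (cases "n = 0")
      case True
      have "(coeff p0 i, 0) \<in> M" if "i > 0" for i
        using p0(1) coeff_eq_0[of j0 i] True j0 that unfolding lift_pair_def by metis
      moreover have "coeff j0 0 \<noteq> 0" using j0 True leading_coeff_neq_0 by metis
      ultimately have "unit_rel y (degree p0)" unfolding unit_rel_def
        using p0 by (intro exI[of _ p0]) (auto simp: lift_pair_def)
      then show ?thesis by blast
    next
      case False
      then obtain \<eta> where \<eta>: "poly j0 \<eta> = 0" using alg_closed_imp_poly_has_root[of j0] j0 by auto
      have all: "j0 dvd j" if "j \<in> J" for j
        using that
      proof (induction "degree j" arbitrary: j rule: less_induct)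
        case less
        show ?case
        proof (cases "j = 0")
          case False
          obtain p where p: "lift_pair p j" "poly p y = 0" using less.prems unfolding J_def by blast
          have dj: "n \<le> degree j" using min less.prems False by blast
          define c where "c = lead_coeff j / lead_coeff j0"
          have "(coeff p0 n, lead_coeff j0) \<in> M" "(coeff p (degree j), lead_coeff j) \<in> M"
            using p0 p j0 unfolding lift_pair_def by auto
          \<comment> \<open>The division step has to be lifted to the domain of \<open>M\<close>:
            the coefficient of \<open>p0\<close> at n has nonzero residue, so it is invertible
            there.\<close>
          then have "(coeff p (degree j) * inverse (coeff p0 n), c) \<in> M"
            unfolding c_def divide_inverse using j0 by (intro partial_homD(4)[OF M] max_hom_inverse) auto
          then obtain a where a: "(a, c) \<in> M" by blast
          define s where "s = monom a (degree j - n) * p0"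
          define s' where "s' = monom c (degree j - n) * j0"
          have ss: "lift_pair s s'" "poly s y = 0" unfolding s_def s'_def using p0 a
            by (auto intro!: lift_pair_mult lift_pair_monom)
          have "j - s' \<in> J" unfolding J_def
            using lift_pair_add[OF p(1) lift_pair_uminus[OF ss(1)]] p(2) ss(2)
            by (intro CollectI exI[of _ "p - s"]) simp
          moreover have "j - s' = 0 \<or> degree (j - s') < degree j"
          proof (cases "degree j = 0")
            case True then show ?thesis using dj \<open>n \<noteq> 0\<close> by simp
          next
            case False
            have c0: "c \<noteq> 0" using \<open>j \<noteq> 0\<close> j0 lc0 by (simp add: c_def)
            have ds: "degree s' = degree j" unfolding s'_def using c0 j0 dj
              by (simp add: degree_mult_eq degree_monom_eq monom_eq_0_iff)
            have "lead_coeff s' = lead_coeff j" unfolding s'_def lead_coeff_mult lead_coeff_monom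
              using j0 lc0 by (simp add: c_def)
            then have "coeff (j - s') (degree j) = 0" using ds by simp
            moreover have "degree (j - s') \<le> degree j" using ds by (intro degree_diff_le) auto
            ultimately show ?thesis using eq_zero_or_degree_less[of "j - s'" "degree j"] by blast
          qed
          ultimately have "j0 dvd j - s'" using less.hyps by auto
          moreover have "j0 dvd s'" by (simp add: s'_def)
          ultimately have "j0 dvd (j - s') + s'" by (rule dvd_add)
          then show ?thesis by simp
        qed simp
      qed
      have "(y, \<eta>) \<in> M"
      proof (rule max_hom_extend)
        fix p p' assume "lift_pair p p'" "poly p y = 0"
        then have "p' \<in> J" unfolding J_def by blast
        then have "j0 dvd p'" by (rule all)
        then show "poly p' \<eta> = 0" using \<eta> by (auto elim: dvdE)
      qed
      then show ?thesis by blast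
    qed
  qed
qed

text \<open>\<open>R\<close> is the reversal of \<open>s\<close> at degree n: it vanishes at
  \<open>y\<close> and its coefficient at n is a unit, so a multiple of it removes the top term of
  \<open>p\<close>. The multiplier has residue 0, hence no residue of a coefficient of
  \<open>p\<close> changes.\<close>

lemma unit_rel_descend:
  assumes y: "y \<noteq> 0" and r: "unit_rel y n" "unit_rel (inverse y) n'" "n' \<le> n"
  shows "\<exists>n1<n. unit_rel y n1"
proof -
  from r obtain p s u v where p: "degree p \<le> n" "poly p y = 0" "u \<noteq> 0" "(coeff p 0, u) \<in> M" "\<And>i. i > 0 \<Longrightarrow> (coeff p i, 0) \<in> M"
    and s: "degree s \<le> n'" "poly s (inverse y) = 0" "v \<noteq> 0" "(coeff s 0, v) \<in> M" "\<And>i. i > 0 \<Longrightarrow> (coeff s i, 0) \<in> M"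
    unfolding unit_rel_def by blast
  have n: "n > 0"
  proof (rule ccontr)
    assume "\<not> n > 0"
    then obtain c where "p = [:c:]" using p(1) degree_eq_zeroE[of p] by auto
    then show False using p partial_homD(9)[OF M, of u] by auto
  qed
  define R where "R = (\<Sum>i\<le>n. monom (coeff s (n - i)) i)"
  have cR: "coeff R i = (if i \<le> n then coeff s (n - i) else 0)" for i
    unfolding R_def coeff_sum by (simp add: sum.delta)
  have "poly R y = (\<Sum>i\<le>n. coeff s (n - i) * y ^ i)" by (simp add: R_def poly_sum poly_monom)
  also have "\<dots> = (\<Sum>i\<le>n. coeff s i * y ^ (n - i))"
    by (rule sum.reindex_bij_witness[of _ "\<lambda>i. n - i" "\<lambda>i. n - i"]) auto
  also have "\<dots> = (\<Sum>i\<le>n. y ^ n * (coeff s i * inverse y ^ i))"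
    using y by (intro sum.cong) (auto simp: power_diff field_simps)
  also have "\<dots> = y ^ n * poly s (inverse y)"
  proof -
    have "poly s (inverse y) = (\<Sum>i\<le>n. coeff s i * inverse y ^ i)"
      unfolding poly_altdef by (rule sum.mono_neutral_left) (use s(1) r(3) in \<open>auto simp: coeff_eq_0\<close>)
    then show ?thesis by (simp add: sum_distrib_left)
  qed
  finally have R0: "poly R y = 0" using s by simp
  have s0: "coeff s 0 \<noteq> 0" using s partial_homD(9)[OF M, of v] by auto
  have inv: "(inverse (coeff s 0), inverse v) \<in> M" using s by (intro max_hom_inverse)
  define c where "c = coeff p n * inverse (coeff s 0)"
  have c: "(c, 0) \<in> M" unfolding c_def using partial_homD(4)[OF M p(5)[OF n] inv] by simp
  define t where "t = p - smult c R"
  have ct: "(c * coeff R i, 0) \<in> M" for i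
  proof -
    have "\<exists>w. (coeff R i, w) \<in> M" using cR[of i] s(4) s(5)[of "n - i"] partial_homD(2)[OF M] by (cases "n - i = 0") auto
    then show ?thesis using partial_homD(4)[OF M c] by fastforce
  qed
  have "degree R \<le> n" by (rule degree_le) (auto simp: cR)
  then have "degree t \<le> n" unfolding t_def using p(1) degree_smult_le[of c R]
    by (intro degree_diff_le) auto
  moreover have "coeff t n = 0" using s0 by (simp add: t_def cR c_def)
  ultimately have "degree t \<le> n - 1" 
    using eq_zero_or_degree_less[of t n] by auto
  moreover have "poly t y = 0" using p R0 by (simp add: t_def)
  moreover have "(coeff t 0, u) \<in> M" using partial_homD(6)[OF M p(4) ct[of 0]] by (simp add: t_def)
  moreover have "(coeff t i, 0) \<in> M" if "i > 0" for i
    using partial_homD(6)[OF M p(5)[OF that] ct[of i]] by (simp add: t_def)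
  ultimately have "unit_rel y (n - 1)" unfolding unit_rel_def using p(3) by blast
  then show ?thesis using n by (intro exI[of _ "n - 1"]) auto
qed

lemma max_hom_valuation: "y \<in> Domain M \<or> (y \<noteq> 0 \<and> inverse y \<in> Domain M)"
proof (rule ccontr)
  assume h: "\<not> ?thesis"
  have y0: "y \<noteq> 0" using h partial_homD(2)[OF M] by blast
  have ex: "\<exists>n. unit_rel y n" "\<exists>n. unit_rel (inverse y) n" using h y0 max_hom_dichotomy by blast+
  define n where "n = (LEAST n. unit_rel y n)"
  define n' where "n' = (LEAST n. unit_rel (inverse y) n)"
  have n: "unit_rel y n" "\<And>n1. n1 < n \<Longrightarrow> \<not> unit_rel y n1"
    using LeastI_ex[OF ex(1)] not_less_Least unfolding n_def by blast+
  have n': "unit_rel (inverse y) n'" "\<And>n1. n1 < n' \<Longrightarrow> \<not> unit_rel (inverse y) n1"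
    using LeastI_ex[OF ex(2)] not_less_Least unfolding n'_def by blast+
  show False
  proof (cases "n' \<le> n")
    case True
    then show ?thesis using unit_rel_descend[OF y0 n(1) n'(1)] n(2) by blast
  next
    case False
    then show ?thesis using unit_rel_descend[of "inverse y" n' n] y0 n n' by auto
  qed
qed

end

text \<open>Chevalley's extension theorem: Zorn's lemma gives a maximal extension, and the domain of
  a maximal one is a valuation ring.\<close>

theorem place_extension:
  fixes \<Gamma>0 :: "('a::field \<times> 'b::alg_closed_field) set"
  assumes "partial_hom \<Gamma>0"
  obtains M where "\<Gamma>0 \<subseteq> M" "partial_hom M" "\<And>y. y \<in> Domain M \<or> (y \<noteq> 0 \<and> inverse y \<in> Domain M)"
    "\<And>b b'. (b, b') \<in> M \<Longrightarrow> b' \<noteq> 0 \<Longrightarrow> (inverse b, inverse b') \<in> M"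
proof -
  define \<A> where "\<A> = {\<Gamma>. \<Gamma>0 \<subseteq> \<Gamma> \<and> partial_hom \<Gamma>}"
  have "\<exists>M\<in>\<A>. \<forall>X\<in>\<A>. M \<subseteq> X \<longrightarrow> X = M"
  proof (rule subset_Zorn_nonempty)
    show "\<A> \<noteq> {}" using assms unfolding \<A>_def by blast
  next
    fix C assume C: "C \<noteq> {}" "subset.chain \<A> C"
    have CA: "C \<subseteq> \<A>" using C(2) by (simp add: subset.chain_def)
    have tot: "X \<subseteq> Y \<or> Y \<subseteq> X" if "X \<in> C" "Y \<in> C" for X Y
      using C(2) that by (auto simp: subset_chain_def)
    have ph: "partial_hom X" "\<Gamma>0 \<subseteq> X" if "X \<in> C" for X using CA that unfolding \<A>_def by blast+
    have "partial_hom (\<Union>C)" unfolding partial_hom_def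
    proof (intro conjI allI impI)
      obtain X where "X \<in> C" using C(1) by blast
      then show "(1, 1) \<in> \<Union>C" using partial_homD(1)[OF ph(1)] by blast
    next
      fix x x' y y' assume "(x, x') \<in> \<Union>C" "(y, y') \<in> \<Union>C"
      then obtain X Y where XY: "X \<in> C" "Y \<in> C" "(x, x') \<in> X" "(y, y') \<in> Y" by blast
      then obtain W where W: "W \<in> C" "(x, x') \<in> W" "(y, y') \<in> W" using tot[OF XY(1,2)] by blast
      show "(x + y, x' + y') \<in> \<Union>C" "(x * y, x' * y') \<in> \<Union>C"
        using W partial_homD(3,4)[OF ph(1)[OF W(1)] W(2,3)] by blast+
    next
      fix x x' assume "(x, x') \<in> \<Union>C"
      then obtain X where X: "X \<in> C" "(x, x') \<in> X" by blast
      then show "(- x, - x') \<in> \<Union>C" using partial_homD(5)[OF ph(1)] by blast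
    next
      fix x' assume "(0, x') \<in> \<Union>C"
      then obtain X where X: "X \<in> C" "(0, x') \<in> X" by blast
      then show "x' = 0" using partial_homD(9)[OF ph(1)] by blast
    qed
    moreover have "\<Gamma>0 \<subseteq> \<Union>C" using C(1) ph(2) by blast
    ultimately show "\<Union>C \<in> \<A>" unfolding \<A>_def by blast
  qed
  then obtain M where "M \<in> \<A>" "\<forall>X\<in>\<A>. M \<subseteq> X \<longrightarrow> X = M" by blast
  then have M: "\<Gamma>0 \<subseteq> M" "partial_hom M" "\<And>\<Gamma>. partial_hom \<Gamma> \<Longrightarrow> M \<subseteq> \<Gamma> \<Longrightarrow> \<Gamma> = M"
    unfolding \<A>_def by auto
  show ?thesis
    using that[OF M(1,2) max_hom_valuation[OF M(2,3)] max_hom_inverse[OF M(2,3)]] by blast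
qed

section \<open>Additive polynomials\<close>

lemma finite_field_power_card: "(a :: 'f::{finite, field}) ^ card (UNIV :: 'f set) = a"
proof (cases "a = 0")
  case True
  then show ?thesis by (simp add: power_0_left finite_UNIV_card_ge_0)
next
  case False
  let ?U = "UNIV - {0 :: 'f}"
  have "(\<Prod>b\<in>?U. a * b) = (\<Prod>b\<in>?U. b)"
    by (rule prod.reindex_bij_witness[of _ "\<lambda>b. inverse a * b" "\<lambda>b. a * b"]) (use False in auto)
  then have "a ^ card ?U * (\<Prod>b\<in>?U. b) = (\<Prod>b\<in>?U. b)" by (simp add: prod.distrib)
  moreover have "(\<Prod>b\<in>?U. b) \<noteq> 0" by simp
  ultimately have u: "a ^ card ?U = 1" by (metis mult_cancel_right2)
  have "card (UNIV :: 'f set) = Suc (card ?U)" by (rule card.remove) auto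
  then show ?thesis by (simp only: power_Suc u mult_1_right)
qed

lemma one_less_card_field: "1 < card (UNIV :: 'f::{finite, field} set)"
proof -
  have "card {0, 1 :: 'f} \<le> card (UNIV :: 'f set)" by (rule card_mono) auto
  then show ?thesis by simp
qed

lemma power_add_split:
  fixes x y :: "'r::comm_ring_1"
  assumes "q > 1"
  shows "(x + y) ^ q = x ^ q + y ^ q + (\<Sum>i\<in>{0<..<q}. of_nat (q choose i) * x ^ i * y ^ (q - i))"
proof -
  have "{..q} = insert 0 (insert q {0<..<q})" using assms by auto
  then show ?thesis using assms by (subst binomial_ring) (simp add: ac_simps)
qed

text \<open>The middle terms of (X + 1) ^ q form a polynomial of degree below q that vanishes at all
  q elements of the field, so it is 0. That q is a prime power does not enter.\<close>

lemma finite_field_binomial: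
  assumes "0 < i" "i < card (UNIV :: 'f::{finite, field} set)"
  shows "of_nat (card (UNIV :: 'f set) choose i) = (0 :: 'f)"
proof -
  let ?q = "card (UNIV :: 'f set)"
  define f where "f = (\<Sum>i\<in>{0<..<?q}. monom (of_nat (?q choose i)) i :: 'f poly)"
  have "poly f a = 0" for a
    using power_add_split[OF one_less_card_field[where 'f = 'f], of a 1]
    by (simp add: f_def poly_sum poly_monom finite_field_power_card)
  then have "{a. poly f a = 0} = UNIV" by auto
  moreover have "degree f < ?q" unfolding f_def
    using one_less_card_field[where 'f = 'f]
    by (intro degree_sum_less) (auto intro: le_less_trans[OF degree_monom_le])
  ultimately have "f = 0" using card_poly_roots_bound[of f] by force
  then have "coeff f i = 0" by simp
  then show ?thesis using assms unfolding f_def coeff_sum by (simp add: sum.delta)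
qed

text \<open>Tied to a type because additivity of the q-th power is needed in the field and in its
  polynomial ring.\<close>

definition frobenius :: "nat \<Rightarrow> 'r::comm_ring_1 itself \<Rightarrow> bool" where
  "frobenius q _ \<longleftrightarrow> q > 1 \<and> (\<forall>x y :: 'r. (x + y) ^ q = x ^ q + y ^ q)"

lemma frobeniusI:
  assumes "q > 1" "\<And>i. 0 < i \<Longrightarrow> i < q \<Longrightarrow> of_nat (q choose i) = (0 :: 'r::comm_ring_1)"
  shows "frobenius q TYPE('r)"
  unfolding frobenius_def using assms by (auto simp: power_add_split)

context
  fixes q :: nat
  assumes fr: "frobenius q TYPE('r::comm_ring_1)"
begin

lemma q_gt_1: "q > 1" using fr by (simp add: frobenius_def)

lemma frob_add: "(x + y :: 'r) ^ q ^ j = x ^ q ^ j + y ^ q ^ j"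
proof (induction j)
  case (Suc j)
  then show ?case using fr by (simp add: frobenius_def power_mult mult.commute[of q])
qed simp

lemma frob_0: "(0 :: 'r) ^ q ^ j = 0"
  using q_gt_1 by (simp add: power_0_left)

lemma frob_uminus: "(- x :: 'r) ^ q ^ j = - (x ^ q ^ j)"
  using frob_add[of x "- x" j] by (simp add: frob_0 eq_neg_iff_add_eq_0 add.commute)

lemma frob_diff: "(x - y :: 'r) ^ q ^ j = x ^ q ^ j - y ^ q ^ j"
  using frob_add[of x "- y" j] by (simp add: frob_uminus)

lemma frob_sum: "(\<Sum>i\<in>A. f i :: 'r) ^ q ^ j = (\<Sum>i\<in>A. f i ^ q ^ j)"
  by (induction A rule: infinite_finite_induct) (simp_all add: frob_0 frob_add)

end

section \<open>Twisted polynomials and their evaluation\<close>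

definition ev :: "nat \<Rightarrow> (nat \<Rightarrow> 'r::comm_ring_1) \<Rightarrow> nat \<Rightarrow> 'r \<Rightarrow> 'r" where
  "ev q c n x = (\<Sum>j\<le>n. c j * x ^ q ^ j)"

text \<open>Multiplication in the twisted polynomial ring with \<tau> c = c ^ q \<tau>;
  \<open>ev_comp\<close> identifies it with composition.\<close>

definition star :: "nat \<Rightarrow> (nat \<Rightarrow> 'r::comm_ring_1) \<Rightarrow> (nat \<Rightarrow> 'r) \<Rightarrow> nat \<Rightarrow> 'r" where
  "star q c d k = (\<Sum>i\<le>k. c i * d (k - i) ^ q ^ i)"

lemma ev_extend:
  assumes "\<And>j. j > n \<Longrightarrow> c j = 0" "n \<le> m"
  shows "ev q c m x = ev q c n x"
  unfolding ev_def by (rule sum.mono_neutral_right) (use assms in auto)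

lemma ev_comp:
  fixes c d :: "nat \<Rightarrow> 'r::comm_ring_1"
  assumes fr: "frobenius q TYPE('r)" and c: "\<And>i. i > n \<Longrightarrow> c i = 0" and d: "\<And>i. i > m \<Longrightarrow> d i = 0"
  shows "ev q c n (ev q d m x) = ev q (star q c d) (n + m) x"
proof -
  let ?f = "\<lambda>i j. c i * d j ^ q ^ i * x ^ q ^ (i + j)"
  have "ev q c n (ev q d m x) = (\<Sum>i\<le>n. \<Sum>j\<le>m. ?f i j)"
    unfolding ev_def by (simp add: frob_sum[OF fr] sum_distrib_left power_mult_distrib mult.assoc power_add
        flip: power_mult) (simp add: mult.commute)
  also have "\<dots> = (\<Sum>(i, j)\<in>{..n} \<times> {..m}. ?f i j)" by (simp add: sum.cartesian_product)
  also have "\<dots> = (\<Sum>(i, j)\<in>{(i, j). i + j \<le> n + m}. ?f i j)"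
  proof (rule sum.mono_neutral_left)
    have "{(i, j). i + j \<le> n + m} \<subseteq> {..n + m} \<times> {..n + m}" by auto
    then show "finite {(i, j). i + j \<le> n + m}" by (rule finite_subset) auto
  next
    show "\<forall>p\<in>{(i, j). i + j \<le> n + m} - {..n} \<times> {..m}. (case p of (i, j) \<Rightarrow> ?f i j) = 0"
    proof
      fix p assume p: "p \<in> {(i, j). i + j \<le> n + m} - {..n} \<times> {..m}"
      obtain i j where ij: "p = (i, j)" by (cases p)
      have "c i * d j ^ q ^ i = 0" if "\<not> j \<le> m" using d[of j] that frob_0[OF fr] by simp
      moreover have "c i = 0" if "\<not> i \<le> n" using c[of i] that by simp
      ultimately show "(case p of (i, j) \<Rightarrow> ?f i j) = 0" using p ij by (cases "i \<le> n"; cases "j \<le> m") auto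
    qed
  qed auto
  also have "\<dots> = (\<Sum>k\<le>n + m. \<Sum>i\<le>k. ?f i (k - i))" by (rule sum.triangle_reindex_eq)
  also have "\<dots> = ev q (star q c d) (n + m) x"
    unfolding ev_def star_def sum_distrib_right by (intro sum.cong) auto
  finally show ?thesis .
qed

lemma infinite_alg_closed: "infinite (UNIV :: 'a::alg_closed_field set)"
proof
  assume fin: "finite (UNIV :: 'a set)"
  define p where "p = (\<Prod>a\<in>(UNIV :: 'a set). [:- a, 1:]) + 1"
  have "poly p x = 1" for x
    using fin by (auto simp: p_def poly_prod prod_zero_iff)
  moreover have "degree p > 0"
  proof -
    have "degree (\<Prod>a\<in>(UNIV :: 'a set). [:- a, 1:]) = (\<Sum>a\<in>(UNIV :: 'a set). 1)"
      by (subst degree_prod_eq_sum_degree) auto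
    then have "degree (\<Prod>a\<in>(UNIV :: 'a set). [:- a, 1:]) > 0" using fin by (simp add: card_gt_0_iff)
    then show ?thesis unfolding p_def by (subst degree_add_eq_left) auto
  qed
  ultimately show False using alg_closed_imp_poly_has_root[of p] by auto
qed

lemma poly_eqI_infinite:
  fixes p s :: "'a::alg_closed_field poly"
  assumes "\<And>x. poly p x = poly s x"
  shows "p = s"
proof (rule ccontr)
  assume "p \<noteq> s"
  then have "finite {x. poly (p - s) x = 0}" by (intro poly_roots_finite) auto
  moreover have "{x. poly (p - s) x = 0} = UNIV" using assms by auto
  ultimately have "finite (UNIV :: 'a set)" by (simp only:)
  then show False using infinite_alg_closed by (rule notE[rotated])
qed

definition ap :: "nat \<Rightarrow> (nat \<Rightarrow> 'r::comm_ring_1) \<Rightarrow> nat \<Rightarrow> 'r poly" where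
  "ap q c n = (\<Sum>j\<le>n. monom (c j) (q ^ j))"

lemma poly_ap: "poly (ap q c n) x = ev q c n x"
  by (simp add: ap_def ev_def poly_sum poly_monom)

lemma coeff_ap:
  assumes "q > 1" shows "coeff (ap q c n) (q ^ j) = (if j \<le> n then c j else 0)"
proof -
  have "q ^ i = q ^ j \<longleftrightarrow> i = j" for i j using assms by (simp add: power_inject_exp)
  then show ?thesis unfolding ap_def coeff_sum by (simp add: sum.delta)
qed

lemma ev_unique:
  fixes c d :: "nat \<Rightarrow> 'a::alg_closed_field"
  assumes q: "q > 1" and eq: "\<And>x. ev q c n x = ev q d n x" and j: "j \<le> n"
  shows "c j = d j"
proof -
  have "ap q c n = ap q d n" by (rule poly_eqI_infinite) (simp add: poly_ap eq)
  then show ?thesis using coeff_ap[OF q, of c n j] coeff_ap[OF q, of d n j] j by simp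
qed

section \<open>Coefficients of a Drinfeld module over an arbitrary ring\<close>

primrec tpow :: "nat \<Rightarrow> (nat \<Rightarrow> 'r::comm_ring_1) \<Rightarrow> nat \<Rightarrow> nat \<Rightarrow> 'r" where
  "tpow q G 0 = (\<lambda>j. if j = 0 then 1 else 0)"
| "tpow q G (Suc k) = star q G (tpow q G k)"

text \<open>Coefficients of the image of \<open>a\<close> when t is sent to the twisted polynomial
  with coefficients \<open>G\<close>. The coefficient ring is general, so the same expression can be
  evaluated at a value of an auxiliary variable or pushed through a place.\<close>

definition dco :: "('f::field \<Rightarrow> 'r::comm_ring_1) \<Rightarrow> nat \<Rightarrow> (nat \<Rightarrow> 'r) \<Rightarrow> 'f poly \<Rightarrow> nat \<Rightarrow> 'r" where
  "dco \<epsilon> q G a j = (\<Sum>k\<le>degree a. \<epsilon> (coeff a k) * tpow q G k j)"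

lemma tpow_0:
  assumes "q > 0" "\<And>i. i > r \<Longrightarrow> G i = 0" "j > r * k"
  shows "tpow q G k j = 0"
  using assms(3)
proof (induction k arbitrary: j)
  case (Suc k)
  have "G i * tpow q G k (j - i) ^ q ^ i = 0" if "i \<le> j" for i
    using assms Suc.IH[of "j - i"] Suc.prems by (cases "i > r") (auto simp: power_0_left)
  then show ?case by (simp add: star_def)
qed simp

lemma tpow_subring:
  assumes "is_subring R" "\<And>i. G i \<in> R"
  shows "tpow q G k j \<in> R"
proof (induction k arbitrary: j)
  case 0 then show ?case by (simp add: is_subringD[OF assms(1)])
next
  case (Suc k)
  then show ?case unfolding tpow.simps star_def
    by (intro subring_sum[OF assms(1)] is_subringD(4,7)[OF assms(1)] assms(2)) auto
qed

lemma dco_subring: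
  assumes "is_subring R" "\<And>i. G i \<in> R" "\<And>c. \<epsilon> c \<in> R"
  shows "dco \<epsilon> q G a j \<in> R"
  unfolding dco_def
  by (intro subring_sum[OF assms(1)] is_subringD(4)[OF assms(1)] tpow_subring[OF assms(1)] assms)

lemma tpow_poly: "poly (tpow q G k j) z = tpow q (\<lambda>i. poly (G i) z) k j"
  by (induction k arbitrary: j) (auto simp: star_def poly_sum)

lemma dco_poly: "poly (dco \<epsilon> q G a j) z = dco (\<lambda>c. poly (\<epsilon> c) z) q (\<lambda>i. poly (G i) z) a j"
  by (simp add: dco_def poly_sum tpow_poly)

lemma tpow_partial_hom:
  assumes "partial_hom M" "\<And>i. (G i, G' i) \<in> M"
  shows "(tpow q G k j, tpow q G' k j) \<in> M"
proof (induction k arbitrary: j)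
  case 0 then show ?case by (simp add: partial_homD[OF assms(1)])
next
  case (Suc k)
  then show ?case unfolding tpow.simps star_def
    by (intro partial_hom_sum[OF assms(1)] partial_homD(4,7)[OF assms(1)] assms(2)) auto
qed

lemma dco_partial_hom:
  assumes "partial_hom M" "\<And>i. (G i, G' i) \<in> M" "\<And>c. (\<epsilon> c, \<epsilon>' c) \<in> M"
  shows "(dco \<epsilon> q G a j, dco \<epsilon>' q G' a j) \<in> M"
  unfolding dco_def
  by (intro partial_hom_sum[OF assms(1)] partial_homD(4)[OF assms(1)] tpow_partial_hom[OF assms(1)] assms)

lemma tpow_lead:
  fixes G :: "nat \<Rightarrow> 'r::idom"
  assumes q: "q > 0" and G: "\<And>i. i > s \<Longrightarrow> G i = 0" "G s \<noteq> 0"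
  shows "tpow q G k (s * k) \<noteq> 0"
proof (induction k)
  case (Suc k)
  have "tpow q G (Suc k) (s * Suc k) = (\<Sum>i\<in>{s}. G i * tpow q G k (s * Suc k - i) ^ q ^ i)"
    unfolding tpow.simps star_def
  proof (rule sum.mono_neutral_right)
    show "\<forall>i\<in>{..s * Suc k} - {s}. G i * tpow q G k (s * Suc k - i) ^ q ^ i = 0"
    proof
      fix i assume i: "i \<in> {..s * Suc k} - {s}"
      show "G i * tpow q G k (s * Suc k - i) ^ q ^ i = 0"
        using i q G tpow_0[of q s G k "s * Suc k - i"] by (cases "i > s") (auto simp: not_less)
    qed
  qed auto
  then show ?case using Suc G by simp
qed simp

lemma dco_lead:
  fixes G :: "nat \<Rightarrow> 'r::idom"
  assumes q: "q > 0" and G: "\<And>i. i > s \<Longrightarrow> G i = 0" "G s \<noteq> 0" and s: "s > 0"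
    and \<epsilon>: "\<epsilon> (lead_coeff a) \<noteq> 0"
  shows "dco \<epsilon> q G a (s * degree a) \<noteq> 0"
proof -
  have "dco \<epsilon> q G a (s * degree a) = (\<Sum>k\<in>{degree a}. \<epsilon> (coeff a k) * tpow q G k (s * degree a))"
    unfolding dco_def by (rule sum.mono_neutral_right) (auto intro!: tpow_0[OF q G(1)] simp: s)
  then show ?thesis using tpow_lead[of q s G "degree a"] assms by simp
qed

text \<open>For invertible c this is conjugation by a scalar: passing to an isomorphic module
  multiplies the coefficient of \<tau> ^ j by c ^ (q ^ j - 1).\<close>

lemma tpow_scale:
  fixes c :: "'r::comm_ring_1"
  assumes "q > 0"
  shows "tpow q (\<lambda>i. G i * c ^ (q ^ i - 1)) k j = tpow q G k j * c ^ (q ^ j - 1)"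
proof (induction k arbitrary: j)
  case (Suc k)
  show ?case unfolding tpow.simps star_def sum_distrib_right
  proof (intro sum.cong refl)
    fix i assume "i \<in> {..j}"
    then have "q ^ j = q ^ i * q ^ (j - i)" by (simp flip: power_add)
    moreover have "q ^ i \<ge> 1" "q ^ (j - i) \<ge> 1" using assms by auto
    ultimately have "q ^ j - 1 = (q ^ i - 1) + (q ^ (j - i) - 1) * q ^ i"
      by (simp add: algebra_simps diff_mult_distrib)
    then show "G i * c ^ (q ^ i - 1) * tpow q (\<lambda>i. G i * c ^ (q ^ i - 1)) k (j - i) ^ q ^ i
        = G i * tpow q G k (j - i) ^ q ^ i * c ^ (q ^ j - 1)"
      unfolding Suc by (simp add: power_mult_distrib power_add power_mult)
  qed
qed simp

lemma dco_scale:
  assumes "q > 0"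
  shows "dco \<epsilon> q (\<lambda>i. G i * c ^ (q ^ i - 1)) a j = dco \<epsilon> q G a j * c ^ (q ^ j - 1)"
  unfolding dco_def tpow_scale[OF assms] sum_distrib_right by (simp add: mult.assoc)

section \<open>Modules over the polynomial ring given by a linear map\<close>

lemma field_embD:
  assumes "field_emb e"
  shows "e 0 = 0" "e 1 = 1" "e (x + y) = e x + e y" "e (x * y) = e x * e y" "e (- x) = - e x" "e x = 0 \<longleftrightarrow> x = 0"
    "e (x ^ n) = e x ^ n" "e (of_nat n) = of_nat n"
proof -
  show 1: "e 0 = 0" "e 1 = 1" "e (x + y) = e x + e y" "e (x * y) = e x * e y" for x y
    using assms by (auto simp: field_emb_def)
  show "e (- x) = - e x" using 1(3)[of x "- x"] 1(1) by (simp add: eq_neg_iff_add_eq_0 add.commute)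
  show "e x = 0 \<longleftrightarrow> x = 0" using 1(4)[of x "inverse x"] 1(1,2) by (cases "x = 0") auto
  show "e (x ^ n) = e x ^ n" by (induction n) (auto simp: 1)
  show "e (of_nat n) = of_nat n" by (induction n) (auto simp: 1)
qed

text \<open>The variable t acts as \<Psi>. Besides \<psi>_t and its twist, \<Psi> may be
  multiplication by a scalar, and \<open>act a 1\<close> is then the value of \<open>a\<close> at
  that scalar.\<close>

locale Fq_module =
  fixes e :: "'f::field \<Rightarrow> 'a::field" and \<Psi> :: "'a \<Rightarrow> 'a"
  assumes e: "field_emb e" and \<Psi>_add: "\<Psi> (x + y) = \<Psi> x + \<Psi> y" and \<Psi>_scale: "\<Psi> (e c * x) = e c * \<Psi> x"
begin

definition act :: "'f poly \<Rightarrow> 'a \<Rightarrow> 'a" where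
  "act a x = (\<Sum>k\<le>degree a. e (coeff a k) * (\<Psi> ^^ k) x)"

lemma \<Psi>_0: "\<Psi> 0 = 0" using \<Psi>_scale[of 0 0] by (simp add: field_embD[OF e])

lemma \<Psi>_sum: "\<Psi> (\<Sum>i\<in>A. f i) = (\<Sum>i\<in>A. \<Psi> (f i))"
  by (induction A rule: infinite_finite_induct) (auto simp: \<Psi>_0 \<Psi>_add)

lemma act_altdef: "degree a \<le> n \<Longrightarrow> act a x = (\<Sum>k\<le>n. e (coeff a k) * (\<Psi> ^^ k) x)"
  unfolding act_def by (rule sum.mono_neutral_left) (auto simp: coeff_eq_0 field_embD[OF e])

lemma act_0 [simp]: "act 0 x = 0" by (simp add: act_def field_embD[OF e])

lemma act_add: "act (a + b) x = act a x + act b x"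
proof -
  let ?n = "max (degree a) (degree b)"
  have "act (a + b) x = (\<Sum>k\<le>?n. e (coeff (a + b) k) * (\<Psi> ^^ k) x)"
    by (rule act_altdef) (rule degree_add_le_max)
  also have "\<dots> = act a x + act b x"
    by (simp add: act_altdef[of a ?n] act_altdef[of b ?n] field_embD[OF e] distrib_right sum.distrib)
  finally show ?thesis .
qed

lemma act_smult: "act (smult c a) x = e c * act a x"
  by (subst act_altdef[of _ "degree a"]) (auto simp: act_def degree_smult_le sum_distrib_left field_embD[OF e] mult.assoc)

lemma act_pCons: "act (pCons c a) x = e c * x + \<Psi> (act a x)"
proof -
  have "act (pCons c a) x = (\<Sum>k\<le>Suc (degree a). e (coeff (pCons c a) k) * (\<Psi> ^^ k) x)"
    by (rule act_altdef) (rule degree_pCons_le)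
  also have "\<dots> = e c * x + (\<Sum>k\<le>degree a. e (coeff a k) * \<Psi> ((\<Psi> ^^ k) x))"
    by (subst sum.atMost_Suc_shift) simp
  finally show ?thesis by (simp add: act_def \<Psi>_sum \<Psi>_scale)
qed

lemma act_1 [simp]: "act 1 x = x"
  by (simp add: one_pCons act_pCons \<Psi>_0 field_embD[OF e])

lemma act_t: "act [:0, 1:] x = \<Psi> x"
  by (simp add: act_pCons \<Psi>_0 field_embD[OF e])

lemma act_mult: "act (a * b) x = act a (act b x)"
  by (induction a) (simp_all add: act_add act_smult act_pCons field_embD[OF e])

lemma act_x_add: "act a (x + y) = act a x + act a y"
  by (induction a) (simp_all add: act_pCons \<Psi>_add distrib_left)

lemma act_x_0 [simp]: "act a 0 = 0"
  by (induction a) (simp_all add: act_pCons \<Psi>_0)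

lemma act_x_sum: "act a (\<Sum>i\<in>A. f i) = (\<Sum>i\<in>A. act a (f i))"
  by (induction A rule: infinite_finite_induct) (auto simp: act_x_add)

lemma act_sum: "act (\<Sum>i\<in>A. f i) x = (\<Sum>i\<in>A. act (f i) x)"
  by (induction A rule: infinite_finite_induct) (auto simp: act_add)

lemma act_uminus: "act (- a) x = - act a x"
  using act_add[of a "- a" x] by (simp add: eq_neg_iff_add_eq_0 add.commute)

lemma act_diff: "act (a - b) x = act a x - act b x"
  using act_add[of a "- b" x] by (simp add: act_uminus)

lemma act_commute: "act a (\<Psi> x) = \<Psi> (act a x)"
  using act_mult[of a "[:0, 1:]" x] act_mult[of "[:0, 1:]" a x] by (simp add: act_t mult.commute)

lemma act_mod: "act b x = 0 \<Longrightarrow> act (a mod b) x = act a x"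
proof -
  assume "act b x = 0"
  then have "act (a div b * b) x = 0" by (simp add: act_mult)
  then show ?thesis using act_add[of "a div b * b" "a mod b" x] by simp
qed

end

section \<open>Drinfeld modules in special characteristic\<close>

lemma tpow_lead_1:
  assumes q: "q > 0" and G: "\<And>i. i > s \<Longrightarrow> G i = 0" "G s = 1"
  shows "tpow q G k (s * k) = 1"
proof (induction k)
  case (Suc k)
  have "tpow q G (Suc k) (s * Suc k) = (\<Sum>i\<in>{s}. G i * tpow q G k (s * Suc k - i) ^ q ^ i)"
    unfolding tpow.simps star_def
  proof (rule sum.mono_neutral_right)
    show "\<forall>i\<in>{..s * Suc k} - {s}. G i * tpow q G k (s * Suc k - i) ^ q ^ i = 0"
    proof
      fix i assume i: "i \<in> {..s * Suc k} - {s}"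
      show "G i * tpow q G k (s * Suc k - i) ^ q ^ i = 0"
        using i q G tpow_0[of q s G k "s * Suc k - i"] by (cases "i > s") (auto simp: not_less power_0_left)
    qed
  qed auto
  then show ?case using Suc G by simp
qed simp

lemma card_poly_degree_less:
  assumes "d > 0"
  shows "finite {a :: 'f::{finite, field} poly. degree a < d} \<and>
    card {a :: 'f poly. degree a < d} = card (UNIV :: 'f set) ^ d"
proof -
  have "bij_betw (\<lambda>a. restrict (coeff a) {..<d}) {a :: 'f poly. degree a < d} ({..<d} \<rightarrow>\<^sub>E UNIV)"
    unfolding bij_betw_def
  proof
    show "inj_on (\<lambda>a. restrict (coeff a) {..<d}) {a :: 'f poly. degree a < d}"
    proof (rule inj_onI)
      fix a b :: "'f poly"
      assume ab: "a \<in> {a. degree a < d}" "b \<in> {a. degree a < d}" "restrict (coeff a) {..<d} = restrict (coeff b) {..<d}"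
      show "a = b"
      proof (rule poly_eqI)
        fix i
        show "coeff a i = coeff b i"
        proof (cases "i < d")
          case True
          then show ?thesis using fun_cong[OF ab(3), of i] by simp
        next
          case False
          then show ?thesis using ab by (simp add: coeff_eq_0)
        qed
      qed
    qed
  next
    show "(\<lambda>a. restrict (coeff a) {..<d}) ` {a :: 'f poly. degree a < d} = ({..<d} \<rightarrow>\<^sub>E UNIV)"
    proof (intro Set.set_eqI iffI)
      fix f :: "nat \<Rightarrow> 'f" assume f: "f \<in> ({..<d} \<rightarrow>\<^sub>E UNIV)"
      define a where "a = (\<Sum>i<d. monom (f i) i)"
      have c: "coeff a j = (if j < d then f j else 0)" for j
        unfolding a_def coeff_sum by (simp add: sum.delta)
      have "degree a \<le> d - 1" by (rule degree_le) (auto simp: c)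
      then have "degree a < d" using assms by simp
      moreover have "restrict (coeff a) {..<d} = f"
        using f by (auto simp: fun_eq_iff c restrict_def PiE_def extensional_def)
      ultimately show "f \<in> (\<lambda>a. restrict (coeff a) {..<d}) ` {a :: 'f poly. degree a < d}" by blast
    qed (auto split: if_splits)
  qed
  moreover have "finite ({..<d} \<rightarrow>\<^sub>E (UNIV :: 'f set))" by (intro finite_PiE) auto
  moreover have "card ({..<d} \<rightarrow>\<^sub>E (UNIV :: 'f set)) = card (UNIV :: 'f set) ^ d" by (simp add: card_PiE)
  ultimately show ?thesis using bij_betw_finite bij_betw_same_card by metis
qed

lemma finite_preorder_max:
  assumes "finite A" "A \<noteq> {}" and tot: "\<And>x y. R x y \<or> R y x" and trans: "\<And>x y z. R x y \<Longrightarrow> R y z \<Longrightarrow> R x z"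
  shows "\<exists>y\<in>A. \<forall>x\<in>A. R x y"
  using assms(1,2)
proof (induction A rule: finite_ne_induct)
  case (singleton x) then show ?case using tot by blast
next
  case (insert x F)
  then obtain y where "y \<in> F" "\<forall>x\<in>F. R x y" by blast
  then show ?case using tot[of x y] tot[of x x] trans by blast
qed

lemma poly_map_poly_emb:
  assumes "field_emb e"
  shows "poly (map_poly e p) x = (\<Sum>i\<le>degree p. e (coeff p i) * x ^ i)"
proof -
  have "degree (map_poly e p) = degree p"
    by (intro degree_map_poly) (simp_all add: field_embD[OF assms])
  then show ?thesis by (simp add: poly_altdef coeff_map_poly field_embD[OF assms])
qed

locale drinfeld =
  fixes e :: "'f::{finite, field} \<Rightarrow> 'a::alg_closed_field"
    and P :: "'f poly" and tb :: 'a and g :: "nat \<Rightarrow> 'a" and r n :: nat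
  assumes r: "r \<ge> 2" and n: "n \<ge> 1" and e: "field_emb e"
    and P_monic: "lead_coeff P = 1" and P_irr: "irreducible P"
    and tb: "poly (map_poly e P) tb = 0"
    and g_indep: "alg_indep (alg_closure_of e) g {1..<r}"
begin

definition q :: nat where "q = card (UNIV :: 'f set)"
definition d :: nat where "d = degree P"
definition k :: "'a set" where "k = alg_closure_of e"

text \<open>The parameters are an argument since \<psi> itself (\<open>g\<close>), its Frobenius
  twist (\<open>gN\<close>) and its supersingular specialization (\<open>g0\<close>) are
  compared.\<close>

definition coefs :: "(nat \<Rightarrow> 'a) \<Rightarrow> nat \<Rightarrow> 'a" where
  "coefs h i = (if i = 0 then tb else if i < r then h i else if i = r then 1 else 0)"

definition \<Psi> :: "(nat \<Rightarrow> 'a) \<Rightarrow> 'a \<Rightarrow> 'a" where "\<Psi> h = ev q (coefs h) r"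

lemma q1: "q > 1" unfolding q_def by (rule one_less_card_field)

lemma q0: "q > 0" using q1 by simp

lemma binom_q: "0 < i \<Longrightarrow> i < q \<Longrightarrow> of_nat (q choose i) = (0 :: 'a)"
  using finite_field_binomial[where 'f = 'f, of i] field_embD(1,8)[OF e] unfolding q_def by metis

lemma fr: "frobenius q TYPE('a)" using q1 binom_q by (rule frobeniusI)

lemma frp: "frobenius q TYPE('a poly)"
  using q1 by (rule frobeniusI) (simp add: binom_q of_nat_poly)

lemma e_q: "e c ^ q ^ j = e c"
proof (induction j)
  case (Suc j)
  have "e c ^ q ^ Suc j = (e c ^ q ^ j) ^ q" by (simp only: power_Suc2 power_mult)
  also have "\<dots> = e (c ^ q)" by (simp add: Suc field_embD[OF e])
  finally show ?case by (simp add: q_def finite_field_power_card)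
qed simp

lemma d_pos: "d > 0"
proof (rule ccontr)
  assume "\<not> d > 0"
  then obtain c where c: "P = [:c:]" using degree_eq_zeroE[of P] by (auto simp: d_def)
  then have "P = 1" using P_monic by (simp add: one_pCons)
  then show False using P_irr by simp
qed

lemma P_0: "P \<noteq> 0" using P_irr by auto

lemma Fq_module_ev: "Fq_module e (ev q c N)"
proof (unfold_locales)
  show "field_emb e" by (rule e)
  show "ev q c N (x + y) = ev q c N x + ev q c N y" for x y
    by (simp add: ev_def frob_add[OF fr] distrib_left sum.distrib)
  show "ev q c N (e a * x) = e a * ev q c N x" for a x
    by (simp add: ev_def power_mult_distrib e_q sum_distrib_left mult.left_commute)
qed

definition act :: "(nat \<Rightarrow> 'a) \<Rightarrow> 'f poly \<Rightarrow> 'a \<Rightarrow> 'a" where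
  "act h = Fq_module.act e (\<Psi> h)"

lemma module: "Fq_module e (\<Psi> h)" unfolding \<Psi>_def by (rule Fq_module_ev)

abbreviation dc :: "(nat \<Rightarrow> 'a) \<Rightarrow> 'f poly \<Rightarrow> nat \<Rightarrow> 'a" where
  "dc h \<equiv> dco e q (coefs h)"

lemma coefs_0: "i > r \<Longrightarrow> coefs h i = 0" using r by (simp add: coefs_def)

lemma tpow_coefs_0: "j > r * i \<Longrightarrow> tpow q (coefs h) i j = 0"
  by (rule tpow_0[OF q0, where r = r]) (auto simp: coefs_0)

lemma dc_0: "j > r * degree a \<Longrightarrow> dc h a j = 0"
  unfolding dco_def
proof (intro sum.neutral ballI)
  fix i assume j: "j > r * degree a" and "i \<in> {..degree a}"
  then have "r * i < j" by (intro le_less_trans[OF _ j]) simp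
  from tpow_coefs_0[OF this] show "e (coeff a i) * tpow q (coefs h) i j = 0" by simp
qed

lemma \<Psi>_pow: "(\<Psi> h ^^ i) x = ev q (tpow q (coefs h) i) (r * i) x"
proof (induction i)
  case 0 then show ?case by (simp add: ev_def)
next
  case (Suc i)
  have "(\<Psi> h ^^ Suc i) x = ev q (coefs h) r (ev q (tpow q (coefs h) i) (r * i) x)"
    by (simp only: funpow.simps comp_apply Suc) (simp only: \<Psi>_def)
  also have "\<dots> = ev q (star q (coefs h) (tpow q (coefs h) i)) (r + r * i) x"
    by (rule ev_comp[OF fr coefs_0 tpow_coefs_0])
  finally show ?case by simp
qed

lemma act_ev: "act h a x = ev q (dc h a) (r * degree a) x"
proof -
  have "act h a x = (\<Sum>i\<le>degree a. e (coeff a i) * ev q (tpow q (coefs h) i) (r * degree a) x)"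
    unfolding act_def Fq_module.act_def[OF module]
  proof (intro sum.cong refl)
    fix i assume "i \<in> {..degree a}"
    then have "ev q (tpow q (coefs h) i) (r * degree a) x = ev q (tpow q (coefs h) i) (r * i) x"
      by (intro ev_extend tpow_coefs_0) auto
    then show "e (coeff a i) * (\<Psi> h ^^ i) x = e (coeff a i) * ev q (tpow q (coefs h) i) (r * degree a) x"
      by (simp add: \<Psi>_pow)
  qed
  also have "\<dots> = ev q (dc h a) (r * degree a) x"
    unfolding ev_def dco_def sum_distrib_left sum_distrib_right
    by (subst sum.swap) (simp only: mult.assoc)
  finally show ?thesis .
qed

text \<open>Comparison of lowest terms in \<psi>_t \<psi>_a = \<psi>_a \<psi>_t: with D the
  coefficients of \<psi>_a, one side gives tb * D j, the other D j * tb ^ q ^ j.\<close>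

lemma lowest_coeff:
  assumes low: "\<And>i. i < j \<Longrightarrow> dc h a i = 0" and j: "dc h a j \<noteq> 0"
  shows "tb ^ q ^ j = tb"
proof -
  let ?D = "dc h a" and ?C = "coefs h" and ?N = "r * degree a"
  have eq: "ev q (star q ?C ?D) (r + ?N) x = ev q (star q ?D ?C) (r + ?N) x" for x
  proof -
    have "ev q (star q ?C ?D) (r + ?N) x = \<Psi> h (act h a x)"
      unfolding \<Psi>_def act_ev by (rule ev_comp[OF fr coefs_0 dc_0, symmetric])
    also have "\<dots> = act h a (\<Psi> h x)" unfolding act_def by (rule Fq_module.act_commute[OF module, symmetric])
    also have "\<dots> = ev q (star q ?D ?C) (?N + r) x"
      unfolding \<Psi>_def act_ev by (rule ev_comp[OF fr dc_0 coefs_0])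
    finally show ?thesis by (simp add: add.commute)
  qed
  have "j \<le> ?N" using j dc_0[of a j h] by (meson not_le)
  then have "star q ?C ?D j = star q ?D ?C j" by (intro ev_unique[OF q1 eq]) simp
  moreover have "star q ?C ?D j = (\<Sum>i\<in>{0}. ?C i * ?D (j - i) ^ q ^ i)" unfolding star_def
    by (rule sum.mono_neutral_right) (auto simp: low frob_0[OF fr])
  moreover have "star q ?D ?C j = (\<Sum>i\<in>{j}. ?D i * ?C (j - i) ^ q ^ i)" unfolding star_def
    by (rule sum.mono_neutral_right) (auto simp: low)
  ultimately have "tb * ?D j = ?D j * tb ^ q ^ j" by (simp add: coefs_def)
  then show ?thesis using j by simp
qed

section \<open>The root \<open>tb\<close>: minimal polynomial and Frobenius period\<close>

lemma tb_module: "Fq_module e (\<lambda>x. tb * x)"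
  by unfold_locales (auto simp: e distrib_left mult.left_commute)

definition evt :: "'f poly \<Rightarrow> 'a" where "evt a = Fq_module.act e (\<lambda>x. tb * x) a 1"

lemma evt_altdef: "evt a = (\<Sum>i\<le>degree a. e (coeff a i) * tb ^ i)"
proof -
  have "((\<lambda>x. tb * x) ^^ i) 1 = tb ^ i" for i by (induction i) auto
  then show ?thesis by (simp add: evt_def Fq_module.act_def[OF tb_module])
qed

lemma evt_mult: "evt (a * b) = evt a * evt b"
proof -
  have *: "Fq_module.act e (\<lambda>x. tb * x) a x = evt a * x" for x
  proof -
    have "((\<lambda>x. tb * x) ^^ i) x = tb ^ i * x" for i by (induction i) (auto simp: mult.assoc)
    then show ?thesis by (simp add: evt_altdef Fq_module.act_def[OF tb_module] sum_distrib_right mult.assoc)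
  qed
  have "evt (a * b) = Fq_module.act e (\<lambda>x. tb * x) a (evt b)"
    unfolding evt_def by (rule Fq_module.act_mult[OF tb_module])
  then show ?thesis by (simp only: *)
qed

lemma evt_P: "evt P = 0"
  using tb by (simp add: evt_altdef poly_map_poly_emb[OF e])

text \<open>An annihilator of \<open>tb\<close> of least degree divides \<open>P\<close>, so by
  irreducibility it has degree d.\<close>

lemma evt_nonzero: "a \<noteq> 0 \<Longrightarrow> degree a < d \<Longrightarrow> evt a \<noteq> 0"
proof
  assume a: "a \<noteq> 0" "degree a < d" "evt a = 0"
  let ?Q = "\<lambda>N. \<exists>a. a \<noteq> 0 \<and> evt a = 0 \<and> degree a = N"
  define N where "N = (LEAST N. ?Q N)"
  have "?Q N" unfolding N_def by (rule LeastI_ex) (use a in blast)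
  then obtain j where j: "j \<noteq> 0" "evt j = 0" "degree j = N" by blast
  have "N \<le> degree a" unfolding N_def by (rule Least_le) (use a in blast)
  then have "N < d" using a by simp
  have "P mod j = 0"
  proof (rule ccontr)
    assume "P mod j \<noteq> 0"
    moreover have "evt (P mod j) = 0"
    proof -
      have "evt P = evt (P div j * j) + evt (P mod j)"
        unfolding evt_def by (simp flip: Fq_module.act_add[OF tb_module])
      then show ?thesis using j by (simp add: evt_P evt_mult)
    qed
    ultimately have "N \<le> degree (P mod j)" unfolding N_def by (intro Least_le) blast
    moreover have "degree (P mod j) < degree j" using j \<open>P mod j \<noteq> 0\<close> by (metis degree_mod_less)
    ultimately show False using j by simp
  qed
  then obtain c where c: "P = j * c" by (metis dvd_def mod_eq_0_iff_dvd)
  then consider "j dvd 1" | "c dvd 1" using P_irr by (metis irreducibleD)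
  then show False
  proof cases
    case 1
    then obtain u where "j = [:u:]" "u \<noteq> 0" using j by (auto simp: is_unit_poly_iff)
    then show ?thesis using j by (simp add: evt_altdef field_embD[OF e])
  next
    case 2
    then have "degree c = 0" by (auto simp: is_unit_poly_iff)
    then have "degree P = degree j" using c j P_0 by (simp add: degree_mult_eq)
    then show ?thesis using \<open>N < d\<close> j by (simp add: d_def)
  qed
qed

text \<open>The values a(tb) with deg a < d are q ^ d distinct elements fixed by the power q ^ j,
  while X ^ (q ^ j) - X has at most q ^ j roots.\<close>

lemma tb_period: assumes "j > 0" "tb ^ q ^ j = tb" shows "d \<le> j"
proof -
  let ?A = "{a :: 'f poly. degree a < d}"
  have inj: "inj_on evt ?A"
  proof (rule inj_onI)
    fix a b assume ab: "a \<in> ?A" "b \<in> ?A" "evt a = evt b"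
    then have "evt (a - b) = 0" unfolding evt_def by (simp add: Fq_module.act_diff[OF tb_module])
    moreover have "degree (a - b) < d" using ab by (intro degree_diff_less) auto
    ultimately show "a = b" using evt_nonzero[of "a - b"] by auto
  qed
  define p where "p = monom 1 (q ^ j) - monom (1::'a) 1"
  have qj: "q ^ j > 1" using one_less_power[OF q1 assms(1)] .
  then have deg: "degree p = q ^ j" unfolding p_def
    by (subst diff_conv_add_uminus, subst degree_add_eq_left) (auto simp: degree_monom_eq)
  then have p0: "p \<noteq> 0" using qj q0 by auto
  have "evt ` ?A \<subseteq> {x. poly p x = 0}"
  proof safe
    fix a :: "'f poly"
    have tbi: "(tb ^ i) ^ q ^ j = tb ^ i" for i using assms(2) by (metis power_mult mult.commute)
    have "evt a ^ q ^ j = evt a"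
      unfolding evt_altdef frob_sum[OF fr] by (simp add: power_mult_distrib e_q tbi)
    then show "poly p (evt a) = 0" by (simp add: p_def poly_monom)
  qed
  then have "card (evt ` ?A) \<le> card {x. poly p x = 0}" using p0 by (intro card_mono poly_roots_finite)
  also have "\<dots> \<le> q ^ j" using card_poly_roots_bound[OF p0] deg by simp
  finally have "q ^ d \<le> q ^ j"
    using card_image[OF inj] card_poly_degree_less[OF d_pos, where 'f = 'f] by (simp add: q_def)
  then show ?thesis by (rule power_le_imp_le_exp[OF q1])
qed

text \<open>The constant coefficient of \<psi>_P is P(tb) = 0, and the index of the lowest nonzero
  coefficient is a period of \<open>tb\<close> under Frobenius.\<close>

lemma dc_P_low: "j < d \<Longrightarrow> dc h P j = 0"
proof (rule ccontr)
  assume j: "j < d" "dc h P j \<noteq> 0"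
  define j0 where "j0 = (LEAST j. dc h P j \<noteq> 0)"
  have j0: "dc h P j0 \<noteq> 0" unfolding j0_def by (rule LeastI[of "\<lambda>j. dc h P j \<noteq> 0"]) (rule j(2))
  have low: "dc h P i = 0" if "i < j0" for i using not_less_Least[of i] that unfolding j0_def by blast
  have "j0 \<le> j" unfolding j0_def by (rule Least_le) (rule j(2))
  have "tpow q (coefs h) i 0 = tb ^ i" for i by (induction i) (auto simp: star_def coefs_def)
  then have "dc h P 0 = evt P" by (simp add: dco_def evt_altdef)
  then have "j0 \<noteq> 0" using j0 evt_P by metis
  then show False using tb_period[of j0] lowest_coeff[of j0 h P] low j0 \<open>j0 \<le> j\<close> j(1) by auto
qed

text \<open>Powers of an algebraic element lie in a finite set, so two of its Frobenius powers
  coincide, and injectivity of Frobenius moves the coincidence down to the element. In this form the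
  closure of \<open>k\<close> under the field operations is immediate.\<close>

lemma k_iff: "x \<in> k \<longleftrightarrow> (\<exists>j>0. x ^ q ^ j = x)"
proof
  assume "\<exists>j>0. x ^ q ^ j = x"
  then obtain j where j: "j > 0" "x ^ q ^ j = x" by blast
  let ?p = "monom 1 (q ^ j) - monom (1::'f) 1"
  have qj: "q ^ j > 1" using one_less_power[OF q1 j(1)] .
  then have "coeff ?p (q ^ j) \<noteq> 0" by simp
  then have "?p \<noteq> 0" by (metis coeff_0)
  moreover have "map_poly e ?p = monom 1 (q ^ j) - monom 1 1"
    by (rule poly_eqI) (auto simp: coeff_map_poly field_embD[OF e])
  then have "poly (map_poly e ?p) x = 0" using j by (simp add: poly_monom)
  ultimately show "x \<in> k" unfolding k_def alg_closure_of_def by blast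
next
  assume "x \<in> k"
  then obtain p where p: "p \<noteq> 0" "poly (map_poly e p) x = 0" unfolding k_def alg_closure_of_def by blast
  let ?ev = "\<lambda>a::'f poly. Fq_module.act e (\<lambda>y. x * y) a 1"
  have xm: "Fq_module e (\<lambda>y. x * y)" by unfold_locales (auto simp: e distrib_left mult.left_commute)
  have pw: "((\<lambda>y. x * y) ^^ i) y = x ^ i * y" for i y by (induction i) (auto simp: mult.assoc)
  have ev: "?ev a = (\<Sum>i\<le>degree a. e (coeff a i) * x ^ i)" for a by (simp add: Fq_module.act_def[OF xm] pw)
  have "poly (map_poly e p) x = ?ev p" by (simp only: ev poly_map_poly_emb[OF e])
  then have evp: "?ev p = 0" using p by simp
  have "degree p > 0"
  proof (rule ccontr)
    assume "\<not> degree p > 0"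
    then obtain c where c: "p = [:c:]" using degree_eq_zeroE[of p] by auto
    then have "e c = 0" using evp by (simp add: ev)
    then show False using c p by (simp add: field_embD[OF e])
  qed
  let ?A = "{a :: 'f poly. degree a < degree p}"
  have fin: "finite (?ev ` ?A)" 
    using card_poly_degree_less[OF \<open>degree p > 0\<close>, where 'f = 'f] by (intro finite_imageI) blast
  have "x ^ i \<in> ?ev ` ?A" for i
  proof (rule image_eqI)
    show "monom 1 i mod p \<in> ?A" 
      using \<open>degree p > 0\<close> degree_mod_less[OF p(1), of "monom 1 i"] by auto
    have "?ev (monom 1 i) = x ^ i"
      unfolding ev by (simp add: degree_monom_eq field_embD[OF e] if_distrib[of e] if_distrib[of "\<lambda>y. y * _"] cong: if_cong)
    moreover have "?ev (monom 1 i mod p) = ?ev (monom 1 i)" using Fq_module.act_mod[OF xm evp] .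
    ultimately show "x ^ i = ?ev (monom 1 i mod p)" by simp
  qed
  then have "range (\<lambda>i. x ^ q ^ i) \<subseteq> ?ev ` ?A" by blast
  then have "finite (range (\<lambda>i. x ^ q ^ i))" using fin by (rule finite_subset)
  then have "\<not> inj (\<lambda>i. x ^ q ^ i)" using finite_imageD infinite_UNIV_nat by blast
  then obtain a b where ab: "a < b" "x ^ q ^ a = x ^ q ^ b" unfolding inj_def by (metis nat_neq_iff)
  have "q ^ b = q ^ (b - a) * q ^ a" using ab by (simp flip: power_add)
  then have "(x ^ q ^ (b - a) - x) ^ q ^ a = 0" using ab by (simp add: frob_diff[OF fr] power_mult)
  then have "x ^ q ^ (b - a) = x" by simp
  then show "\<exists>j>0. x ^ q ^ j = x" using ab by (intro exI[of _ "b - a"]) auto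
qed

lemma k_common:
  assumes "x \<in> k" "y \<in> k"
  shows "\<exists>j>0. x ^ q ^ j = x \<and> y ^ q ^ j = y"
proof -
  from assms obtain i j where ij: "i > 0" "x ^ q ^ i = x" "j > 0" "y ^ q ^ j = y" by (auto simp: k_iff)
  have pw: "z ^ q ^ (i * l) = z" if "z ^ q ^ i = z" for z :: 'a and i l
  proof (induction l)
    case (Suc l)
    have "z ^ q ^ (i * Suc l) = (z ^ q ^ i) ^ q ^ (i * l)" by (simp add: power_add power_mult)
    then show ?case by (simp add: that Suc)
  qed simp
  show ?thesis using pw[OF ij(2), of j] pw[OF ij(4), of i] ij
    by (intro exI[of _ "i * j"]) (auto simp: mult.commute)
qed

lemma k_subfield: "is_subfield k"
  unfolding is_subfield_def
proof (intro conjI ballI)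
  show "0 \<in> k" "1 \<in> k" by (auto simp: k_iff frob_0[OF fr] intro!: exI[of _ 1])
next
  fix x y assume "x \<in> k" "y \<in> k"
  then obtain j where "j > 0" "x ^ q ^ j = x" "y ^ q ^ j = y" using k_common by blast
  then show "x + y \<in> k" "x * y \<in> k"
    by (auto simp: k_iff frob_add[OF fr] power_mult_distrib intro!: exI[of _ j])
next
  fix x assume "x \<in> k"
  then obtain j where "j > 0" "x ^ q ^ j = x" by (auto simp: k_iff)
  then show "- x \<in> k" "inverse x \<in> k"
    by (auto simp: k_iff frob_uminus[OF fr] power_inverse intro!: exI[of _ j])
qed

lemma k_subring: "is_subring k" using k_subfield by (rule subfield_subring)

lemma e_k: "e c \<in> k" by (auto simp: k_iff e_q[of _ 1, simplified] intro!: exI[of _ 1])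

lemma tb_k: "tb \<in> k" unfolding k_def alg_closure_of_def using tb P_0 by blast

end

section \<open>Existence of a supersingular specialization\<close>

lemma alg_indepD:
  assumes "alg_indep K g I" "finite S" "S \<subseteq> exps I" "\<And>e. e \<in> S \<Longrightarrow> c e \<in> K"
    "(\<Sum>e\<in>S. c e * mpow I g e) = 0" "e \<in> S"
  shows "c e = 0"
proof -
  have "finite S \<and> (\<forall>e\<in>S. \<forall>i. i \<notin> I \<longrightarrow> e i = 0) \<and> (\<forall>e\<in>S. c e \<in> K) \<and>
      (\<Sum>e\<in>S. c e * (\<Prod>i\<in>I. g i ^ e i)) = 0"
    using assms(2-5) unfolding mpow_def by (auto simp: exps_def)
  then show ?thesis using assms(1,6) unfolding alg_indep_def by blast
qed

lemma geometric_nat: "(x - 1) * (\<Sum>t<N. x ^ t) = x ^ N - (1::nat)"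
proof (induction N)
  case (Suc N)
  show ?case
  proof (cases "x = 0")
    case False
    then have "x ^ N \<ge> 1" "x * x ^ N \<ge> x ^ N" by auto
    then show ?thesis using Suc by (simp add: distrib_left diff_mult_distrib)
  qed simp
qed simp

context drinfeld
begin

section \<open>Algebraic independence of the coefficients \<open>H i\<close>\<close>

abbreviation "I \<equiv> {1..<r}"

definition H :: "nat \<Rightarrow> 'a" where "H i = dc g P (i * d)"

text \<open>The weights \<open>w i\<close> make \<open>H i\<close> have a single monomial of dominant weight, a power of \<open>g i\<close>; this gives the
  algebraic independence of the \<open>H i\<close>.\<close>

definition Y :: nat where "Y = q ^ (r * d) + 1"
definition \<Lambda> :: nat where "\<Lambda> = Y ^ r"
definition w :: "nat \<Rightarrow> nat" where "w i = \<Lambda> * (q ^ i - 1) - Y ^ i"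
definition Gt :: "nat \<Rightarrow> 'a poly" where
  "Gt i = (if i = 0 then [:tb:] else if i < r then monom (g i) (w i) else if i = r then 1 else 0)"
text \<open>The exponent of g i in the N-th twisted power of g i \<tau> ^ i.\<close>

definition E :: "nat \<Rightarrow> nat \<Rightarrow> nat" where "E i N = (\<Sum>t<N. (q ^ i) ^ t)"
definition Ht :: "nat \<Rightarrow> 'a poly" where "Ht i = dco (\<lambda>c. [:e c:]) q Gt P (i * d)"

text \<open>The coefficient of \<tau> ^ j has degree at most \<Lambda> * (q ^ j - 1), a bound that
  is compatible with \<open>star\<close>; \<open>C\<close> is a margin by which it is missed. The
  factor g i misses it by Y ^ i, and margins add up with Frobenius multiplicities. A factor of index
  above i thus costs at least Y ^ Suc i, more than all the factors g i of the main monomial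
  together.\<close>

definition small :: "nat \<Rightarrow> nat \<Rightarrow> 'a poly \<Rightarrow> bool" where
  "small C j p \<longleftrightarrow> p = 0 \<or> degree p + C \<le> \<Lambda> * (q ^ j - 1)"

lemma small_0: "small C j 0" by (simp add: small_def)

lemma small_mono: "small C j p \<Longrightarrow> C' \<le> C \<Longrightarrow> small C' j p" by (auto simp: small_def)

lemma small_add: "small C j p \<Longrightarrow> small C j s \<Longrightarrow> small C j (p + s)"
  using degree_add_le_max[of p s] unfolding small_def by (cases "p = 0"; cases "s = 0") (auto simp: max_def split: if_splits)

lemma small_sum: "(\<And>i. i \<in> A \<Longrightarrow> small C j (f i)) \<Longrightarrow> small C j (\<Sum>i\<in>A. f i)"
  by (induction A rule: infinite_finite_induct) (auto intro: small_0 small_add)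

lemma small_const_mult: "small C j p \<Longrightarrow> small C j ([:c:] * p)"
  using degree_smult_le[of c p] by (auto simp: small_def)

lemma small_mult:
  assumes "small C i p" "small C' j s"
  shows "small (C + q ^ i * C') (i + j) (p * s ^ q ^ i)"
proof (cases "p = 0 \<or> s = 0")
  case True
  then show ?thesis using q0 by (auto simp: small_def power_0_left)
next
  case False
  then have a: "degree p + C \<le> \<Lambda> * (q ^ i - 1)" "degree s + C' \<le> \<Lambda> * (q ^ j - 1)"
    using assms by (auto simp: small_def)
  have "degree (p * s ^ q ^ i) + (C + q ^ i * C') = (degree p + C) + q ^ i * (degree s + C')"
    using False by (simp add: degree_mult_eq degree_power_eq algebra_simps)
  also have "\<dots> \<le> \<Lambda> * (q ^ i - 1) + q ^ i * (\<Lambda> * (q ^ j - 1))"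
    using a by (intro add_mono mult_left_mono) auto
  also have "\<dots> = \<Lambda> * ((q ^ i - 1) + q ^ i * (q ^ j - 1))" by (simp add: algebra_simps)
  also have "(q ^ i - 1) + q ^ i * (q ^ j - 1) = q ^ (i + j) - 1"
  proof -
    have "q ^ i \<ge> 1" "q ^ j \<ge> 1" using q0 by auto
    then have "q ^ i \<le> q ^ i * q ^ j" by simp
    then show ?thesis using \<open>q ^ i \<ge> 1\<close> by (simp add: diff_mult_distrib2 power_add)
  qed
  finally show ?thesis by (simp add: small_def)
qed

lemma Y_pos: "Y > 0" by (simp add: Y_def)

lemma qi: "i > 0 \<Longrightarrow> q ^ i - 1 \<ge> 1" using one_less_power[OF q1, of i] by simp

lemma w_eq: assumes "0 < i" "i < r" shows "w i + Y ^ i = \<Lambda> * (q ^ i - 1)"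
proof -
  have "Y ^ i \<le> \<Lambda>" unfolding \<Lambda>_def using assms Y_pos by (intro power_increasing) auto
  also have "\<dots> \<le> \<Lambda> * (q ^ i - 1)" using qi[OF assms(1)] by (metis mult.right_neutral mult_le_mono2)
  finally show ?thesis by (simp add: w_def)
qed

lemma small_Gt_0: "small 0 i (Gt i)"
proof -
  consider "i = 0" | "0 < i" "i < r" | "i = r" | "i > r" by linarith
  then show ?thesis
  proof cases
    case 2
    then show ?thesis using w_eq[OF 2] degree_monom_le[of "g i" "w i"] by (auto simp: Gt_def small_def)
  qed (use r in \<open>auto simp: Gt_def small_def\<close>)
qed

lemma small_Gt: assumes "i < s" "i < r" shows "small (Y ^ Suc i) s (Gt s)"
proof -
  have mono: "Y ^ Suc i \<le> Y ^ s" using assms Y_pos by (intro power_increasing) auto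
  consider "s < r" | "s = r" | "s > r" by linarith
  then show ?thesis
  proof cases
    case 1
    have "degree (monom (g s) (w s)) + Y ^ Suc i \<le> w s + Y ^ s"
      using mono degree_monom_le[of "g s" "w s"] by (rule add_mono[rotated])
    then show ?thesis using 1 assms w_eq[of s] by (simp add: Gt_def small_def)
  next
    case 2
    have "Y ^ Suc i \<le> \<Lambda> * 1" using mono 2 by (simp add: \<Lambda>_def)
    also have "\<dots> \<le> \<Lambda> * (q ^ s - 1)" using qi[of s] assms by (intro mult_le_mono2) auto
    finally show ?thesis using 2 r by (simp add: Gt_def small_def)
  next
    case 3
    then show ?thesis by (simp add: Gt_def small_def)
  qed
qed

lemma small_tpow_0: "small 0 j (tpow q Gt N j)"
proof (induction N arbitrary: j)
  case 0 then show ?case by (simp add: small_def)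
next
  case (Suc N)
  show ?case unfolding tpow.simps star_def
  proof (rule small_sum)
    fix s assume "s \<in> {..j}"
    then show "small 0 j (Gt s * tpow q Gt N (j - s) ^ q ^ s)"
      using small_mult[OF small_Gt_0[of s] Suc[of "j - s"]] by simp
  qed
qed

lemma small_term:
  assumes i: "i < r" and s: "s \<le> j" and c: "i < s \<or> small (Y ^ Suc i) (j - s) (tpow q Gt N (j - s))"
  shows "small (Y ^ Suc i) j (Gt s * tpow q Gt N (j - s) ^ q ^ s)"
proof (cases "i < s")
  case True
  then show ?thesis using small_mult[OF small_Gt[OF True i] small_tpow_0[of "j - s" N]] s by simp
next
  case False
  then have "small (0 + q ^ s * Y ^ Suc i) (s + (j - s)) (Gt s * tpow q Gt N (j - s) ^ q ^ s)"
    using c by (intro small_mult small_Gt_0) auto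
  moreover have "Y ^ Suc i \<le> 0 + q ^ s * Y ^ Suc i" using q0 by simp
  ultimately have "small (Y ^ Suc i) (s + (j - s)) (Gt s * tpow q Gt N (j - s) ^ q ^ s)" by (rule small_mono)
  then show ?thesis using s by simp
qed

text \<open>N indices whose sum is above i * N include one greater than i, and its factor
  \<open>Gt s\<close> already misses the bound by Y ^ Suc i.\<close>

lemma small_tpow: "i < r \<Longrightarrow> j > i * N \<Longrightarrow> small (Y ^ Suc i) j (tpow q Gt N j)"
proof (induction N arbitrary: j)
  case 0 then show ?case by (simp add: small_def)
next
  case (Suc N)
  show ?case unfolding tpow.simps star_def
  proof (rule small_sum)
    fix s assume s: "s \<in> {..j}"
    have "i * N < j - s" if "\<not> i < s" using Suc.prems that by simp
    then show "small (Y ^ Suc i) j (Gt s * tpow q Gt N (j - s) ^ q ^ s)"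
      using s Suc.prems(1) Suc.IH[of "j - s"] by (intro small_term) auto
  qed
qed

lemma E_Suc: "E i (Suc N) = 1 + q ^ i * E i N"
  unfolding E_def by (subst sum.lessThan_Suc_shift) (simp add: sum_distrib_left)

text \<open>N indices with sum i * N are either all equal to i, which gives the monomial in g i, or
  include one above i, which makes the product negligible.\<close>

lemma tpow_main:
  assumes i: "0 < i" "i < r"
  shows "small (Y ^ Suc i) (i * N) (tpow q Gt N (i * N) - monom (g i ^ E i N) (w i * E i N))"
proof (induction N)
  case 0 then show ?case by (simp add: small_def E_def monom_0 one_pCons)
next
  case (Suc N)
  let ?j = "i * Suc N" and ?M = "monom (g i ^ E i N) (w i * E i N)"
  have M: "Gt i * ?M ^ q ^ i = monom (g i ^ E i (Suc N)) (w i * E i (Suc N))"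
    using i by (simp add: Gt_def monom_power mult_monom E_Suc power_add algebra_simps flip: power_mult)
  have "tpow q Gt (Suc N) ?j = Gt i * tpow q Gt N (?j - i) ^ q ^ i + (\<Sum>s\<in>{..?j} - {i}. Gt s * tpow q Gt N (?j - s) ^ q ^ s)"
    unfolding tpow.simps star_def by (rule sum.remove) auto
  also have "?j - i = i * N" by simp
  finally have "tpow q Gt (Suc N) ?j - monom (g i ^ E i (Suc N)) (w i * E i (Suc N))
     = Gt i * (tpow q Gt N (i * N) - ?M) ^ q ^ i + (\<Sum>s\<in>{..?j} - {i}. Gt s * tpow q Gt N (?j - s) ^ q ^ s)"
    unfolding frob_diff[OF frp] right_diff_distrib M by simp
  moreover have "small (Y ^ Suc i) ?j \<dots>"
  proof (rule small_add)
    have "small (0 + q ^ i * Y ^ Suc i) (i + i * N) (Gt i * (tpow q Gt N (i * N) - ?M) ^ q ^ i)"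
      by (rule small_mult[OF small_Gt_0 Suc])
    moreover have "Y ^ Suc i \<le> 0 + q ^ i * Y ^ Suc i" using q0 by simp
    ultimately have "small (Y ^ Suc i) (i + i * N) (Gt i * (tpow q Gt N (i * N) - ?M) ^ q ^ i)" by (rule small_mono)
    then show "small (Y ^ Suc i) ?j (Gt i * (tpow q Gt N (i * N) - ?M) ^ q ^ i)" by simp
    show "small (Y ^ Suc i) ?j (\<Sum>s\<in>{..?j} - {i}. Gt s * tpow q Gt N (?j - s) ^ q ^ s)"
    proof (rule small_sum)
      fix s assume s: "s \<in> {..?j} - {i}"
      have "i * N < ?j - s" if "\<not> i < s" using s that i by auto
      then show "small (Y ^ Suc i) ?j (Gt s * tpow q Gt N (?j - s) ^ q ^ s)"
        using s i small_tpow[OF i(2), where j = "?j - s" and N = N] by (intro small_term) auto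
    qed
  qed
  ultimately show ?case by simp
qed

lemma Ht_main:
  assumes i: "0 < i" "i < r"
  shows "small (Y ^ Suc i) (i * d) (Ht i - monom (g i ^ E i d) (w i * E i d))"
proof -
  have "Ht i = [:e (coeff P d):] * tpow q Gt d (i * d) + (\<Sum>N\<in>{..d} - {d}. [:e (coeff P N):] * tpow q Gt N (i * d))"
    unfolding Ht_def dco_def d_def[symmetric] by (rule sum.remove) auto
  moreover have "e (coeff P d) = 1" using P_monic by (simp add: d_def field_embD[OF e])
  ultimately have "Ht i - monom (g i ^ E i d) (w i * E i d) = (tpow q Gt d (i * d) - monom (g i ^ E i d) (w i * E i d))
      + (\<Sum>N\<in>{..d} - {d}. [:e (coeff P N):] * tpow q Gt N (i * d))" by (simp add: one_pCons)
  moreover have "small (Y ^ Suc i) (i * d) \<dots>"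
    using i by (intro small_add tpow_main small_sum small_const_mult small_tpow) auto
  ultimately show ?thesis by (simp only:)
qed

lemma g_nz: "i \<in> I \<Longrightarrow> g i \<noteq> 0"
proof
  assume i: "i \<in> I" "g i = 0"
  let ?\<delta> = "\<lambda>j. if j = i then 1 else (0::nat)"
  have "mpow I g ?\<delta> = 0" unfolding mpow_def using i by (intro prod_zero) auto
  then have "(\<Sum>e\<in>{?\<delta>}. 1 * mpow I g e) = 0" by simp
  then have "(1::'a) = 0"
    using i is_subringD(2)[OF k_subring] by (intro alg_indepD[OF g_indep, of "{?\<delta>}" "\<lambda>_. 1" ?\<delta>]) (auto simp: exps_def k_def)
  then show False by simp
qed

text \<open>Since \<open>E i d\<close> is smaller than \<open>Y\<close>, the main monomial misses
  the bound by Y ^ i * E i d < Y ^ Suc i, which is less than for the rest.\<close>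

lemma Ht_lead:
  assumes i: "0 < i" "i < r"
  shows "degree (Ht i) = w i * E i d \<and> lead_coeff (Ht i) = g i ^ E i d"
proof -
  let ?M = "monom (g i ^ E i d) (w i * E i d)" and ?s = "Ht i - monom (g i ^ E i d) (w i * E i d)"
  have gi: "g i \<noteq> 0" using g_nz i by auto
  then have dM: "degree ?M = w i * E i d" by (simp add: degree_monom_eq)
  have geo: "(q ^ i - 1) * E i d = q ^ (i * d) - 1" unfolding E_def geometric_nat by (simp add: power_mult)
  then have "E i d \<le> q ^ (i * d)" using qi[OF i(1)] by (metis diff_le_self le_trans mult.commute mult_le_mono2 mult.right_neutral)
  also have "\<dots> < Y" unfolding Y_def using i q0 by (simp add: less_Suc_eq_le power_increasing)
  finally have EY: "E i d < Y" .
  show ?thesis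
  proof (cases "?s = 0")
    case True
    then have "Ht i = ?M" by simp
    then show ?thesis using dM by simp
  next
    case False
    then have "degree ?s + Y ^ Suc i \<le> \<Lambda> * ((q ^ i - 1) * E i d)" 
      using Ht_main[OF i] unfolding small_def geo by blast
    also have "\<dots> = (w i + Y ^ i) * E i d" by (simp add: w_eq[OF i] mult.assoc)
    also have "\<dots> = w i * E i d + Y ^ i * E i d" by (rule distrib_right)
    also have "\<dots> < w i * E i d + Y ^ Suc i" using EY Y_pos by (simp add: mult.commute)
    finally have ds: "degree ?s < degree ?M" by (simp add: dM)
    have "Ht i = ?M + ?s" by simp
    then show ?thesis using ds dM by (metis degree_add_eq_left lead_coeff_add_le lead_coeff_monom add.commute)
  qed
qed

lemma Ht_eval: "poly (Ht i) 1 = H i"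
proof -
  have "(\<lambda>i. poly (Gt i) 1) = coefs g" by (auto simp: fun_eq_iff Gt_def coefs_def poly_monom)
  then show ?thesis by (simp add: Ht_def H_def dco_poly)
qed

lemma mpow_lead:
  assumes "finite J" "\<And>i. i \<in> J \<Longrightarrow> F i \<noteq> (0 :: 'a poly)"
  shows "degree (mpow J F b) = (\<Sum>i\<in>J. b i * degree (F i)) \<and> lead_coeff (mpow J F b) = mpow J (\<lambda>i. lead_coeff (F i)) b"
proof -
  have "degree (mpow J F b) = (\<Sum>i\<in>J. degree (F i ^ b i))"
    unfolding mpow_def using assms by (subst degree_prod_eq_sum_degree) auto
  also have "\<dots> = (\<Sum>i\<in>J. b i * degree (F i))" using assms by (intro sum.cong) (auto simp: degree_power_eq)
  finally have "degree (mpow J F b) = (\<Sum>i\<in>J. b i * degree (F i))" .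
  moreover have "lead_coeff (mpow J F b) = mpow J (\<lambda>i. lead_coeff (F i)) b"
    unfolding mpow_def by (simp only: lead_coeff_prod lead_coeff_power)
  ultimately show ?thesis by blast
qed

lemma Ht_hull: "Ht i \<in> ring_hull ((\<lambda>c. [:c:]) ` k \<union> Gt ` I)"
proof -
  have "Gt j \<in> ring_hull ((\<lambda>c. [:c:]) ` k \<union> Gt ` I)" for j
  proof -
    consider "j = 0" | "j \<in> I" | "j = r" | "j > r" by fastforce
    then show ?thesis
    proof cases
      case 1 then show ?thesis using tb_k by (auto simp: Gt_def intro: ring_hull.base)
    next
      case 2 then show ?thesis by (auto intro: ring_hull.base)
    next
      case 3 then show ?thesis using r by (auto simp: Gt_def intro: ring_hull.one)
    next
      case 4 then show ?thesis by (auto simp: Gt_def intro: ring_hull.zero)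
    qed
  qed
  then show ?thesis unfolding Ht_def
    by (intro dco_subring subring_ring_hull) (auto intro: ring_hull.base e_k)
qed

text \<open>A relation between the \<open>H i\<close> lifts to one between the \<open>Ht i\<close>,
  and its part of top degree is a relation between leading coefficients. These are monomials in g
  whose exponents are multiplied by the nonzero numbers \<open>E i d\<close>; they remain distinct,
  so the independence of g applies.\<close>

lemma H_indep:
  assumes S: "finite S" "S \<subseteq> exps I" "\<And>b. b \<in> S \<Longrightarrow> c b \<in> k" and sum: "(\<Sum>b\<in>S. c b * mpow I H b) = 0" and b: "b \<in> S"
  shows "c b = 0"
proof (rule ccontr)
  assume cb: "c b \<noteq> 0"
  define F where "F = (\<Sum>b\<in>S. [:c b:] * mpow I Ht b)"
  let ?R = "ring_hull ((\<lambda>c. [:c:]) ` k \<union> Gt ` I)"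
  have R: "is_subring ?R" by (rule subring_ring_hull)
  have "F \<in> ?R" unfolding F_def mpow_def using S(3) Ht_hull
    by (intro subring_sum[OF R] is_subringD(4)[OF R] subring_prod[OF R] is_subringD(7)[OF R]) (auto intro: ring_hull.base)
  moreover have "poly F 1 = 0" using sum by (simp add: F_def poly_sum poly_mon Ht_eval)
  moreover have "poly (Gt i) 1 = g i" if "i \<in> I" for i using that by (auto simp: Gt_def poly_monom)
  ultimately have F0: "F = 0"
    by (intro lift_inj[OF k_subfield _ g_indep[folded k_def], of Gt F]) auto
  define D where "D b = (\<Sum>i\<in>I. b i * (w i * E i d))" for b :: "nat \<Rightarrow> nat"
  have Ht0: "Ht i \<noteq> 0" if "i \<in> I" for i using Ht_lead[of i] g_nz[OF that] that by auto
  have deg: "degree (mpow I Ht b) = D b" "lead_coeff (mpow I Ht b) = mpow I g (\<lambda>i. E i d * b i)" for b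
  proof -
    have "(\<Sum>i\<in>I. b i * degree (Ht i)) = D b" unfolding D_def using Ht_lead by (intro sum.cong) auto
    moreover have "mpow I (\<lambda>i. lead_coeff (Ht i)) b = mpow I g (\<lambda>i. E i d * b i)"
      unfolding mpow_def
    proof (intro prod.cong refl)
      fix i assume "i \<in> I"
      then have "0 < i" "i < r" by auto
      from Ht_lead[OF this] have "lead_coeff (Ht i) = g i ^ E i d" by blast
      then show "lead_coeff (Ht i) ^ b i = g i ^ (E i d * b i)" by (simp only: power_mult)
    qed
    ultimately show "degree (mpow I Ht b) = D b" "lead_coeff (mpow I Ht b) = mpow I g (\<lambda>i. E i d * b i)"
      using mpow_lead[of I Ht b] Ht0 by (auto simp only: finite_atLeastLessThan)
  qed
  let ?S' = "{b \<in> S. c b \<noteq> 0}"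
  \<comment> \<open>The top degree among the terms that occur; comparing coefficients of
    \<open>F\<close> = 0 there retains leading coefficients only.\<close>
  define m where "m = Max (D ` ?S')"
  have "m \<in> D ` ?S'" unfolding m_def using S cb b by (intro Max_in) auto
  then obtain b0 where b0: "b0 \<in> S" "c b0 \<noteq> 0" "D b0 = m" by auto
  have max: "D b \<le> m" if "b \<in> S" "c b \<noteq> 0" for b unfolding m_def using S that by (intro Max_ge) auto
  let ?T = "{b \<in> S. c b \<noteq> 0 \<and> D b = m}"
  let ?\<phi> = "\<lambda>b i. E i d * b i"
  have Epos: "E i d > 0" for i unfolding E_def using d_pos q0 by (intro sum_pos2[of _ 0]) auto
  have E0: "E i d \<noteq> 0" for i using Epos[of i] by simp
  have inj: "inj_on ?\<phi> ?T" by (auto simp: inj_on_def fun_eq_iff E0)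
  have "0 = coeff F m" by (simp add: F0)
  also have "\<dots> = (\<Sum>b\<in>S. c b * coeff (mpow I Ht b) m)" by (simp add: F_def coeff_sum)
  also have "\<dots> = (\<Sum>b\<in>?T. c b * coeff (mpow I Ht b) m)"
  proof (rule sum.mono_neutral_right)
    show "\<forall>b\<in>S - ?T. c b * coeff (mpow I Ht b) m = 0"
    proof
      fix b assume b: "b \<in> S - ?T"
      show "c b * coeff (mpow I Ht b) m = 0"
      proof (cases "c b = 0")
        case False
        then have "degree (mpow I Ht b) < m" unfolding deg(1) using b max[of b] by auto
        then show ?thesis by (simp add: coeff_eq_0)
      qed simp
    qed
  qed (use S in auto)
  also have "\<dots> = (\<Sum>b\<in>?T. c b * mpow I g (?\<phi> b))"
    using deg by (intro sum.cong refl) auto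
  also have "\<dots> = (\<Sum>f\<in>?\<phi> ` ?T. c (the_inv_into ?T ?\<phi> f) * mpow I g f)"
    by (subst sum.reindex[OF inj]) (auto simp: the_inv_into_f_f[OF inj] intro!: sum.cong)
  finally have z: "(\<Sum>f\<in>?\<phi> ` ?T. c (the_inv_into ?T ?\<phi> f) * mpow I g f) = 0" by simp
  have b0T: "b0 \<in> ?T" using b0 by simp
  have "c (the_inv_into ?T ?\<phi> (?\<phi> b0)) = 0"
  proof (rule alg_indepD[OF g_indep[folded k_def] _ _ _ z])
    show "finite (?\<phi> ` ?T)" using S by auto
    show "?\<phi> ` ?T \<subseteq> exps I" using S by (auto simp: exps_def)
    show "c (the_inv_into ?T ?\<phi> f) \<in> k" if f: "f \<in> ?\<phi> ` ?T" for f
    proof -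
      obtain b where "b \<in> ?T" "f = ?\<phi> b" using f by blast
      then show ?thesis using the_inv_into_f_f[OF inj, of b] S(3) by auto
    qed
    show "?\<phi> b0 \<in> ?\<phi> ` ?T" using b0T by (rule imageI)
  qed
  then show False using the_inv_into_f_f[OF inj b0T] b0 by simp
qed

section \<open>A place where all \<open>H i\<close> vanish\<close>

lemma H1_nz: "H 1 \<noteq> 0"
proof
  assume H1: "H 1 = 0"
  let ?\<delta> = "\<lambda>j. if j = 1 then 1 else (0::nat)"
  have "mpow I H ?\<delta> = 0" unfolding mpow_def using r H1 by (intro prod_zero) (auto intro!: bexI[of _ 1])
  then have "(\<Sum>e\<in>{?\<delta>}. 1 * mpow I H e) = 0" by simp
  then have "(1::'a) = 0"
    using r is_subringD(2)[OF k_subring] by (intro H_indep[of "{?\<delta>}" "\<lambda>_. 1" ?\<delta>]) (auto simp: exps_def)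
  then show False by simp
qed

text \<open>The generic module is ordinary: the lowest coefficient of \<psi>_P sits at index d and
  is \<open>H 1\<close>. \<open>lowest_coeff\<close> turns this into a period of
  \<open>tb\<close>.\<close>

lemma tb_qd: "tb ^ q ^ d = tb"
  using lowest_coeff[of d g P] dc_P_low H1_nz by (simp add: H_def)

text \<open>Independence of the \<open>H i\<close> makes the pairs (c, c) and (H i, 0) generate the
  graph of a homomorphism on k[H], which extends to a place. Pairs are functions on
  \<open>bool\<close>, with the source at \<open>True\<close>.\<close>

lemma place_H:
  obtains M :: "('a \<times> 'a) set" where "partial_hom M" "\<And>c. c \<in> k \<Longrightarrow> (c, c) \<in> M" "\<And>i. i \<in> I \<Longrightarrow> (H i, 0) \<in> M"
    "\<And>y. y \<in> Domain M \<or> (y \<noteq> 0 \<and> inverse y \<in> Domain M)"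
    "\<And>b b'. (b, b') \<in> M \<Longrightarrow> b' \<noteq> 0 \<Longrightarrow> (inverse b, inverse b') \<in> M"
proof -
  let ?K = "(\<lambda>c (_::bool). c) ` k"
  let ?x = "\<lambda>i b. if b then H i else (0::'a)"
  let ?R = "ring_hull (?K \<union> ?x ` I)"
  have K: "is_subring ?K"
    by (rule subring_image[OF k_subring]) (auto simp: fun_eq_iff)
  define \<Gamma> where "\<Gamma> = {(f True, f False) | f. f \<in> ?R}"
  have \<Gamma>I: "(f True, f False) \<in> \<Gamma>" if "f \<in> ?R" for f using that unfolding \<Gamma>_def by blast
  have "partial_hom \<Gamma>" unfolding partial_hom_def
  proof (intro conjI allI impI)
    show "(1, 1) \<in> \<Gamma>" using \<Gamma>I[OF ring_hull.one] by simp
  next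
    fix x x' y y' assume "(x, x') \<in> \<Gamma>" "(y, y') \<in> \<Gamma>"
    then obtain f h where fh: "f \<in> ?R" "h \<in> ?R" "x = f True" "x' = f False" "y = h True" "y' = h False"
      unfolding \<Gamma>_def by auto
    show "(x + y, x' + y') \<in> \<Gamma>" "(x * y, x' * y') \<in> \<Gamma>"
      using \<Gamma>I[OF ring_hull.add[OF fh(1,2)]] \<Gamma>I[OF ring_hull.mult[OF fh(1,2)]] by (simp_all add: fh)
  next
    fix x x' assume "(x, x') \<in> \<Gamma>"
    then obtain f where fh: "f \<in> ?R" "x = f True" "x' = f False" unfolding \<Gamma>_def by auto
    show "(- x, - x') \<in> \<Gamma>" using \<Gamma>I[OF ring_hull.uminus[OF fh(1)]] by (simp add: fh)
  next
    fix x' assume "(0, x') \<in> \<Gamma>"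
    then obtain f where f: "f \<in> ?R" "f True = 0" "x' = f False" unfolding \<Gamma>_def by auto
    obtain S c where S: "finite S" "S \<subseteq> exps I" "\<forall>b. c b \<in> ?K" "f = (\<Sum>b\<in>S. c b * mpow I ?x b)"
      using ring_hull_mon_expansion[OF K _ f(1)] by auto
    have sum_app: "(\<Sum>b\<in>S. u b) z = (\<Sum>b\<in>S. u b z)" for u :: "(nat \<Rightarrow> nat) \<Rightarrow> bool \<Rightarrow> 'a" and z
      by (induction S rule: infinite_finite_induct) auto
    have pow_app: "(u ^ N) z = u z ^ N" for u :: "bool \<Rightarrow> 'a" and z N by (induction N) auto
    have mpow_app: "mpow I u b z = mpow I (\<lambda>i. u i z) b" for u :: "nat \<Rightarrow> bool \<Rightarrow> 'a" and b z
    proof -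
      have "(\<Prod>i\<in>A. u i ^ b i) z = (\<Prod>i\<in>A. u i z ^ b i)" for A
        by (induction A rule: infinite_finite_induct) (auto simp: pow_app)
      then show ?thesis by (simp add: mpow_def)
    qed
    have "c b True = 0" if "b \<in> S" for b
    proof (rule H_indep[OF S(1,2) _ _ that])
      show "c b True \<in> k" for b using S(3)[rule_format, of b] by auto
      have "f True = (\<Sum>b\<in>S. c b True * mpow I H b)"
        by (simp only: S(4) sum_app times_fun_apply mpow_app if_True)
      then show "(\<Sum>b\<in>S. c b True * mpow I H b) = 0" using f(2) by (simp only:)
    qed
    moreover have "c b False = c b True" for b using S(3)[rule_format, of b] by auto
    ultimately show "x' = 0" by (simp add: f(3) S(4) sum_app)
  qed
  then obtain M where M: "\<Gamma> \<subseteq> M" "partial_hom M" "\<And>y. y \<in> Domain M \<or> (y \<noteq> 0 \<and> inverse y \<in> Domain M)"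
    "\<And>b b'. (b, b') \<in> M \<Longrightarrow> b' \<noteq> 0 \<Longrightarrow> (inverse b, inverse b') \<in> M"
    using place_extension by blast
  have "(c, c) \<in> M" if "c \<in> k" for c
    using \<Gamma>I[OF ring_hull.base, of "\<lambda>_. c"] M(1) that by auto
  moreover have "(H i, 0) \<in> M" if "i \<in> I" for i
    using \<Gamma>I[OF ring_hull.base, of "?x i"] M(1) that by auto
  ultimately show ?thesis using that[OF M(2)] M(3,4) by blast
qed

text \<open>At a place where all \<open>H i\<close> vanish the parameters stay finite: otherwise rescaling would produce
  a reduction of smaller positive rank \<open>s < r\<close>, whose coefficient \<open>H s\<close> is a nonzero leading coefficient.\<close>

lemma place_finite:
  assumes M: "partial_hom M" and Mk: "\<And>c. c \<in> k \<Longrightarrow> (c, c) \<in> M" and MH: "\<And>i. i \<in> I \<Longrightarrow> (H i, 0) \<in> M"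
    and Mval: "\<And>y. y \<in> Domain M \<or> (y \<noteq> 0 \<and> inverse y \<in> Domain M)"
    and Minv: "\<And>b b'. (b, b') \<in> M \<Longrightarrow> b' \<noteq> 0 \<Longrightarrow> (inverse b, inverse b') \<in> M"
    and i: "i \<in> I"
  shows "g i \<in> Domain M"
proof -
  have Dmult: "x * y \<in> Domain M" if "x \<in> Domain M" "y \<in> Domain M" for x y
    using that partial_homD(4)[OF M] by blast
  have Dpow: "x ^ N \<in> Domain M" if "x \<in> Domain M" for x N using that partial_homD(7)[OF M] by blast
  \<comment> \<open>Roots of degree q ^ i - 1 put the coefficients on a common scale: rescaling the
    module by u multiplies each of these roots by u.\<close>
  have "\<exists>y. y ^ (q ^ i - 1) = coefs g i" if "i > 0" for i
    using nth_root_exists[of "q ^ i - 1" "coefs g i"] qi[OF that] by auto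
  then obtain c0 where c0: "\<And>i. i > 0 \<Longrightarrow> c0 i ^ (q ^ i - 1) = coefs g i" by metis
  define c where "c i = (if i = r then 1 else c0 i)" for i
  have c: "c i ^ (q ^ i - 1) = coefs g i" if "i > 0" for i using c0[OF that] r by (auto simp: c_def coefs_def)
  have "\<exists>y\<in>{1..r}. \<forall>x\<in>{1..r}. \<exists>t\<in>Domain M. c x = t * c y"
  proof (rule finite_preorder_max)
    show "finite {1..r}" "{1..r} \<noteq> {}" using r by auto
    fix x y
    show "(\<exists>t\<in>Domain M. c x = t * c y) \<or> (\<exists>t\<in>Domain M. c y = t * c x)"
    proof (cases "c x = 0 \<or> c y = 0")
      case True
      then show ?thesis using partial_homD(2)[OF M] by (metis DomainI mult_zero_left)
    next
      case False
      consider "c x / c y \<in> Domain M" | "inverse (c x / c y) \<in> Domain M" using Mval by blast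
      then show ?thesis
      proof cases
        case 1
        then show ?thesis using False by (intro disjI1 bexI[of _ "c x / c y"]) auto
      next
        case 2
        then show ?thesis using False by (intro disjI2 bexI[of _ "inverse (c x / c y)"]) auto
      qed
    qed
  next
    fix x y z assume "\<exists>t\<in>Domain M. c x = t * c y" "\<exists>t\<in>Domain M. c y = t * c z"
    then obtain t t' where "t \<in> Domain M" "t' \<in> Domain M" "c x = t * c y" "c y = t' * c z" by blast
    then show "\<exists>t\<in>Domain M. c x = t * c z" by (intro bexI[of _ "t * t'"]) (auto simp: mult.assoc intro: Dmult)
  qed
  then obtain i0 where i0: "i0 \<in> {1..r}" "\<And>x. x \<in> {1..r} \<Longrightarrow> \<exists>t\<in>Domain M. c x = t * c i0" by blast
  \<comment> \<open>\<open>c i0\<close> is the largest root for divisibility in the valuation ring;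
    after division by it all roots are integral and one of them is 1. As \<open>c r\<close> is 1, u
    itself is integral.\<close>
  define u where "u = inverse (c i0)"
  have "\<exists>t\<in>Domain M. 1 = t * c i0" using i0(2)[of r] r by (auto simp: c_def)
  then obtain t where t: "t \<in> Domain M" "1 = t * c i0" by blast
  then have ci0: "c i0 \<noteq> 0" by auto
  have "u = t" unfolding u_def using t(2) by (metis inverse_unique mult.commute)
  then obtain u' where u': "(u, u') \<in> M" using t by blast
  have cu: "c x * u \<in> Domain M" if x: "x \<in> {1..r}" for x
  proof -
    obtain t where "t \<in> Domain M" "c x = t * c i0" using i0(2)[OF x] by blast
    then show ?thesis using ci0 by (simp add: u_def mult.assoc)
  qed
  show ?thesis
  proof (cases "u' = 0")
    case False
    then have "(inverse u, inverse u') \<in> M" using Minv[OF u'] by simp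
    then have "c i * u * inverse u \<in> Domain M" using cu[of i] i by (intro Dmult[of "c i * u"]) auto
    moreover have "u \<noteq> 0" using ci0 by (simp add: u_def)
    ultimately have "c i \<in> Domain M" by (simp add: mult.assoc)
    then have "c i ^ (q ^ i - 1) \<in> Domain M" by (rule Dpow)
    then show ?thesis using c[of i] i by (simp add: coefs_def)
  next
    case True
    define Gu where "Gu i = coefs g i * u ^ (q ^ i - 1)" for i
    have "\<exists>y. (Gu i, y) \<in> M" for i
    proof -
      consider "i = 0" | "i \<in> {1..r}" | "i > r" by fastforce
      then show ?thesis
      proof cases
        case 1
        then show ?thesis using Mk[OF tb_k] by (auto simp: Gu_def coefs_def)
      next
        case 2
        then have "Gu i = (c i * u) ^ (q ^ i - 1)" using c[of i] by (simp add: Gu_def power_mult_distrib)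
        then show ?thesis using Dpow[OF cu[OF 2], of "q ^ i - 1"] by auto
      next
        case 3
        then show ?thesis using partial_homD(2)[OF M] by (auto simp: Gu_def coefs_0)
      qed
    qed
    then obtain G' where G': "\<And>i. (Gu i, G' i) \<in> M" by metis
    have G'_0: "G' i = 0" if "i > r" for i using G'[of i] that partial_homD(9)[OF M] by (simp add: Gu_def coefs_0)
    \<comment> \<open>The leading coefficient becomes u ^ (q ^ r - 1), and u reduces to 0 in this
      case, so the rank drops below r.\<close>
    have "G' r = 0"
    proof -
      have "(Gu r, 0 ^ (q ^ r - 1)) \<in> M" using partial_homD(7)[OF M u', of "q ^ r - 1"] r True by (simp add: Gu_def coefs_def)
      then have "G' r = 0 ^ (q ^ r - 1)" using G' partial_homD(8)[OF M] by blast
      then show ?thesis using qi[of r] r by (simp add: power_0_left)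
    qed
    have "Gu i0 = (c i0 * u) ^ (q ^ i0 - 1)" using c[of i0] i0 by (simp add: Gu_def power_mult_distrib)
    then have "Gu i0 = 1" using ci0 by (simp add: u_def)
    then have "G' i0 = 1" using G'[of i0] partial_homD(1,8)[OF M] by metis
    define s where "s = Max {i. i \<le> r \<and> G' i \<noteq> 0}"
    have fin: "finite {i. i \<le> r \<and> G' i \<noteq> 0}" by simp
    have i0in: "i0 \<in> {i. i \<le> r \<and> G' i \<noteq> 0}" using i0 \<open>G' i0 = 1\<close> by auto
    have "s \<in> {i. i \<le> r \<and> G' i \<noteq> 0}" unfolding s_def using fin i0in by (intro Max_in) auto
    then have s: "s \<le> r" "G' s \<noteq> 0" by auto
    have "i0 \<le> s" unfolding s_def using fin i0in by (rule Max_ge)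
    have above: "G' i = 0" if "i > s" for i
    proof (rule ccontr)
      assume "G' i \<noteq> 0"
      then have "i \<le> s" unfolding s_def using fin G'_0[of i] by (intro Max_ge) (auto simp: not_less[symmetric])
      then show False using that by simp
    qed
    have sI: "s \<in> I" using s \<open>i0 \<le> s\<close> i0 \<open>G' r = 0\<close> by (cases "s = r") auto
    have "dco e q G' P (s * degree P) \<noteq> 0"
      using sI P_monic s(2) above by (intro dco_lead[OF q0]) (auto simp: field_embD[OF e])
    moreover have "(dco e q Gu P (s * d), dco e q G' P (s * d)) \<in> M"
      using G' Mk e_k by (intro dco_partial_hom[OF M]) auto
    moreover have "dco e q Gu P (s * d) = H s * u ^ (q ^ (s * d) - 1)"
      unfolding Gu_def H_def by (rule dco_scale[OF q0])
    moreover have "(H s * u ^ (q ^ (s * d) - 1), 0 * u' ^ (q ^ (s * d) - 1)) \<in> M"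
      using MH[OF sI] u' by (intro partial_homD(4,7)[OF M])
    ultimately have False using partial_homD(8)[OF M] by (metis d_def mult_zero_left)
    then show ?thesis ..
  qed
qed

lemma tb_dvd: assumes "tb ^ q ^ j = tb" shows "d dvd j"
proof -
  have pw: "tb ^ q ^ (d * l) = tb" for l
  proof (induction l)
    case (Suc l)
    have "tb ^ q ^ (d * Suc l) = (tb ^ q ^ d) ^ q ^ (d * l)" by (simp add: power_add power_mult)
    then show ?case by (simp add: tb_qd Suc)
  qed simp
  have "q ^ j = q ^ (d * (j div d)) * q ^ (j mod d)" by (simp flip: power_add)
  then have "tb ^ q ^ j = (tb ^ q ^ (d * (j div d))) ^ q ^ (j mod d)" by (simp add: power_mult)
  then have "tb ^ q ^ (j mod d) = tb" using assms pw by simp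
  then have "j mod d = 0" using tb_period[of "j mod d"] d_pos by (metis mod_less_divisor neq0_conv not_less)
  then show ?thesis by auto
qed

text \<open>At \<open>g0\<close> the lowest nonzero coefficient of \<psi>_P has an index divisible
  by d (\<open>tb_dvd\<close>), and the multiples of d below r * d are the reductions of the
  \<open>H i\<close>, which are 0. As \<open>P\<close> is monic, \<psi>_P is the pure power \<tau> ^
  (r * d).\<close>

lemma supersingular_exists:
  obtains g0 where "\<And>i. i \<in> I \<Longrightarrow> g0 i \<in> k" "\<And>x. act g0 (P ^ n) x = x ^ q ^ (r * d * n)"
    "\<And>i. i \<in> I \<Longrightarrow> g0 i ^ q ^ (r * d * n) = g0 i"
proof -
  obtain M where M: "partial_hom M" "\<And>c. c \<in> k \<Longrightarrow> (c, c) \<in> M" "\<And>i. i \<in> I \<Longrightarrow> (H i, 0) \<in> M"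
    "\<And>y. y \<in> Domain M \<or> (y \<noteq> 0 \<and> inverse y \<in> Domain M)"
    "\<And>b b'. (b, b') \<in> M \<Longrightarrow> b' \<noteq> 0 \<Longrightarrow> (inverse b, inverse b') \<in> M"
    using place_H by blast
  have "\<forall>i\<in>I. \<exists>y. (g i, y) \<in> M" using place_finite[OF M] by blast
  then obtain g0 where g0: "\<And>i. i \<in> I \<Longrightarrow> (g i, g0 i) \<in> M" by metis
  have cf: "(coefs g i, coefs g0 i) \<in> M" for i
    using g0[of i] M(2)[OF tb_k] partial_homD(1,2)[OF M(1)] by (auto simp: coefs_def)
  have H0: "dc g0 P (i * d) = 0" if "i \<in> I" for i
  proof -
    have "(dc g P (i * d), dc g0 P (i * d)) \<in> M"
      using cf M(2) e_k by (intro dco_partial_hom[OF M(1)]) auto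
    then show ?thesis using M(3)[OF that] partial_homD(8)[OF M(1)] unfolding H_def by blast
  qed
  have low: "dc g0 P j = 0" if "j < r * d" for j
  proof (rule ccontr)
    assume j: "dc g0 P j \<noteq> 0"
    define j0 where "j0 = (LEAST j. dc g0 P j \<noteq> 0)"
    have j0: "dc g0 P j0 \<noteq> 0" unfolding j0_def by (rule LeastI[of "\<lambda>j. dc g0 P j \<noteq> 0"]) (rule j)
    have l: "dc g0 P i = 0" if "i < j0" for i using not_less_Least[of i] that unfolding j0_def by blast
    have "j0 \<le> j" unfolding j0_def by (rule Least_le) (rule j)
    have "d dvd j0" using tb_dvd lowest_coeff[OF l j0] by blast
    then obtain i where i: "j0 = i * d" by (metis dvd_def mult.commute)
    have "j0 > 0" using j0 dc_P_low[of 0 g0] d_pos by (metis neq0_conv)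
    then have "i > 0" using i by auto
    moreover have "i < r" using i \<open>j0 \<le> j\<close> that d_pos by (metis le_less_trans mult_less_cancel2)
    ultimately show False using H0[of i] j0 i by auto
  qed
  have top: "dc g0 P (r * d) = 1"
  proof -
    have "dc g0 P (r * d) = (\<Sum>i\<in>{d}. e (coeff P i) * tpow q (coefs g0) i (r * d))"
      unfolding dco_def d_def[symmetric] by (rule sum.mono_neutral_right) (use r in \<open>auto intro!: tpow_coefs_0\<close>)
    moreover have "tpow q (coefs g0) d (r * d) = 1"
      using r by (intro tpow_lead_1[OF q0 coefs_0]) (auto simp: coefs_def)
    ultimately show ?thesis using P_monic by (simp add: d_def field_embD[OF e])
  qed
  have actP: "act g0 P x = x ^ q ^ (r * d)" for x
  proof -
    have "act g0 P x = (\<Sum>j\<in>{r * d}. dc g0 P j * x ^ q ^ j)"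
      unfolding act_ev ev_def d_def[symmetric] by (rule sum.mono_neutral_right) (auto simp: low)
    then show ?thesis by (simp add: top)
  qed
  have act: "act g0 (P ^ N) x = x ^ q ^ (r * d * N)" for N x
  proof (induction N arbitrary: x)
    case 0 then show ?case by (simp add: act_def Fq_module.act_1[OF module])
  next
    case (Suc N)
    have "act g0 (P ^ Suc N) x = act g0 P (act g0 (P ^ N) x)"
      unfolding act_def by (simp add: Fq_module.act_mult[OF module])
    also have "\<dots> = (x ^ q ^ (r * d * N)) ^ q ^ (r * d)" by (simp add: Suc actP)
    also have "\<dots> = x ^ q ^ (r * d * Suc N)" by (simp add: power_mult[symmetric] power_add[symmetric] algebra_simps)
    finally show ?case .
  qed
  let ?Q = "q ^ (r * d * n)"
  \<comment> \<open>At \<open>g0\<close>, \<psi>_t commutes with the \<open>?Q\<close>-th power map.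
    This map is onto, so coefficients can be compared, and each is fixed by it; hence the values of
    the place lie in \<open>k\<close>.\<close>
  have fixC: "coefs g0 i = coefs g0 i ^ ?Q" if "i \<le> r" for i
  proof (rule ev_unique[OF q1 _ that])
    fix y :: 'a
    obtain x where x: "x ^ ?Q = y" using nth_root_exists[of ?Q y] q0 by auto
    have "ev q (coefs g0) r y = \<Psi> g0 (act g0 (P ^ n) x)" by (simp add: act x \<Psi>_def)
    also have "\<dots> = act g0 (P ^ n) (\<Psi> g0 x)" unfolding act_def by (rule Fq_module.act_commute[OF module, symmetric])
    also have "\<dots> = (\<Sum>j\<le>r. coefs g0 j * x ^ q ^ j) ^ ?Q" by (simp add: act \<Psi>_def ev_def)
    also have "\<dots> = (\<Sum>j\<le>r. coefs g0 j ^ ?Q * (x ^ q ^ j) ^ ?Q)" by (simp add: frob_sum[OF fr] power_mult_distrib)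
    also have "\<dots> = (\<Sum>j\<le>r. coefs g0 j ^ ?Q * y ^ q ^ j)"
      unfolding x[symmetric] by (simp add: power_mult[symmetric] mult.commute)
    finally show "ev q (coefs g0) r y = ev q (\<lambda>i. coefs g0 i ^ ?Q) r y" by (simp add: ev_def)
  qed
  have fixI: "g0 i ^ ?Q = g0 i" if "i \<in> I" for i using fixC[of i] that by (auto simp: coefs_def)
  have "g0 i \<in> k" if "i \<in> I" for i
    using fixI[OF that] r d_pos n by (auto simp: k_iff intro!: exI[of _ "r * d * n"])
  then show ?thesis using that[OF _ act fixI] by blast
qed

end

section \<open>The etale torsion module\<close>

lemma separable_monic_factorization:
  fixes p :: "'a::alg_closed_field poly"
  assumes lc: "lead_coeff p = 1" and sep: "\<And>x. poly (pderiv p) x \<noteq> 0"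
  shows "p = (\<Prod>x\<in>{x. poly p x = 0}. [:- x, 1:])" "card {x. poly p x = 0} = degree p"
proof -
  have p0: "p \<noteq> 0" using lc by auto
  obtain A where A: "size A = degree p" "p = smult (lead_coeff p) (\<Prod>x\<in>#A. [:- x, 1:])"
    using alg_closed_imp_factorization[OF p0] by blast
  have pA: "p = (\<Prod>x\<in>#A. [:- x, 1:])" using A(2) lc by simp
  have cnt: "count A x \<le> 1" for x
  proof (rule ccontr)
    assume "\<not> count A x \<le> 1"
    then have "{#x, x#} \<subseteq># A" by (intro mset_subset_eqI) auto
    then obtain C where "A = {#x, x#} + C" by (metis subset_mset.le_iff_add)
    then have "p = [:- x, 1:] * ([:- x, 1:] * (\<Prod>y\<in>#C. [:- y, 1:]))" by (simp add: pA mult.assoc)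
    then have "pderiv p = pderiv ([:- x, 1:] * ([:- x, 1:] * (\<Prod>y\<in>#C. [:- y, 1:])))" by (rule arg_cong)
    then have "poly (pderiv p) x = 0" by (simp only: pderiv_mult) simp
    then show False using sep by blast
  qed
  have Aset: "A = mset_set (set_mset A)"
  proof (rule multiset_eqI)
    fix x
    show "count A x = count (mset_set (set_mset A)) x"
    proof (cases "x \<in># A")
      case True
      then have "count A x > 0" by simp
      with cnt[of x] have "count A x = 1" by linarith
      then show ?thesis using True by simp
    qed (simp add: not_in_iff)
  qed
  have roots: "set_mset A = {x. poly p x = 0}"
    unfolding pA by (auto simp: poly_prod_mset prod_mset_zero_iff)
  have "p = (\<Prod>x\<in>#mset_set (set_mset A). [:- x, 1:])" using pA Aset by simp
  also have "\<dots> = (\<Prod>x\<in>set_mset A. [:- x, 1:])" by (simp add: prod_unfold_prod_mset)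
  finally show "p = (\<Prod>x\<in>{x. poly p x = 0}. [:- x, 1:])" by (simp only: roots)
  have "size A = card (set_mset A)" by (subst Aset) simp
  then show "card {x. poly p x = 0} = degree p" using A(1) roots by simp
qed

lemma irreducible_bezout:
  fixes P a :: "'f::field poly"
  assumes P: "irreducible P" and a: "\<not> P dvd a"
  obtains u v where "u * a + v * P = 1"
proof -
  define J where "J = {u * a + v * P | u v. True}"
  have Jmod: "x mod y \<in> J" if "x \<in> J" "y \<in> J" for x y
  proof -
    from that obtain u v u' v' where "x = u * a + v * P" "y = u' * a + v' * P" unfolding J_def by blast
    moreover have "x mod y = x - x div y * y" by (simp add: minus_div_mult_eq_mod)
    ultimately have "x mod y = (u - x div y * u') * a + (v - x div y * v') * P" by (simp add: algebra_simps)
    then show ?thesis unfolding J_def by blast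
  qed
  have P0: "P \<noteq> 0" using P by auto
  have PJ: "P \<in> J" unfolding J_def by (intro CollectI exI[of _ 0] exI[of _ 1]) simp
  have aJ: "a \<in> J" unfolding J_def by (intro CollectI exI[of _ 1] exI[of _ 0]) simp
  define N where "N = (LEAST N. \<exists>x\<in>J. x \<noteq> 0 \<and> degree x = N)"
  have "\<exists>x\<in>J. x \<noteq> 0 \<and> degree x = N" unfolding N_def by (rule LeastI_ex) (use PJ P0 in blast)
  then obtain j where j: "j \<in> J" "j \<noteq> 0" "degree j = N" by blast
  have dv: "j dvd x" if "x \<in> J" for x
  proof (rule ccontr)
    assume "\<not> j dvd x"
    then have x0: "x mod j \<noteq> 0" by (simp add: mod_eq_0_iff_dvd)
    then have "N \<le> degree (x mod j)" unfolding N_def by (intro Least_le) (use Jmod[OF that j(1)] in blast)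
    moreover have "degree (x mod j) < degree j" using degree_mod_less[OF j(2), of x] x0 by blast
    ultimately show False using j by simp
  qed
  obtain c where c: "P = j * c" using dv[OF PJ] by (auto elim: dvdE)
  then consider "j dvd 1" | "c dvd 1" using P by (metis irreducibleD)
  then show ?thesis
  proof cases
    case 1
    then obtain i where i: "1 = j * i" by (auto elim: dvdE)
    from j(1) obtain u v where "j = u * a + v * P" unfolding J_def by blast
    then have "(i * u) * a + (i * v) * P = 1" using i by (simp add: algebra_simps)
    then show ?thesis by (rule that)
  next
    case 2
    then have "P dvd j" using c by (metis dvd_mult_unit_iff' dvd_refl mult_dvd_mono mult.commute mult.right_neutral dvd_triv_left unit_imp_dvd dvd_mult_cancel_right mult_unit_dvd_iff)
    then show ?thesis using dv[OF aJ] a by (meson dvd_trans)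
  qed
qed

context drinfeld
begin

section \<open>The etale part for powers of \<open>P\<close> and its kernel\<close>

definition m :: nat where "m = r - 1"

lemma m_pos: "m > 0" using r by (simp add: m_def)

lemma r_m: "r = Suc m" using r by (simp add: m_def)

lemma deg_P_pow: "degree (P ^ j) = j * d" using P_0 by (simp add: degree_power_eq d_def)

lemma P_pow_0: "P ^ j \<noteq> 0" using P_0 by simp

lemma act_mult: "act h (a * b) x = act h a (act h b x)"
  unfolding act_def by (rule Fq_module.act_mult[OF module])

lemma dc_mult:
  assumes "a \<noteq> 0" "b \<noteq> 0" "i \<le> r * degree a + r * degree b"
  shows "dc h (a * b) i = star q (dc h a) (dc h b) i"
proof (rule ev_unique[OF q1 _ assms(3)])
  fix x
  have "ev q (dc h (a * b)) (r * degree a + r * degree b) x = act h (a * b) x"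
    unfolding act_ev using assms(1,2) by (simp add: degree_mult_eq distrib_left)
  also have "\<dots> = ev q (dc h a) (r * degree a) (ev q (dc h b) (r * degree b) x)"
    by (simp only: act_mult) (simp only: act_ev)
  also have "\<dots> = ev q (star q (dc h a) (dc h b)) (r * degree a + r * degree b) x"
    by (rule ev_comp[OF fr dc_0 dc_0])
  finally show "ev q (dc h (a * b)) (r * degree a + r * degree b) x
    = ev q (star q (dc h a) (dc h b)) (r * degree a + r * degree b) x" .
qed

lemma dc_top: "lead_coeff a = 1 \<Longrightarrow> dc h a (r * degree a) = 1"
proof -
  assume a: "lead_coeff a = 1"
  have "dc h a (r * degree a) = (\<Sum>i\<in>{degree a}. e (coeff a i) * tpow q (coefs h) i (r * degree a))"
    unfolding dco_def by (rule sum.mono_neutral_right) (use r in \<open>auto intro!: tpow_coefs_0\<close>)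
  moreover have "tpow q (coefs h) (degree a) (r * degree a) = 1"
    using r by (intro tpow_lead_1[OF q0 coefs_0]) (auto simp: coefs_def)
  ultimately show ?thesis using a by (simp add: field_embD[OF e])
qed

lemma lead_P_pow: "lead_coeff (P ^ j) = 1"
  using P_monic by (simp only: lead_coeff_power power_one)

text \<open>Lowest terms multiply: that of \<psi>_P stands at d with coefficient H 1 \<noteq> 0, so
  that of the j-th power stands exactly at j * d. The exactness is what makes the etale part
  separable.\<close>

lemma dc_P_pow: "(\<forall>i<j * d. dc g (P ^ j) i = 0) \<and> dc g (P ^ j) (j * d) \<noteq> 0"
proof (induction j)
  case 0
  then show ?case by (simp add: dco_def field_embD[OF e])
next
  case (Suc j)
  have bd: "Suc j * d \<le> r * degree P + r * degree (P ^ j)"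
  proof -
    have "Suc j * d \<le> r * (Suc j * d)" using r by simp
    then show ?thesis by (simp add: deg_P_pow d_def[symmetric] algebra_simps)
  qed
  have eq: "dc g (P ^ Suc j) i = star q (dc g P) (dc g (P ^ j)) i" if "i \<le> Suc j * d" for i
    using dc_mult[OF P_0 P_pow_0, of i j g] that bd by simp
  have z: "dc g P s * dc g (P ^ j) (i - s) ^ q ^ s = 0" if "i \<le> Suc j * d" "s \<le> i" "i < Suc j * d \<or> s \<noteq> d" for i s
  proof (cases "s < d")
    case True then show ?thesis by (simp add: dc_P_low)
  next
    case False
    then have "i - s < j * d" using that by auto
    then show ?thesis using Suc by (simp add: frob_0[OF fr])
  qed
  have "dc g (P ^ Suc j) i = 0" if "i < Suc j * d" for i
    using that eq[of i] z[of i] by (auto simp: star_def intro!: sum.neutral)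
  moreover have "dc g (P ^ Suc j) (Suc j * d) \<noteq> 0"
  proof -
    have "dc g (P ^ Suc j) (Suc j * d) = (\<Sum>s\<in>{d}. dc g P s * dc g (P ^ j) (Suc j * d - s) ^ q ^ s)"
      unfolding eq[OF order_refl] star_def
    proof (rule sum.mono_neutral_right)
      show "\<forall>s\<in>{..Suc j * d} - {d}. dc g P s * dc g (P ^ j) (Suc j * d - s) ^ q ^ s = 0"
        using z[OF order_refl] by blast
    qed auto
    then show ?thesis using Suc H1_nz by (simp add: H_def)
  qed
  ultimately show ?case by blast
qed

text \<open>Division by \<tau> ^ (j * d) on the right is a shift of indices, as all coefficients
  before j * d vanish.\<close>

definition cE :: "nat \<Rightarrow> nat \<Rightarrow> 'a" where "cE j l = dc g (P ^ j) (l + j * d)"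

definition Ep :: "nat \<Rightarrow> 'a poly" where "Ep j = ap q (cE j) (j * m * d)"

lemma idx: "j * m * d + j * d = r * (j * d)"
proof -
  have "r * (j * d) = Suc m * (j * d)" using r_m by (rule arg_cong)
  then show ?thesis by (simp add: algebra_simps)
qed

lemma cE_0: "l > j * m * d \<Longrightarrow> cE j l = 0"
  unfolding cE_def using idx[of j] by (intro dc_0) (simp add: deg_P_pow)

lemma cE_top: "cE j (j * m * d) = 1"
  unfolding cE_def idx using dc_top[OF lead_P_pow[of j], of g] by (simp add: deg_P_pow)

lemma poly_Ep: "poly (Ep j) (x ^ q ^ (j * d)) = act g (P ^ j) x"
proof -
  have "act g (P ^ j) x = (\<Sum>i\<le>r * (j * d). dc g (P ^ j) i * x ^ q ^ i)" by (simp add: act_ev ev_def deg_P_pow)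
  also have "\<dots> = (\<Sum>i\<in>{j * d..r * (j * d)}. dc g (P ^ j) i * x ^ q ^ i)"
    by (rule sum.mono_neutral_right) (use dc_P_pow[of j] in auto)
  also have "\<dots> = (\<Sum>l\<le>j * m * d. dc g (P ^ j) (l + j * d) * x ^ q ^ (l + j * d))"
    unfolding idx[symmetric]
    by (rule sum.reindex_bij_witness[of _ "\<lambda>l. l + j * d" "\<lambda>i. i - j * d"]) auto
  also have "\<dots> = poly (Ep j) (x ^ q ^ (j * d))"
    unfolding Ep_def poly_ap ev_def cE_def by (simp add: power_add power_mult[symmetric] mult.commute)
  finally show ?thesis by simp
qed

lemma of_nat_q: "of_nat q = (0::'a)" using binom_q[of 1] q1 by simp

lemma degree_Ep: "degree (Ep j) = q ^ (j * m * d)" "lead_coeff (Ep j) = 1"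
proof -
  let ?M = "j * m * d"
  have c: "coeff (Ep j) (q ^ ?M) = 1" unfolding Ep_def coeff_ap[OF q1] by (simp add: cE_top)
  have "degree (Ep j) \<le> q ^ ?M" unfolding Ep_def ap_def
    using q0 by (intro degree_sum_le order.trans[OF degree_monom_le]) (auto intro: power_increasing)
  moreover have "q ^ ?M \<le> degree (Ep j)" using c by (intro le_degree) simp
  ultimately show "degree (Ep j) = q ^ (j * m * d)" by simp
  then show "lead_coeff (Ep j) = 1" using c by simp
qed

text \<open>The derivative of a q-polynomial is its linear coefficient, here the lowest nonzero
  coefficient of \<psi> at P ^ j.\<close>

lemma pderiv_Ep: "poly (pderiv (Ep j)) x \<noteq> 0"
proof -
  have "pderiv (Ep j) = (\<Sum>l\<le>j * m * d. monom (of_nat (q ^ l) * cE j l) (q ^ l - 1))"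
    unfolding Ep_def ap_def by (simp add: higher_pderiv_sum[of 1, simplified] pderiv_monom)
  also have "\<dots> = (\<Sum>l\<in>{0}. monom (of_nat (q ^ l) * cE j l) (q ^ l - 1))"
    by (rule sum.mono_neutral_right) (auto simp: of_nat_q power_0_left)
  also have "\<dots> = [:cE j 0:]" by (simp add: monom_0)
  finally show ?thesis using dc_P_pow[of j] by (simp add: cE_def)
qed

lemma frob_bij: "bij (\<lambda>x::'a. x ^ q ^ j)"
proof (rule bijI)
  show "inj (\<lambda>x::'a. x ^ q ^ j)"
  proof (rule injI)
    fix x y :: 'a assume "x ^ q ^ j = y ^ q ^ j"
    then have "(x - y) ^ q ^ j = 0" by (simp add: frob_diff[OF fr])
    then show "x = y" by simp
  qed
  show "surj (\<lambda>x::'a. x ^ q ^ j)"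
    unfolding surj_def
  proof
    fix y :: 'a
    show "\<exists>x. y = x ^ q ^ j" using nth_root_exists[of "q ^ j" y] q0 by auto
  qed
qed

lemma roots_Ep: "{x. poly (Ep j) x = 0} = (\<lambda>x. x ^ q ^ (j * d)) ` {x. act g (P ^ j) x = 0}"
proof (intro Set.set_eqI iffI)
  fix x assume "x \<in> {x. poly (Ep j) x = 0}"
  moreover obtain y where "x = y ^ q ^ (j * d)" using frob_bij[of "j * d"] by (metis bij_pointE)
  ultimately show "x \<in> (\<lambda>x. x ^ q ^ (j * d)) ` {x. act g (P ^ j) x = 0}" by (auto simp: poly_Ep)
qed (auto simp: poly_Ep)

lemma card_ker: "card {x. act g (P ^ j) x = 0} = q ^ (j * m * d)" "finite {x. act g (P ^ j) x = 0}"
proof -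
  have inj: "inj_on (\<lambda>x. x ^ q ^ (j * d)) {x. act g (P ^ j) x = 0}"
    using frob_bij by (meson bij_def inj_on_subset subset_UNIV)
  show "card {x. act g (P ^ j) x = 0} = q ^ (j * m * d)"
    using separable_monic_factorization(2)[OF degree_Ep(2) pderiv_Ep, of j]
    by (simp add: roots_Ep card_image[OF inj] degree_Ep(1))
  then show "finite {x. act g (P ^ j) x = 0}" using q0 by (metis card.infinite power_not_zero neq0_conv)
qed

lemma act_surj: assumes "a \<noteq> 0" shows "\<exists>x. act h a x = y"
proof -
  let ?b = "smult (inverse (lead_coeff a)) a"
  have b: "lead_coeff ?b = 1" using assms by simp
  let ?N = "r * degree ?b"
  let ?p = "ap q (dc h ?b) ?N - [:e (inverse (lead_coeff a)) * y:]"
  have "coeff ?p (q ^ ?N) \<noteq> 0" using dc_top[OF b, of h] q0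
    by (simp only: coeff_diff coeff_ap[OF q1]) (auto simp: coeff_pCons split: nat.splits)
  moreover have "q ^ ?N > 0" using q0 by simp
  ultimately have "degree ?p > 0" by (meson le_degree less_le_trans)
  then obtain x where "poly ?p x = 0" using alg_closed_imp_poly_has_root by blast
  then have "act h ?b x = e (inverse (lead_coeff a)) * y" by (simp add: poly_ap act_ev)
  then have "e (inverse (lead_coeff a)) * act h a x = e (inverse (lead_coeff a)) * y"
    unfolding act_def by (simp only: Fq_module.act_smult[OF module])
  then show ?thesis using assms by (auto simp: field_embD[OF e])
qed

text \<open>The kernel of \<psi>_P has q ^ (m * d) elements and j < m vectors span at most q ^ (j *
  d), so a further vector exists. A coefficient of it prime to \<open>P\<close> is invertible modulo
  \<open>P\<close> and would put it into the span of the others.\<close>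

lemma ker_basis:
  assumes "j \<le> m"
  shows "\<exists>b. (\<forall>i<j. act g P (b i) = 0) \<and> (\<forall>a. (\<Sum>i<j. act g (a i) (b i)) = 0 \<longrightarrow> (\<forall>i<j. P dvd a i))"
  using assms
proof (induction j)
  case (Suc j)
  interpret A: Fq_module e "\<Psi> g" by (rule module)
  have act: "act g = A.act" by (simp add: act_def)
  from Suc obtain b where b: "\<And>i. i < j \<Longrightarrow> act g P (b i) = 0"
    "\<And>a i. (\<Sum>i<j. act g (a i) (b i)) = 0 \<Longrightarrow> i < j \<Longrightarrow> P dvd a i" by auto
  let ?W = "range (\<lambda>a. \<Sum>i<j. act g (a i) (b i))"
  let ?F = "{..<j} \<rightarrow>\<^sub>E {a :: 'f poly. degree a < d}"
  have fd: "finite {a :: 'f poly. degree a < d}" "card {a :: 'f poly. degree a < d} = q ^ d"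
    using card_poly_degree_less[OF d_pos, where 'f = 'f] by (auto simp: q_def)
  have sub: "?W \<subseteq> (\<lambda>a. \<Sum>i<j. act g (a i) (b i)) ` ?F"
  proof
    fix x assume "x \<in> ?W"
    then obtain a where a: "x = (\<Sum>i<j. act g (a i) (b i))" by blast
    define a' where "a' = restrict (\<lambda>i. a i mod P) {..<j}"
    have "degree (a i mod P) < d" for i using degree_mod_less[OF P_0, of "a i"] d_pos by (auto simp: d_def)
    then have "a' \<in> ?F" by (auto simp: a'_def)
    moreover have "x = (\<Sum>i<j. act g (a' i) (b i))"
      unfolding a by (intro sum.cong) (auto simp: a'_def act A.act_mod b(1)[unfolded act])
    ultimately show "x \<in> (\<lambda>a. \<Sum>i<j. act g (a i) (b i)) ` ?F" by blast
  qed
  have finF: "finite ?F" using fd by (intro finite_PiE) auto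
  have "card ?W \<le> card ((\<lambda>a. \<Sum>i<j. act g (a i) (b i)) ` ?F)" using sub finF by (intro card_mono) auto
  also have "\<dots> \<le> card ?F" using finF by (rule card_image_le)
  also have "\<dots> = q ^ (d * j)" by (simp add: card_PiE fd power_mult)
  also have "\<dots> < q ^ (1 * m * d)" using Suc.prems q1 d_pos by (intro power_strict_increasing) auto
  also have "\<dots> = card {x. act g (P ^ 1) x = 0}" by (simp only: card_ker)
  finally have "\<not> {x. act g (P ^ 1) x = 0} \<subseteq> ?W"
    using card_mono[of ?W "{x. act g (P ^ 1) x = 0}"] sub finF by (meson finite_imageI finite_subset not_le)
  then obtain \<beta> where \<beta>: "act g P \<beta> = 0" "\<beta> \<notin> ?W" by auto
  define b' where "b' = b(j := \<beta>)"
  have "P dvd a i" if h: "(\<Sum>i<Suc j. act g (a i) (b' i)) = 0" and i: "i < Suc j" for a i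
  proof -
    have h': "(\<Sum>i<j. act g (a i) (b i)) + act g (a j) \<beta> = 0"
    proof -
      have "(\<Sum>i<j. act g (a i) (b' i)) = (\<Sum>i<j. act g (a i) (b i))" by (intro sum.cong) (auto simp: b'_def)
      then show ?thesis using h by (simp add: b'_def)
    qed
    have Pj: "P dvd a j"
    proof (rule ccontr)
      assume "\<not> P dvd a j"
      then obtain u v where uv: "u * a j + v * P = 1" using irreducible_bezout[OF P_irr] by blast
      have "\<beta> = act g (u * a j + v * P) \<beta>" by (simp add: uv act)
      also have "\<dots> = act g u (act g (a j) \<beta>)" using \<beta>(1) by (simp add: act A.act_add A.act_mult)
      also have "act g (a j) \<beta> = act g (- 1) (\<Sum>i<j. act g (a i) (b i))"
        using h' by (simp add: act A.act_uminus eq_neg_iff_add_eq_0 add.commute)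
      also have "act g u \<dots> = (\<Sum>i<j. act g (u * (- 1) * a i) (b i))"
        by (simp only: act A.act_mult A.act_x_sum)
      finally have "\<beta> \<in> ?W" by (rule range_eqI[of _ _ "\<lambda>i. u * (- 1) * a i"])
      then show False using \<beta> by blast
    qed
    then obtain c where "a j = c * P" by (metis dvdE mult.commute)
    then have "act g (a j) \<beta> = 0" using \<beta>(1) by (simp add: act A.act_mult)
    then have "(\<Sum>i<j. act g (a i) (b i)) = 0" using h' by simp
    then show ?thesis using b(2) Pj i by (cases "i = j") auto
  qed
  moreover have "act g P (b' i) = 0" if "i < Suc j" for i using that b(1) \<beta>(1) by (auto simp: b'_def less_Suc_eq)
  ultimately show ?case by blast
qed auto

section \<open>The Frobenius twist and freeness of the torsion module\<close>

definition N :: nat where "N = q ^ (n * d)"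
text \<open>\<psi> at P ^ n is the etale part after the N-th power map, so the roots of the etale
  part are N-th powers of torsion points of \<psi>. The module acting on them has its parameters
  raised to the power N.\<close>

definition gN :: "nat \<Rightarrow> 'a" where "gN i = g i ^ N"

lemma N_pos: "N > 0" using q0 by (simp add: N_def)

lemma tb_N: "tb ^ N = tb"
proof -
  have "tb ^ q ^ (l * d) = tb" for l
  proof (induction l)
    case (Suc l)
    have "tb ^ q ^ (Suc l * d) = (tb ^ q ^ d) ^ q ^ (l * d)" by (simp add: power_add power_mult)
    then show ?case by (simp add: tb_qd Suc)
  qed simp
  then show ?thesis by (simp add: N_def)
qed

lemma coefs_gN: "coefs gN i = coefs g i ^ N"
  using N_pos by (auto simp: coefs_def gN_def tb_N power_0_left)

lemma \<Psi>_gN: "\<Psi> gN (x ^ N) = \<Psi> g x ^ N"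
proof -
  have "\<Psi> g x ^ N = (\<Sum>j\<le>r. coefs g j ^ N * (x ^ q ^ j) ^ N)"
    unfolding \<Psi>_def ev_def N_def by (simp only: frob_sum[OF fr] power_mult_distrib)
  also have "\<dots> = \<Psi> gN (x ^ N)"
    unfolding \<Psi>_def ev_def coefs_gN by (simp add: power_mult[symmetric] mult.commute)
  finally show ?thesis by simp
qed

lemma act_gN: "act gN a (x ^ N) = act g a x ^ N"
proof -
  have "(\<Psi> gN ^^ i) (x ^ N) = (\<Psi> g ^^ i) x ^ N" for i by (induction i) (simp_all add: \<Psi>_gN)
  then show ?thesis
    unfolding act_def Fq_module.act_def[OF module] unfolding N_def
    by (simp add: frob_sum[OF fr] power_mult_distrib e_q)
qed

definition V :: "'a set" where "V = {x. poly (Ep n) x = 0}"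

lemma V_iff: "x \<in> V \<longleftrightarrow> (\<exists>y. x = y ^ N \<and> act g (P ^ n) y = 0)"
  unfolding V_def roots_Ep N_def by auto

lemma card_V: "card V = q ^ (n * m * d)" "finite V"
  unfolding V_def using separable_monic_factorization(2)[OF degree_Ep(2) pderiv_Ep, of n] degree_Ep(1)[of n] q0
  by (auto intro: card_ge_0_finite)

lemma Ep_prod: "Ep n = (\<Prod>x\<in>V. [:- x, 1:])"
  unfolding V_def by (rule separable_monic_factorization(1)[OF degree_Ep(2) pderiv_Ep])

lemma V_act: "x \<in> V \<Longrightarrow> act gN a x \<in> V"
proof -
  interpret A: Fq_module e "\<Psi> g" by (rule module)
  assume "x \<in> V"
  then obtain y where y: "x = y ^ N" "act g (P ^ n) y = 0" by (auto simp: V_iff)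
  have "act g (P ^ n) (act g a y) = act g a (act g (P ^ n) y)"
    by (simp only: act_mult[symmetric] mult.commute)
  also have "\<dots> = 0" using y(2) by (simp add: act_def)
  finally show ?thesis unfolding V_iff using y(1) act_gN by blast
qed

lemma V_add: "x \<in> V \<Longrightarrow> y \<in> V \<Longrightarrow> x + y \<in> V"
  unfolding V_def Ep_def by (simp add: poly_ap Fq_module.\<Psi>_add[OF Fq_module_ev])

lemma V_zero: "0 \<in> V"
  unfolding V_def Ep_def by (simp add: poly_ap Fq_module.\<Psi>_0[OF Fq_module_ev])

lemma V_sum: "(\<And>i. i \<in> A \<Longrightarrow> f i \<in> V) \<Longrightarrow> (\<Sum>i\<in>A. f i) \<in> V"
  by (induction A rule: infinite_finite_induct) (auto intro: V_add V_zero)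

lemma V_ann: "x \<in> V \<Longrightarrow> act gN (P ^ n) x = 0"
  using N_pos by (auto simp: V_iff act_gN power_0_left)

definition basis :: "(nat \<Rightarrow> 'a) \<Rightarrow> bool" where
  "basis x \<longleftrightarrow> (\<forall>i<m. x i \<in> V) \<and> (\<forall>a. (\<Sum>i<m. act gN (a i) (x i)) = 0 \<longrightarrow> (\<forall>i<m. P ^ n dvd a i))"

text \<open>Preimages under P ^ (n - 1) of a basis \<open>b\<close> of the P-torsion are raised to
  the power N. If P ^ j divides the coefficients of a relation, applying P ^ (n - 1 - j) leaves a
  relation between the \<open>b i\<close>, which yields one more factor \<open>P\<close>.\<close>

lemma basis_exists: "\<exists>x. basis x"
proof -
  interpret A: Fq_module e "\<Psi> g" by (rule module)
  have act: "act g = A.act" by (simp add: act_def)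
  obtain b where b: "\<And>i. i < m \<Longrightarrow> act g P (b i) = 0"
    "\<And>a i. (\<Sum>i<m. act g (a i) (b i)) = 0 \<Longrightarrow> i < m \<Longrightarrow> P dvd a i" using ker_basis[of m] by auto
  have "\<forall>i. \<exists>y. act g (P ^ (n - 1)) y = b i" using act_surj P_pow_0 by blast
  then obtain y where y: "\<And>i. act g (P ^ (n - 1)) (y i) = b i" by metis
  define x where "x i = y i ^ N" for i
  have Pn: "P ^ n = P * P ^ (n - 1)" using n by (metis Suc_diff_1 power_Suc less_le_trans zero_less_one)
  have "x i \<in> V" if "i < m" for i
  proof -
    have "act g (P ^ n) (y i) = 0" by (simp only: Pn act_mult y b(1)[OF that])
    then show ?thesis unfolding V_iff x_def by blast
  qed
  moreover have "P ^ n dvd a i" if h: "(\<Sum>i<m. act gN (a i) (x i)) = 0" and i: "i < m" for a i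
  proof -
    have "(\<Sum>i<m. act g (a i) (y i)) ^ N = 0"
      using h[unfolded x_def act_gN] unfolding N_def by (simp only: frob_sum[OF fr])
    then have h': "(\<Sum>i<m. act g (a i) (y i)) = 0" by simp
    have "\<forall>i<m. P ^ j dvd a i" if "j \<le> n" for j
      using that
    proof (induction j)
      case (Suc j)
      then have "\<forall>i. \<exists>c. i < m \<longrightarrow> a i = P ^ j * c" by (auto elim!: dvdE)
      then obtain c where c: "\<And>i. i < m \<Longrightarrow> a i = P ^ j * c i" by metis
      have nj: "n - 1 = (n - 1 - j) + j" using Suc.prems by simp
      have "0 = act g (P ^ (n - 1 - j)) (\<Sum>i<m. act g (a i) (y i))"
        unfolding h' by (simp add: act)
      also have "\<dots> = (\<Sum>i<m. act g (P ^ (n - 1 - j) * a i) (y i))" by (simp only: act A.act_mult A.act_x_sum)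
      also have "\<dots> = (\<Sum>i<m. act g (c i) (b i))"
      proof (intro sum.cong refl)
        fix i assume "i \<in> {..<m}"
        then have "P ^ (n - 1 - j) * a i = c i * (P ^ (n - 1 - j) * P ^ j)" using c by (simp add: ac_simps)
        also have "P ^ (n - 1 - j) * P ^ j = P ^ (n - 1)" using nj by (metis power_add)
        finally show "act g (P ^ (n - 1 - j) * a i) (y i) = act g (c i) (b i)" by (simp only: act_mult y)
      qed
      finally have "\<forall>i<m. P dvd c i" using b(2) by metis
      then show ?case using c by (auto simp: mult.commute intro: mult_dvd_mono)
    qed simp
    then show ?thesis using i by blast
  qed
  ultimately show ?thesis unfolding basis_def by blast
qed

definition Rep :: "(nat \<Rightarrow> 'f poly) set" where "Rep = {..<m} \<rightarrow>\<^sub>E {a. degree a < n * d}"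

definition comb :: "(nat \<Rightarrow> 'a) \<Rightarrow> (nat \<Rightarrow> 'f poly) \<Rightarrow> 'a" where "comb x a = (\<Sum>i<m. act gN (a i) (x i))"

lemma nd_pos: "n * d > 0" using n d_pos by simp

lemma card_Rep: "finite Rep" "card Rep = q ^ (n * m * d)"
proof -
  have fd: "finite {a :: 'f poly. degree a < n * d}" "card {a :: 'f poly. degree a < n * d} = q ^ (n * d)"
    using card_poly_degree_less[OF nd_pos, where 'f = 'f] by (auto simp: q_def)
  show "finite Rep" unfolding Rep_def using fd by (intro finite_PiE) auto
  show "card Rep = q ^ (n * m * d)" unfolding Rep_def by (simp add: card_PiE fd power_mult[symmetric] ac_simps)
qed

text \<open>Independence makes reduced coefficient vectors inject into \<open>V\<close>, and both
  sets have q ^ (n * m * d) elements; so generation need not be part of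
  \<open>basis\<close>.\<close>

lemma comb_bij: assumes x: "basis x" shows "bij_betw (comb x) Rep V"
proof -
  interpret A: Fq_module e "\<Psi> gN" by (rule module)
  have act: "act gN = A.act" by (simp add: act_def)
  have inj: "inj_on (comb x) Rep"
  proof (rule inj_onI)
    fix a b assume ab: "a \<in> Rep" "b \<in> Rep" "comb x a = comb x b"
    then have "(\<Sum>i<m. act gN (a i - b i) (x i)) = 0"
      by (simp add: comb_def act A.act_diff sum_subtractf)
    then have dv: "P ^ n dvd a i - b i" if "i < m" for i
      using x that unfolding basis_def by (elim conjE allE[of _ "\<lambda>i. a i - b i"]) blast
    show "a = b"
    proof (rule PiE_ext[OF ab(1,2)[unfolded Rep_def]])
      fix i assume i: "i \<in> {..<m}"
      then have "degree (a i) < n * d" "degree (b i) < n * d" using ab unfolding Rep_def by auto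
      then have "degree (a i - b i) < degree (P ^ n)" unfolding deg_P_pow by (rule degree_diff_less)
      then have "a i - b i = 0" using dv i by (metis dvd_imp_degree_le leD lessThan_iff)
      then show "a i = b i" by simp
    qed
  qed
  have "comb x ` Rep \<subseteq> V" using x unfolding basis_def comb_def by (auto intro!: V_sum V_act)
  then have "comb x ` Rep = V"
    using card_image[OF inj] card_V card_Rep by (intro card_subset_eq) auto
  with inj show ?thesis by (simp add: bij_betw_def)
qed

lemma Ep_comb: "basis x \<Longrightarrow> Ep n = (\<Prod>a\<in>Rep. [:- comb x a, 1:])"
  unfolding Ep_prod by (rule prod.reindex_bij_betw[symmetric]) (rule comb_bij)

end

section \<open>Torsion points as local coordinates\<close>

lemma fun_sum_apply: "(\<Sum>i\<in>A. f i) z = (\<Sum>i\<in>A. f i z)"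
  by (induction A rule: infinite_finite_induct) auto

lemma fun_power_apply: "((f :: 'b \<Rightarrow> 'a::comm_ring_1) ^ k) z = f z ^ k"
  by (induction k) auto

lemma fun_mpow_apply: "mpow J (f :: 'i \<Rightarrow> 'b \<Rightarrow> 'a::comm_ring_1) e z = mpow J (\<lambda>i. f i z) e"
proof -
  have "(\<Prod>i\<in>A. f i ^ e i) z = (\<Prod>i\<in>A. f i z ^ e i)" for A
    by (induction A rule: infinite_finite_induct) (auto simp: fun_power_apply)
  then show ?thesis by (simp add: mpow_def)
qed

context drinfeld
begin

section \<open>The commutation relation of the etale part\<close>

abbreviation "J \<equiv> {..<m}"
abbreviation "B \<equiv> q ^ (n * m * d)"

definition kg :: "'a set" where "kg = ring_hull (k \<union> g ` I)"

lemma kg_subring: "is_subring kg" unfolding kg_def by (rule subring_ring_hull)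

lemma k_kg: "c \<in> k \<Longrightarrow> c \<in> kg" unfolding kg_def by (rule ring_hull.base) simp

lemma g_kg: "i \<in> I \<Longrightarrow> g i \<in> kg" unfolding kg_def by (rule ring_hull.base) simp

lemma coefs_kg: "coefs g i \<in> kg" "coefs gN i \<in> kg"
proof -
  show 1: "coefs g i \<in> kg" using k_kg[OF tb_k] g_kg[of i] is_subringD(1,2)[OF kg_subring] by (auto simp: coefs_def)
  then show "coefs gN i \<in> kg" unfolding coefs_gN by (rule is_subringD(7)[OF kg_subring])
qed

lemma dc_kg: "dc g a j \<in> kg" "dc gN a j \<in> kg"
  using coefs_kg k_kg[OF e_k] by (intro dco_subring[OF kg_subring]; blast)+

text \<open>\<psi>_t commutes with \<psi> at P ^ n, that is with the etale part after the N-th power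
  map. Moving this map past \<psi>_t twists the parameters, and it cancels because it is
  onto.\<close>

lemma E_commute: "star q (coefs g) (cE n) l = star q (cE n) (coefs gN) l"
proof -
  let ?M = "n * m * d"
  have "ev q (star q (coefs g) (cE n)) (r + ?M) x = ev q (star q (cE n) (coefs gN)) (r + ?M) x" for x
  proof -
    obtain y where y: "x = y ^ N" using frob_bij[of "n * d"] unfolding N_def by (metis bij_pointE)
    have E: "ev q (cE n) ?M (z ^ N) = act g (P ^ n) z" for z
      using poly_Ep[of n z] by (simp add: Ep_def poly_ap N_def)
    have "ev q (star q (coefs g) (cE n)) (r + ?M) x = \<Psi> g (ev q (cE n) ?M x)"
      unfolding \<Psi>_def by (rule ev_comp[OF fr coefs_0 cE_0, symmetric])
    also have "\<dots> = \<Psi> g (act g (P ^ n) y)" by (simp only: y E)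
    also have "\<dots> = act g (P ^ n) (\<Psi> g y)" unfolding act_def by (rule Fq_module.act_commute[OF module, symmetric])
    also have "\<dots> = ev q (cE n) ?M (\<Psi> gN x)" by (simp only: E[symmetric] \<Psi>_gN y)
    also have "\<dots> = ev q (star q (cE n) (coefs gN)) (?M + r) x"
      unfolding \<Psi>_def by (rule ev_comp[OF fr cE_0 coefs_0])
    finally show ?thesis by (simp add: add.commute)
  qed
  note eq = this
  show ?thesis
  proof (cases "l \<le> r + ?M")
    case True
    then show ?thesis by (rule ev_unique[OF q1 eq])
  next
    case False
    have z: "coefs g i * cE n (l - i) ^ q ^ i = 0" "cE n i * coefs gN (l - i) ^ q ^ i = 0" for i
    proof -
      show "coefs g i * cE n (l - i) ^ q ^ i = 0"
        using False cE_0[of n "l - i"] coefs_0[of i g] by (cases "i > r") (auto simp: frob_0[OF fr])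
      show "cE n i * coefs gN (l - i) ^ q ^ i = 0"
        using False cE_0[of n i] coefs_0[of "l - i" gN] by (cases "i > ?M") (auto simp: frob_0[OF fr])
    qed
    show ?thesis unfolding star_def by (simp only: z)
  qed
qed

text \<open>Comparing coefficients in \<open>\<psi>\<^sub>t \<circ> E = E \<circ> \<psi>'\<^sub>t\<close> expresses \<open>g i - g i ^ q ^ (r * d * n)\<close> by the
  non-leading coefficients of \<open>E\<close>; this is why the torsion points are local coordinates.\<close>

lemma g_frob:
  assumes i: "i \<in> I"
  shows "g i - g i ^ q ^ (r * d * n) =
    (\<Sum>l<n * m * d. cE n l * coefs gN (n * m * d + i - l) ^ q ^ l)
    - (\<Sum>s\<in>{i<..n * m * d + i}. coefs g s * cE n (n * m * d + i - s) ^ q ^ s)"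
proof -
  let ?M = "n * m * d"
  have "star q (coefs g) (cE n) (?M + i) = (\<Sum>s\<in>insert i {i<..?M + i}. coefs g s * cE n (?M + i - s) ^ q ^ s)"
    unfolding star_def
  proof (rule sum.mono_neutral_right)
    show "\<forall>s\<in>{..?M + i} - insert i {i<..?M + i}. coefs g s * cE n (?M + i - s) ^ q ^ s = 0"
    proof
      fix s assume "s \<in> {..?M + i} - insert i {i<..?M + i}"
      then have "?M + i - s > ?M" by auto
      then show "coefs g s * cE n (?M + i - s) ^ q ^ s = 0" by (simp add: cE_0 frob_0[OF fr])
    qed
  qed auto
  also have "\<dots> = g i + (\<Sum>s\<in>{i<..?M + i}. coefs g s * cE n (?M + i - s) ^ q ^ s)"
    using i by (simp add: cE_top coefs_def)
  finally have L: "star q (coefs g) (cE n) (?M + i) = \<dots>" .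
  have "star q (cE n) (coefs gN) (?M + i) = (\<Sum>l\<in>insert ?M {..<?M}. cE n l * coefs gN (?M + i - l) ^ q ^ l)"
    unfolding star_def by (rule sum.mono_neutral_right) (auto simp: cE_0)
  also have "\<dots> = g i ^ q ^ (r * d * n) + (\<Sum>l<?M. cE n l * coefs gN (?M + i - l) ^ q ^ l)"
  proof -
    have "coefs gN i ^ q ^ ?M = g i ^ (N * q ^ ?M)" using i by (simp add: coefs_def gN_def power_mult)
    also have "N * q ^ ?M = q ^ (?M + n * d)" by (simp add: N_def power_add)
    also have "?M + n * d = r * d * n" using idx[of n] by (simp add: ac_simps)
    finally show ?thesis by (simp add: cE_top)
  qed
  finally have R: "star q (cE n) (coefs gN) (?M + i) = \<dots>" .
  from L R E_commute[of "?M + i"] show ?thesis by (simp add: algebra_simps)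
qed

end

locale supersingular = drinfeld e P tb g r n
  for e :: "'f::{finite, field} \<Rightarrow> 'a::alg_closed_field" and P tb g r n +
  fixes g0 :: "nat \<Rightarrow> 'a"
  assumes g0_k: "i \<in> {1..<r} \<Longrightarrow> g0 i \<in> k" and g0_act: "act g0 (P ^ n) x = x ^ q ^ (r * d * n)"
    and g0_frob: "i \<in> {1..<r} \<Longrightarrow> g0 i ^ q ^ (r * d * n) = g0 i"
begin

text \<open>Functions on \<open>bool\<close> are pairs of field elements, the values belonging to two bases \<open>X True\<close> and
  \<open>X False\<close>; \<open>g\<close> and \<open>k\<close> are embedded diagonally.\<close>

definition Kh :: "(bool \<Rightarrow> 'a) set" where "Kh = (\<lambda>c _. c) ` k"

definition xh :: "(bool \<Rightarrow> nat \<Rightarrow> 'a) \<Rightarrow> nat \<Rightarrow> bool \<Rightarrow> 'a" where "xh X i b = X b i"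

definition Zh :: "(bool \<Rightarrow> nat \<Rightarrow> 'a) \<Rightarrow> (bool \<Rightarrow> 'a) set" where
  "Zh X = (\<lambda>i _. g i - g0 i) ` I \<union> xh X ` J"

definition Z :: "(nat \<Rightarrow> 'a) \<Rightarrow> 'a set" where "Z x = (\<lambda>i. g i - g0 i) ` I \<union> x ` J"

section \<open>The ring of pairs attached to two bases\<close>

lemma Kh_subring: "is_subring Kh"
  unfolding Kh_def by (rule subring_image[OF k_subring]) (auto simp: fun_eq_iff)

lemma kg_filt: "y \<in> kg \<Longrightarrow> filt Kh (Zh X) 0 (\<lambda>_. y)"
  unfolding kg_def
proof (induction rule: ring_hull.induct)
  case (base y)
  have "filt Kh (Zh X) 0 (\<lambda>_. g i)" if "i \<in> I" for i
  proof -
    have "filt Kh (Zh X) 0 (\<lambda>_. g i - g0 i)"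
      by (rule filt.weaken, rule filt.gen[simplified]) (use that in \<open>auto simp: Zh_def\<close>)
    moreover have "filt Kh (Zh X) 0 (\<lambda>_. g0 i)" by (rule filt.const) (use g0_k that in \<open>auto simp: Kh_def\<close>)
    ultimately have "filt Kh (Zh X) 0 ((\<lambda>_. g i - g0 i) + (\<lambda>_. g0 i))" by (rule filt.add)
    then show ?thesis by (simp add: plus_fun_def)
  qed
  moreover have "filt Kh (Zh X) 0 (\<lambda>_. y)" if "y \<in> k" by (rule filt.const) (use that in \<open>auto simp: Kh_def\<close>)
  ultimately show ?case using base by auto
next
  case zero then show ?case using filt.zero[of Kh "Zh X" 0] by (simp add: zero_fun_def)
next
  case one then show ?case using filt.const[OF is_subringD(2)[OF Kh_subring], of "Zh X"] by (simp add: one_fun_def)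
next
  case (uminus y)
  then show ?case using filt_uminus[OF Kh_subring uminus.IH] by (simp add: fun_Compl_def)
next
  case (add y z)
  then show ?case using filt.add[OF add.IH] by (simp add: plus_fun_def)
next
  case (mult y z)
  then show ?case using filt_mult_left[OF Kh_subring mult.IH] by (simp add: times_fun_def)
qed

text \<open>The ideal generated by the torsion coordinates alone, without the g i - g0 i. It turns
  out to contain these up to the square of the larger ideal.\<close>

definition XI :: "(bool \<Rightarrow> nat \<Rightarrow> 'a) \<Rightarrow> (bool \<Rightarrow> 'a) \<Rightarrow> bool" where
  "XI X f \<longleftrightarrow> (\<exists>b. (\<forall>j\<in>J. filt Kh (Zh X) 0 (b j)) \<and> f = (\<Sum>j\<in>J. xh X j * b j))"

lemma XI_zero: "XI X 0"
  unfolding XI_def by (intro exI[of _ "\<lambda>_. 0"]) (auto intro: filt.zero)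

lemma XI_add: "XI X f \<Longrightarrow> XI X h \<Longrightarrow> XI X (f + h)"
  unfolding XI_def
proof (elim exE conjE)
  fix b b' assume "\<forall>j\<in>J. filt Kh (Zh X) 0 (b j)" "f = (\<Sum>j\<in>J. xh X j * b j)"
    "\<forall>j\<in>J. filt Kh (Zh X) 0 (b' j)" "h = (\<Sum>j\<in>J. xh X j * b' j)"
  then show "\<exists>b. (\<forall>j\<in>J. filt Kh (Zh X) 0 (b j)) \<and> f + h = (\<Sum>j\<in>J. xh X j * b j)"
    by (intro exI[of _ "\<lambda>j. b j + b' j"]) (auto simp: distrib_left sum.distrib intro: filt.add)
qed

lemma XI_mult: "XI X f \<Longrightarrow> filt Kh (Zh X) 0 h \<Longrightarrow> XI X (h * f)"
  unfolding XI_def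
proof (elim exE conjE)
  fix b assume b: "\<forall>j\<in>J. filt Kh (Zh X) 0 (b j)" "f = (\<Sum>j\<in>J. xh X j * b j)" and h: "filt Kh (Zh X) 0 h"
  have "h * f = (\<Sum>j\<in>J. xh X j * (h * b j))" unfolding b(2) sum_distrib_left by (simp add: mult.left_commute)
  then show "\<exists>b. (\<forall>j\<in>J. filt Kh (Zh X) 0 (b j)) \<and> h * f = (\<Sum>j\<in>J. xh X j * b j)"
    using b(1) h by (intro exI[of _ "\<lambda>j. h * b j"]) (auto intro: filt_mult_left[OF Kh_subring])
qed

lemma XI_sum: "(\<And>i. i \<in> A \<Longrightarrow> XI X (f i)) \<Longrightarrow> XI X (\<Sum>i\<in>A. f i)"
  by (induction A rule: infinite_finite_induct) (auto intro: XI_zero XI_add)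

lemma XI_uminus: "XI X f \<Longrightarrow> XI X (- f)"
  using XI_mult[of X f "- 1"] filt_uminus[OF Kh_subring filt.const[OF is_subringD(2)[OF Kh_subring]]] by simp

lemma xh_filt: "j \<in> J \<Longrightarrow> filt Kh (Zh X) 0 (xh X j)"
  by (rule filt.weaken, rule filt.gen[simplified]) (auto simp: Zh_def)

lemma XI_x: assumes "j \<in> J" shows "XI X (xh X j)"
proof -
  have "(\<Sum>i\<in>J. xh X i * (if i = j then 1 else 0)) = (\<Sum>i\<in>J. if i = j then xh X j else 0)"
    by (intro sum.cong) auto
  also have "\<dots> = xh X j" using assms by (simp add: sum.delta)
  finally have "xh X j = (\<Sum>i\<in>J. xh X i * (if i = j then 1 else 0))" by simp
  moreover have "\<forall>i\<in>J. filt Kh (Zh X) 0 (if i = j then 1 else 0)"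
    by (auto intro: filt.zero filt.const is_subringD[OF Kh_subring])
  ultimately show ?thesis unfolding XI_def by (intro exI[of _ "\<lambda>i. if i = j then 1 else 0"]) blast
qed

lemma XI_filt: assumes "XI X f" shows "filt Kh (Zh X) 0 f"
proof -
  obtain b where "\<forall>j\<in>J. filt Kh (Zh X) 0 (b j)" "f = (\<Sum>j\<in>J. xh X j * b j)" using assms unfolding XI_def by blast
  then show ?thesis by (auto intro!: filt_sum[OF Kh_subring] filt_mult_left[OF Kh_subring] xh_filt)
qed

lemma XI_act: assumes "j \<in> J" shows "XI X (\<lambda>b. act gN a (X b j))"
proof -
  have "(\<lambda>b. act gN a (X b j)) = (\<Sum>l\<le>r * degree a. (\<lambda>_. dc gN a l) * xh X j ^ q ^ l)"
    by (rule ext) (simp add: act_ev ev_def fun_sum_apply fun_power_apply xh_def)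
  moreover have "XI X \<dots>"
  proof (intro XI_sum XI_mult kg_filt dc_kg)
    fix l
    obtain t where t: "q ^ l = Suc t" using q0 by (metis gr0_implies_Suc zero_less_power)
    have "XI X (xh X j ^ t * xh X j)"
      using is_subringD(7)[OF filt_subring[OF Kh_subring], of "xh X j" "Zh X" t] xh_filt[OF assms]
      by (intro XI_mult XI_x assms) auto
    then show "XI X (xh X j ^ q ^ l)" by (simp add: t mult.commute)
  qed
  ultimately show ?thesis by (rule ssubst[where P = "XI X"])
qed

lemma XI_comb: "XI X (\<lambda>b. comb (X b) a)"
proof -
  have "(\<lambda>b. comb (X b) a) = (\<Sum>i\<in>J. (\<lambda>b. act gN (a i) (X b i)))"
    by (rule ext) (simp add: comb_def fun_sum_apply)
  moreover have "XI X \<dots>" by (intro XI_sum XI_act)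
  ultimately show ?thesis by (rule ssubst[where P = "XI X"])
qed

text \<open>Modulo the ideal every factor is X, so only the top coefficient of the product
  survives.\<close>

lemma coeff_prod_filt:
  assumes "finite A" and v: "\<And>a. a \<in> A \<Longrightarrow> XI X (\<lambda>b. v b a)"
  shows "filt Kh (Zh X) 0 (\<lambda>b. coeff (\<Prod>a\<in>A. [:- v b a, 1:]) j) \<and>
    (j < card A \<longrightarrow> XI X (\<lambda>b. coeff (\<Prod>a\<in>A. [:- v b a, 1:]) j))"
  using assms
proof (induction A arbitrary: j rule: finite_induct)
  case empty
  show ?case using kg_filt[OF is_subringD(1)[OF kg_subring], of X] kg_filt[OF is_subringD(2)[OF kg_subring], of X]
    by (cases j) auto
next
  case (insert a A)
  let ?p = "\<lambda>b. \<Prod>a\<in>A. [:- v b a, 1:]"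
  have IH: "filt Kh (Zh X) 0 (\<lambda>b. coeff (?p b) i)" "i < card A \<Longrightarrow> XI X (\<lambda>b. coeff (?p b) i)" for i
    using insert.IH[of i] insert.prems by auto
  define sh where "sh b = (if j = 0 then 0 else coeff (?p b) (j - 1))" for b
  have eq: "(\<lambda>b. coeff (\<Prod>a\<in>insert a A. [:- v b a, 1:]) j) = (\<lambda>b. coeff (?p b) j) * (- (\<lambda>b. v b a)) + sh"
    using insert.hyps by (intro ext) (simp add: sh_def coeff_pCons mult.commute split: nat.splits)
  have XIv: "XI X ((\<lambda>b. coeff (?p b) j) * (- (\<lambda>b. v b a)))"
    using insert.prems by (intro XI_mult XI_uminus IH) auto
  have shf: "filt Kh (Zh X) 0 sh"
  proof (cases "j = 0")
    case True
    then have "sh = 0" by (auto simp: sh_def)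
    then show ?thesis by (simp add: filt.zero)
  next
    case False
    then have "sh = (\<lambda>b. coeff (?p b) (j - 1))" by (auto simp: sh_def)
    then show ?thesis using IH(1)[of "j - 1"] by simp
  qed
  moreover have "XI X sh" if "j < card (insert a A)"
  proof (cases "j = 0")
    case True
    then have "sh = 0" by (auto simp: sh_def)
    then show ?thesis by (simp add: XI_zero)
  next
    case False
    then have "sh = (\<lambda>b. coeff (?p b) (j - 1))" by (auto simp: sh_def)
    moreover have "j - 1 < card A" using that False insert.hyps by simp
    ultimately show ?thesis using IH(2)[of "j - 1"] by simp
  qed
  ultimately show ?case unfolding eq using filt.add[OF XI_filt[OF XIv] shf] XI_add[OF XIv, of sh] by blast
qed

text \<open>Non-leading coefficients of the etale part are symmetric functions of its roots, and the
  roots are combinations of a basis without constant term. Both bases enumerate the same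
  \<open>V\<close>, so the expression has equal components.\<close>

lemma XI_cE:
  assumes X: "\<And>b. basis (X b)" and l: "l < n * m * d"
  shows "XI X (\<lambda>_. cE n l)"
proof -
  have "coeff (Ep n) (q ^ l) = cE n l" unfolding Ep_def coeff_ap[OF q1] using l by simp
  then have "(\<lambda>_. cE n l) = (\<lambda>b. coeff (\<Prod>a\<in>Rep. [:- comb (X b) a, 1:]) (q ^ l))"
    by (simp add: Ep_comb[OF X, symmetric])
  moreover have "XI X \<dots>"
  proof -
    have "q ^ l < card Rep" using card_Rep q1 l by (simp add: power_strict_increasing)
    then show ?thesis using coeff_prod_filt[OF card_Rep(1), of X "\<lambda>b. comb (X b)" "q ^ l"] XI_comb by blast
  qed
  ultimately show ?thesis by (rule ssubst[where P = "XI X"])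
qed

lemma XI_g:
  assumes X: "\<And>b. basis (X b)" and i: "i \<in> I"
  shows "XI X (\<lambda>_. g i - g i ^ q ^ (r * d * n))"
proof -
  let ?M = "n * m * d"
  have "(\<lambda>_::bool. g i - g i ^ q ^ (r * d * n)) =
     (\<Sum>l<?M. (\<lambda>_. coefs gN (?M + i - l) ^ q ^ l) * (\<lambda>_. cE n l))
     + (- (\<Sum>s\<in>{i<..?M + i}. (\<lambda>_. coefs g s * cE n (?M + i - s) ^ (q ^ s - 1)) * (\<lambda>_. cE n (?M + i - s))))"
  proof (rule ext)
    have "x ^ q ^ s = x ^ (q ^ s - 1) * x" for x :: 'a and s
      using q0 by (metis Suc_diff_1 power_Suc2 zero_less_power)
    then show "g i - g i ^ q ^ (r * d * n) =
     ((\<Sum>l<?M. (\<lambda>_. coefs gN (?M + i - l) ^ q ^ l) * (\<lambda>_. cE n l))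
     + (- (\<Sum>s\<in>{i<..?M + i}. (\<lambda>_. coefs g s * cE n (?M + i - s) ^ (q ^ s - 1)) * (\<lambda>_. cE n (?M + i - s))))) b" for b :: bool
      unfolding g_frob[OF i] by (simp add: fun_sum_apply mult.assoc mult.commute[of "cE n _"])
  qed
  moreover have "XI X \<dots>"
  proof (intro XI_add XI_uminus XI_sum XI_mult)
    show "XI X (\<lambda>_. cE n l)" if "l \<in> {..<?M}" for l using XI_cE[of X, OF X] that by simp
    show "filt Kh (Zh X) 0 (\<lambda>_. coefs gN (?M + i - l) ^ q ^ l)" for l
      by (intro kg_filt is_subringD(7)[OF kg_subring] coefs_kg)
    show "XI X (\<lambda>_. cE n (?M + i - s))" if "s \<in> {i<..?M + i}" for s using XI_cE[of X, OF X, of "?M + i - s"] that by auto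
    show "filt Kh (Zh X) 0 (\<lambda>_. coefs g s * cE n (?M + i - s) ^ (q ^ s - 1))" for s
      unfolding cE_def by (intro kg_filt is_subringD(4,7)[OF kg_subring] coefs_kg dc_kg)
  qed
  ultimately show ?thesis by (rule ssubst[where P = "XI X"])
qed

lemma Q_ge_2: "q ^ (r * d * n) \<ge> 2"
proof -
  have "r * d * n > 0" using r d_pos n by simp
  then show ?thesis using one_less_power[OF q1, of "r * d * n"] by simp
qed

text \<open>Put Q = q ^ (r * d * n). For z = g i - g0 i one has z ^ Q = g i ^ Q - g0 i, as g0 i is
  fixed by the Q-th power. Hence z - z ^ Q lies in \<open>XI X\<close> by \<open>XI_g\<close>, and z
  ^ Q lies in the square of the ideal because Q \<ge> 2.\<close>

lemma Zh_param:
  assumes X: "\<And>b. basis (X b)" and z: "z \<in> Zh X"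
  shows "\<exists>b. (\<forall>j\<in>J. filt Kh (Zh X) 0 (b j)) \<and> filt Kh (Zh X) 2 (z - (\<Sum>j\<in>J. xh X j * b j))"
proof -
  consider i where "i \<in> I" "z = (\<lambda>_. g i - g0 i)" | j where "j \<in> J" "z = xh X j" using z unfolding Zh_def by blast
  then show ?thesis
  proof cases
    case 1
    let ?Q = "q ^ (r * d * n)"
    obtain b where b: "\<forall>j\<in>J. filt Kh (Zh X) 0 (b j)" "(\<lambda>_. g i - g i ^ ?Q) = (\<Sum>j\<in>J. xh X j * b j)"
      using XI_g[of X, OF X 1(1)] unfolding XI_def by blast
    have "z - (\<Sum>j\<in>J. xh X j * b j) = z ^ ?Q"
      unfolding b(2)[symmetric] 1(2)
      by (rule ext) (simp add: fun_power_apply frob_diff[OF fr] g0_frob[OF 1(1)])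
    moreover have "filt Kh (Zh X) ?Q (z ^ ?Q)"
      using z Kh_subring is_subringD(1)[OF Kh_subring] by (intro filt_power filt.gen) auto
    then have "filt Kh (Zh X) 2 (z ^ ?Q)" using Q_ge_2 by (rule filt_mono)
    ultimately show ?thesis using b(1) by (intro exI[of _ b]) simp
  next
    case 2
    obtain b where b: "\<forall>j\<in>J. filt Kh (Zh X) 0 (b j)" "xh X j = (\<Sum>j\<in>J. xh X j * b j)"
      using XI_x[OF 2(1), of X] unfolding XI_def by blast
    from 2(2) b(2) have "z = (\<Sum>j\<in>J. xh X j * b j)" by (rule trans)
    then have "z - (\<Sum>j\<in>J. xh X j * b j) = 0" by (rule eq_iff_diff_eq_0[THEN iffD1])
    then have "filt Kh (Zh X) 2 (z - (\<Sum>j\<in>J. xh X j * b j))" by (simp only: filt.zero)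
    with b(1) show ?thesis by blast
  qed
qed

lemma filt_eval: "filt Kh (Zh X) l f \<Longrightarrow> filt k (Z (X b)) l (f b)"
  by (rule filt_hom[where h = "\<lambda>f. f b"]) (auto simp: Kh_def Zh_def Z_def xh_def)

text \<open>The etale part gives a monic equation of degree \<open>B\<close> for x j, and it is a
  pure power at \<open>g0\<close>, so the lower coefficients vanish there. The condition on
  parameters is \<open>Zh_param\<close> with \<open>x\<close> in both components.\<close>

lemma local_coords:
  assumes x: "basis x"
  shows "local_coords k I J g x g0 B"
proof
  show "is_subfield k" by (rule k_subfield)
  show "finite I" "finite J" "card I = card J" by (simp_all add: m_def)
  show "J \<noteq> {}" using m_pos by (simp add: lessThan_empty_iff)
  show "alg_indep k g I" using g_indep by (simp add: k_def)
  show "g0 i \<in> k" if "i \<in> I" for i using g0_k that .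
  have Zx: "(\<lambda>i. g i - g0 i) ` I \<union> x ` J = Z x" by (simp add: Z_def)
  show "\<exists>b. (\<forall>j\<in>J. filt k ((\<lambda>i. g i - g0 i) ` I \<union> x ` J) 0 (b j)) \<and>
      filt k ((\<lambda>i. g i - g0 i) ` I \<union> x ` J) 2 (g i - g0 i - (\<Sum>j\<in>J. x j * b j))" if i: "i \<in> I" for i
  proof -
    obtain b where b: "\<forall>j\<in>J. filt Kh (Zh (\<lambda>_. x)) 0 (b j)"
      "filt Kh (Zh (\<lambda>_. x)) 2 ((\<lambda>_. g i - g0 i) - (\<Sum>j\<in>J. xh (\<lambda>_. x) j * b j))"
      using Zh_param[of "\<lambda>_. x" "\<lambda>_. g i - g0 i"] x i unfolding Zh_def by blast
    have "\<forall>j\<in>J. filt k (Z x) 0 (b j True)" using b(1) filt_eval[of "\<lambda>_. x" 0 _ True] by blast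
    moreover have "filt k (Z x) 2 (g i - g0 i - (\<Sum>j\<in>J. x j * b j True))"
      using filt_eval[OF b(2), of True] by (simp add: fun_sum_apply xh_def)
    ultimately show ?thesis unfolding Zx by (intro exI[of _ "\<lambda>j. b j True"] conjI)
  qed
  show "\<exists>c. (\<forall>l<B. c l \<in> lifted k I g g0 \<and> [:0, 1:] dvd c l) \<and> x j ^ B = (\<Sum>l<B. poly (c l) 1 * x j ^ l)"
    if j: "j \<in> J" for j
  proof -
    let ?M = "n * m * d"
    \<comment> \<open>Coefficients of \<psi>_t along the line from \<open>g0\<close> at T = 0 to
      \<open>g\<close> at T = 1.\<close>
    define Gs where "Gs i = (if i = 0 then [:tb:] else if i < r then [:g0 i, g i - g0 i:] else if i = r then 1 else 0)" for i
    define u where "u l = dco (\<lambda>c. [:e c:]) q Gs (P ^ n) (l + n * d)" for l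
    \<comment> \<open>The equation has terms at powers of q only; the sum spreads the negated
      coefficients over all exponents t < B.\<close>
    define c where "c t = (\<Sum>l<?M. if t = q ^ l then - u l else 0)" for t
    have R: "is_subring (lifted k I g g0)" unfolding lifted_def by (rule subring_ring_hull)
    have cst: "[:y:] \<in> lifted k I g g0" if "y \<in> k" for y unfolding lifted_def using that by (intro ring_hull.base) auto
    have Gs: "Gs i \<in> lifted k I g g0" for i
    proof -
      have "[:g0 i, g i - g0 i:] \<in> lifted k I g g0" if "i \<in> I" unfolding lifted_def using that by (intro ring_hull.base) auto
      then show ?thesis using cst[OF tb_k] is_subringD(1,2)[OF R] by (auto simp: Gs_def)
    qed
    have uR: "u l \<in> lifted k I g g0" for l unfolding u_def using Gs cst[OF e_k] by (intro dco_subring[OF R])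
    have "(\<lambda>i. poly (Gs i) 1) = coefs g" "(\<lambda>i. poly (Gs i) 0) = coefs g0" by (auto simp: fun_eq_iff Gs_def coefs_def)
    then have u1: "poly (u l) 1 = cE n l" and u0: "poly (u l) 0 = dc g0 (P ^ n) (l + n * d)" for l
      by (simp_all add: u_def cE_def dco_poly)
    have dc0: "dc g0 (P ^ n) (l + n * d) = 0" if "l < ?M" for l
    proof -
      have eqx: "ev q (dc g0 (P ^ n)) (r * d * n) z = ev q (\<lambda>i. if i = r * d * n then 1 else 0) (r * d * n) z" for z
      proof -
        have "ev q (\<lambda>i. if i = r * d * n then 1 else 0) (r * d * n) z = (\<Sum>i\<le>r * d * n. if i = r * d * n then z ^ q ^ i else 0)"
          unfolding ev_def by (intro sum.cong) auto
        then show ?thesis using g0_act[of z] unfolding act_ev by (simp add: deg_P_pow ac_simps)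
      qed
      have "l + n * d \<le> r * d * n" using that idx[of n] by (simp add: ac_simps)
      then have "dc g0 (P ^ n) (l + n * d) = (if l + n * d = r * d * n then 1 else 0)"
        by (rule ev_unique[OF q1 eqx])
      moreover have "l + n * d \<noteq> r * d * n" using that idx[of n] by (simp add: ac_simps)
      ultimately show ?thesis by simp
    qed
    have "[:0, 1:] dvd u l" if "l < ?M" for l
      using u0[of l] dc0[OF that] poly_eq_0_iff_dvd[of "u l" 0] by simp
    then have "\<forall>t<B. c t \<in> lifted k I g g0 \<and> [:0, 1:] dvd c t" unfolding c_def using uR
      by (auto intro!: subring_sum[OF R] dvd_sum is_subringD(1,5)[OF R] simp del: One_nat_def)
    moreover have "x j ^ B = (\<Sum>t<B. poly (c t) 1 * x j ^ t)"
    proof -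
      have "(\<Sum>t<B. poly (c t) 1 * x j ^ t) = (\<Sum>t<B. \<Sum>l<?M. if t = q ^ l then - cE n l * x j ^ q ^ l else 0)"
        unfolding c_def poly_sum sum_distrib_right by (intro sum.cong refl) (auto simp: u1)
      also have "\<dots> = (\<Sum>l<?M. \<Sum>t<B. if t = q ^ l then - cE n l * x j ^ q ^ l else 0)" by (rule sum.swap)
      also have "\<dots> = (\<Sum>l<?M. - cE n l * x j ^ q ^ l)"
        using q1 by (intro sum.cong refl) (simp add: sum.delta power_strict_increasing)
      also have "\<dots> = - (\<Sum>l<?M. cE n l * x j ^ q ^ l)" by (simp add: sum_negf)
      finally have 1: "(\<Sum>t<B. poly (c t) 1 * x j ^ t) = - (\<Sum>l<?M. cE n l * x j ^ q ^ l)" .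
      have "0 = poly (Ep n) (x j)" using x j by (auto simp: basis_def V_def)
      also have "\<dots> = (\<Sum>l<?M. cE n l * x j ^ q ^ l) + x j ^ B"
        unfolding Ep_def poly_ap ev_def by (simp add: lessThan_Suc_atMost[symmetric] cE_top)
      finally have "(\<Sum>l<?M. cE n l * x j ^ q ^ l) + x j ^ B = 0" by simp
      then show ?thesis unfolding 1 by (simp add: eq_neg_iff_add_eq_0 add.commute)
    qed
    ultimately show ?thesis by blast
  qed
qed

lemma transfer:
  assumes X: "\<And>b. basis (X b)" and f: "filt Kh (Zh X) 0 f" and f0: "f b = 0"
  shows "f b' = 0"
proof -
  interpret T: local_coords k I J g "X b" g0 B by (rule local_coords[OF X])
  interpret F: local_coords k I J g "X b'" g0 B by (rule local_coords[OF X])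
  have "filt k (Z (X b')) l (f b')" for l
  proof -
    have xZ: "\<And>j. j \<in> J \<Longrightarrow> xh X j \<in> Zh X" by (auto simp: Zh_def)
    have "\<exists>c. (\<forall>e. c e \<in> Kh) \<and> filt Kh (Zh X) l (f - (\<Sum>e | e \<in> UNIV \<and> e \<in> exps J \<and> tdeg J e < l. c e * mpow J (xh X) e))"
      by (rule filt_expand[OF Kh_subring _ xZ _ f])
         (use filt_leading_form[OF Kh_subring _ xZ Zh_param[of X, OF X]] in auto)
    then obtain c where c: "\<And>e. c e \<in> Kh" "filt Kh (Zh X) l (f - (\<Sum>e | e \<in> exps J \<and> tdeg J e < l. c e * mpow J (xh X) e))"
      by auto
    \<comment> \<open>The coefficients of the expansion are diagonal pairs, so those that vanish in
      one component vanish in the other.\<close>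
    have cb: "c e b \<in> k" "c e b' = c e b" for e using c(1)[of e] by (auto simp: Kh_def)
    have "filt k (Z (X b)) l (- (\<Sum>e | e \<in> exps J \<and> tdeg J e < l. c e b * mpow J (X b) e))"
      using filt_eval[OF c(2), of b] f0 by (simp add: fun_sum_apply fun_mpow_apply xh_def)
    from filt_uminus[OF k_subring this]
    have "filt k (Z (X b)) l (\<Sum>e | e \<in> exps J \<and> tdeg J e < l. c e b * mpow J (X b) e)" by simp
    then have "c e b = 0" if "e \<in> exps J" "tdeg J e < l" for e
      using T.analytically_independent[of "\<lambda>e. c e b" l e, OF cb(1) _ that] unfolding Z_def by blast
    then have "(\<Sum>e | e \<in> exps J \<and> tdeg J e < l. c e b' * mpow J (X b') e) = 0"
      by (intro sum.neutral) (auto simp: cb(2))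
    then show ?thesis using filt_eval[OF c(2), of b'] by (simp add: fun_sum_apply fun_mpow_apply xh_def)
  qed
  then show ?thesis using F.krull unfolding Z_def by blast
qed

end

section \<open>The Galois group\<close>

lemma gen_field_subfield: "is_subfield (gen_field S)"
  unfolding gen_field_def is_subfield_def by blast

lemma gen_field_base: "S \<subseteq> gen_field S"
  unfolding gen_field_def by blast

lemma gen_field_least: "is_subfield F \<Longrightarrow> S \<subseteq> F \<Longrightarrow> gen_field S \<subseteq> F"
  unfolding gen_field_def by blast

lemma is_subfieldD:
  assumes "is_subfield F"
  shows "0 \<in> F" "1 \<in> F" "x \<in> F \<Longrightarrow> y \<in> F \<Longrightarrow> x + y \<in> F" "x \<in> F \<Longrightarrow> y \<in> F \<Longrightarrow> x * y \<in> F"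
    "x \<in> F \<Longrightarrow> - x \<in> F" "x \<in> F \<Longrightarrow> inverse x \<in> F"
  using assms unfolding is_subfield_def by blast+

context drinfeld
begin

definition L :: "'a set" where "L = gen_field (k \<union> g ` I)"
definition SF :: "'a set" where "SF = gen_field (L \<union> V)"

lemma L_subfield: "is_subfield L" unfolding L_def by (rule gen_field_subfield)

lemma SF_subfield: "is_subfield SF" unfolding SF_def by (rule gen_field_subfield)

lemma L_SF: "L \<subseteq> SF" unfolding SF_def using gen_field_base by blast

lemma V_SF: "V \<subseteq> SF" unfolding SF_def using gen_field_base by blast

lemma kg_L: "kg \<subseteq> L"
  unfolding kg_def using gen_field_base[of "k \<union> g ` I"]
  by (intro ring_hull_subset subfield_subring L_subfield) (simp add: L_def)

lemma kg_SF: "kg \<subseteq> SF" using kg_L L_SF by blast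

text \<open>The N-th power map is onto, so a polynomial is determined by its composite with it, and
  the description by \<open>THE\<close> fits \<open>Ep n\<close> only.\<close>

lemma drin_et_eq: "drin_et e (drin_t q r tb g) q P n = Ep n"
proof -
  have psit: "poly (drin_t q r tb g) x = \<Psi> g x" for x
  proof -
    have "{..r} = insert 0 (insert r {1..<r})" using r by auto
    then show ?thesis unfolding drin_t_def \<Psi>_def ev_def using r
      by (simp add: poly_sum poly_monom coefs_def)
  qed
  have it: "poly (((\<lambda>p. pcompose (drin_t q r tb g) p) ^^ i) [:0, 1:]) x = (\<Psi> g ^^ i) x" for i x
    by (induction i) (simp_all add: poly_pcompose psit)
  have drin: "poly (drin e (drin_t q r tb g) a) x = act g a x" for a x
    unfolding drin_def act_def Fq_module.act_def[OF module] by (simp add: poly_sum it)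
  have N': "q ^ (degree P * n) = q ^ (n * d)" by (simp add: d_def mult.commute)
  show ?thesis unfolding drin_et_def N'
  proof (rule the_equality)
    show "pcompose (Ep n) (monom 1 (q ^ (n * d))) = drin e (drin_t q r tb g) (P ^ n)"
      by (rule poly_eqI_infinite) (simp add: poly_pcompose poly_monom drin poly_Ep)
  next
    fix E assume E: "pcompose E (monom 1 (q ^ (n * d))) = drin e (drin_t q r tb g) (P ^ n)"
    show "E = Ep n"
    proof (rule poly_eqI_infinite)
      fix x :: 'a
      obtain y where y: "x = y ^ q ^ (n * d)" using surjD[OF bij_is_surj[OF frob_bij[of "n * d"]], of x] by blast
      have "poly E x = poly (pcompose E (monom 1 (q ^ (n * d)))) y" by (simp add: poly_pcompose poly_monom y)
      also have "\<dots> = poly (Ep n) x" unfolding E drin poly_Ep y ..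
      finally show "poly E x = poly (Ep n) x" .
    qed
  qed
qed

text \<open>Column convention: the j-th vector has coefficients M i j. It lets composition of
  automorphisms become the matrix product in the same order.\<close>

definition matc :: "(nat \<Rightarrow> 'a) \<Rightarrow> (nat \<Rightarrow> nat \<Rightarrow> 'f poly) \<Rightarrow> nat \<Rightarrow> 'a" where
  "matc x M j = comb x (\<lambda>i. M i j)"

lemma comb_V: "basis x \<Longrightarrow> comb x a \<in> V"
  unfolding basis_def comb_def by (auto intro!: V_sum V_act)

lemma comb_cong_mod: 
  assumes x: "basis x" and ab: "\<And>i. i < m \<Longrightarrow> P ^ n dvd a i - b i"
  shows "comb x a = comb x b"
proof -
  interpret A: Fq_module e "\<Psi> gN" by (rule module)
  have act: "act gN = A.act" by (simp add: act_def)
  have "act gN (a i) (x i) = act gN (b i) (x i)" if i: "i < m" for i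
  proof -
    obtain c where "a i - b i = c * P ^ n" using ab[OF i] by (metis dvdE mult.commute)
    then have "act gN (a i - b i) (x i) = act gN c (act gN (P ^ n) (x i))" by (simp add: act_mult)
    also have "act gN (P ^ n) (x i) = 0" using x i by (intro V_ann) (simp add: basis_def)
    finally show ?thesis by (simp add: act A.act_diff)
  qed
  then show ?thesis unfolding comb_def by simp
qed

lemma comb_comb:
  "comb (\<lambda>j. comb x (M j)) a = comb x (\<lambda>i. \<Sum>j<m. M j i * a j)"
proof -
  interpret A: Fq_module e "\<Psi> gN" by (rule module)
  have act: "act gN = A.act" by (simp add: act_def)
  have "comb (\<lambda>j. comb x (M j)) a = (\<Sum>j<m. \<Sum>i<m. act gN (a j * M j i) (x i))"
    unfolding comb_def act A.act_x_sum A.act_mult ..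
  also have "\<dots> = (\<Sum>i<m. \<Sum>j<m. act gN (M j i * a j) (x i))" by (subst sum.swap) (simp add: mult.commute)
  also have "\<dots> = comb x (\<lambda>i. \<Sum>j<m. M j i * a j)" unfolding comb_def act A.act_sum ..
  finally show ?thesis .
qed

section \<open>Bases and matrices modulo P ^ n\<close>

abbreviation "Qn \<equiv> P ^ n"

lemma mod_dvd: "Qn dvd a mod Qn - a" by (simp add: mod_eq_dvd_iff[symmetric])

lemma matc_mult:
  assumes x: "basis x" and j: "j < m"
  shows "comb (matc x M) (\<lambda>i. M' i j) = matc x (mat_mult_mod m Qn M M') j"
proof -
  have "comb (matc x M) (\<lambda>i. M' i j) = comb x (\<lambda>i. \<Sum>l<m. M i l * M' l j)"
    unfolding matc_def by (rule comb_comb)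
  also have "\<dots> = matc x (mat_mult_mod m Qn M M') j"
    unfolding matc_def
  proof (rule comb_cong_mod[OF x])
    fix i assume "i < m"
    then show "Qn dvd (\<Sum>l<m. M i l * M' l j) - mat_mult_mod m Qn M M' i j"
      using j mod_dvd[of "\<Sum>l<m. M i l * M' l j"] by (simp add: mat_mult_mod_def dvd_diff_commute)
  qed
  finally show ?thesis .
qed

lemma comb_unit:
  assumes "j < m" shows "comb x (\<lambda>i. if i = j then 1 else 0) = x j"
proof -
  interpret A: Fq_module e "\<Psi> gN" by (rule module)
  have "comb x (\<lambda>i. if i = j then 1 else 0) = (\<Sum>i<m. if i = j then x j else 0)"
    unfolding comb_def act_def by (intro sum.cong) auto
  then show ?thesis using assms by simp
qed

lemma matc_one: assumes x: "basis x" and j: "j < m" shows "matc x (mat_one_mod m Qn) j = x j"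
proof -
  have "matc x (mat_one_mod m Qn) j = comb x (\<lambda>i. if i = j then 1 else 0)"
    unfolding matc_def
  proof (rule comb_cong_mod[OF x])
    fix i assume "i < m"
    then show "Qn dvd mat_one_mod m Qn i j - (if i = j then 1 else 0)"
      using j mod_dvd[of 1] by (simp add: mat_one_mod_def)
  qed
  then show ?thesis using comb_unit[OF j] by simp
qed

text \<open>A relation with coefficient vector a between the new vectors means that M a vanishes
  modulo P ^ n; a left inverse of \<open>M\<close> then kills a.\<close>

lemma matc_basis:
  assumes x: "basis x" and M: "M \<in> carrier (GL_mod m Qn)"
  shows "basis (matc x M)"
proof -
  obtain M' where M': "mat_mult_mod m Qn M' M = mat_one_mod m Qn" using M by (auto simp: GL_mod_def)
  have "Qn dvd a l" if h: "(\<Sum>i<m. act gN (a i) (matc x M i)) = 0" and l: "l < m" for a l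
  proof -
    have "comb (matc x M) a = 0" using h by (simp add: comb_def)
    then have "comb x (\<lambda>i. \<Sum>j<m. M i j * a j) = 0" unfolding matc_def comb_comb .
    then have dv: "Qn dvd (\<Sum>j<m. M i j * a j)" if "i < m" for i
      using x that unfolding basis_def comb_def
      by (elim conjE allE[of _ "\<lambda>i. \<Sum>j<m. M i j * a j"]) blast
    have one: "Qn dvd (\<Sum>i<m. M' l i * M i j) - (if l = j then 1 else 0)" if j: "j < m" for j
    proof -
      have "(\<Sum>i<m. M' l i * M i j) mod Qn = (if l = j then 1 else 0) mod Qn"
        using fun_cong[OF fun_cong[OF M'], of l j] l j by (simp add: mat_mult_mod_def mat_one_mod_def)
      then show ?thesis by (simp add: mod_eq_dvd_iff)
    qed
    have "(\<Sum>i<m. M' l i * (\<Sum>j<m. M i j * a j)) = (\<Sum>j<m. (\<Sum>i<m. M' l i * M i j) * a j)"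
      unfolding sum_distrib_left sum_distrib_right by (subst sum.swap) (simp add: mult.assoc)
    moreover have "Qn dvd (\<Sum>i<m. M' l i * (\<Sum>j<m. M i j * a j))" using dv by (auto intro!: dvd_sum)
    moreover have "Qn dvd (\<Sum>j<m. ((\<Sum>i<m. M' l i * M i j) - (if l = j then 1 else 0)) * a j)"
      using one by (auto intro!: dvd_sum dvd_mult2)
    moreover have "(\<Sum>j<m. (if l = j then 1 else 0) * a j) = a l"
    proof -
      have "(\<Sum>j<m. (if l = j then 1 else 0) * a j) = (\<Sum>j<m. if j = l then a l else 0)" by (intro sum.cong) auto
      then show ?thesis using l by simp
    qed
    ultimately have "Qn dvd (\<Sum>j<m. (\<Sum>i<m. M' l i * M i j) * a j)"
      "Qn dvd (\<Sum>j<m. (\<Sum>i<m. M' l i * M i j) * a j) - a l"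
      by (simp_all add: left_diff_distrib sum_subtractf)
    from dvd_diff[OF this] show ?thesis by simp
  qed
  then show ?thesis unfolding basis_def using comb_V[OF x] by (auto simp: matc_def)
qed

lemma matc_inj:
  assumes x: "basis x" and M: "M \<in> mat_red m Qn" "M' \<in> mat_red m Qn" and eq: "\<And>j. j < m \<Longrightarrow> matc x M j = matc x M' j"
  shows "M = M'"
proof (intro ext)
  fix i j
  interpret A: Fq_module e "\<Psi> gN" by (rule module)
  show "M i j = M' i j"
  proof (cases "i < m \<and> j < m")
    case True
    have "(\<Sum>i<m. act gN (M i j - M' i j) (x i)) = 0"
      using eq[of j] True by (simp add: matc_def comb_def act_def A.act_diff sum_subtractf)
    then have "Qn dvd M i j - M' i j" using x True unfolding basis_def by (elim conjE allE[of _ "\<lambda>i. M i j - M' i j"]) blast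
    then have "M i j mod Qn = M' i j mod Qn" by (simp add: mod_eq_dvd_iff)
    moreover have "M i j = M i j mod Qn" "M' i j = M' i j mod Qn" using M unfolding mat_red_def by blast+
    ultimately show ?thesis by metis
  next
    case False
    then show ?thesis using M unfolding mat_red_def by auto
  qed
qed

lemma matc_exists:
  assumes x: "basis x" and y: "\<And>j. j < m \<Longrightarrow> y j \<in> V"
  shows "\<exists>M\<in>mat_red m Qn. \<forall>j<m. matc x M j = y j"
proof -
  have "\<forall>j. \<exists>a. j < m \<longrightarrow> a \<in> Rep \<and> comb x a = y j"
    using comb_bij[OF x] y unfolding bij_betw_def by (metis imageE)
  then obtain a where a: "\<And>j. j < m \<Longrightarrow> a j \<in> Rep" "\<And>j. j < m \<Longrightarrow> comb x (a j) = y j" by metis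
  define M where "M i j = (if i < m \<and> j < m then a j i else 0)" for i j
  have "M i j = M i j mod Qn" for i j
  proof (cases "i < m \<and> j < m")
    case True
    then have "degree (a j i) < degree Qn" using a(1)[of j] unfolding Rep_def deg_P_pow by auto
    then show ?thesis using True by (simp add: M_def mod_poly_less)
  qed (auto simp: M_def)
  then have "M \<in> mat_red m Qn" unfolding mat_red_def by (auto simp: M_def)
  moreover have "matc x M j = y j" if "j < m" for j
    using a(2)[OF that] that unfolding matc_def comb_def M_def by simp
  ultimately show ?thesis by blast
qed

section \<open>Action of the Galois group on the torsion module\<close>

lemma Gal_D:
  assumes "\<sigma> \<in> carrier (Gal SF L)"
  shows "bij_betw \<sigma> SF SF" "x \<in> SF \<Longrightarrow> y \<in> SF \<Longrightarrow> \<sigma> (x + y) = \<sigma> x + \<sigma> y"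
    "x \<in> SF \<Longrightarrow> y \<in> SF \<Longrightarrow> \<sigma> (x * y) = \<sigma> x * \<sigma> y" "x \<in> L \<Longrightarrow> \<sigma> x = x" "x \<notin> SF \<Longrightarrow> \<sigma> x = x"
    "x \<in> SF \<Longrightarrow> \<sigma> x \<in> SF"
  using assms by (auto simp: Gal_def bij_betw_def)

lemma SF_power: "x \<in> SF \<Longrightarrow> x ^ j \<in> SF"
  by (rule is_subringD(7)[OF subfield_subring[OF SF_subfield]])

lemma SF_sum: "(\<And>i. i \<in> A \<Longrightarrow> f i \<in> SF) \<Longrightarrow> (\<Sum>i\<in>A. f i) \<in> SF"
  by (rule subring_sum[OF subfield_subring[OF SF_subfield]])

lemma Gal_power:
  assumes s: "\<sigma> \<in> carrier (Gal SF L)" and x: "x \<in> SF"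
  shows "\<sigma> (x ^ j) = \<sigma> x ^ j"
proof (induction j)
  case 0 then show ?case using Gal_D(4)[OF s] is_subfieldD(2)[OF L_subfield] by simp
next
  case (Suc j)
  then show ?case using Gal_D(3)[OF s x SF_power[OF x, of j]] by simp
qed

lemma Gal_sum:
  assumes s: "\<sigma> \<in> carrier (Gal SF L)" and f: "\<And>i. i \<in> A \<Longrightarrow> f i \<in> SF"
  shows "\<sigma> (\<Sum>i\<in>A. f i) = (\<Sum>i\<in>A. \<sigma> (f i))"
  using f
proof (induction A rule: infinite_finite_induct)
  case (insert a A)
  then show ?case using Gal_D(2)[OF s, of "f a" "sum f A"] SF_sum[of A f] by simp
qed (use Gal_D(4)[OF s] is_subfieldD(1)[OF L_subfield] in auto)

lemma Gal_ev:
  assumes s: "\<sigma> \<in> carrier (Gal SF L)" and x: "x \<in> SF" and c: "\<And>j. c j \<in> L"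
  shows "\<sigma> (ev q c l x) = ev q c l (\<sigma> x)"
proof -
  have cS: "c j \<in> SF" for j using c L_SF by blast
  have "\<sigma> (ev q c l x) = (\<Sum>j\<le>l. \<sigma> (c j * x ^ q ^ j))"
    unfolding ev_def using cS x by (intro Gal_sum[OF s] is_subfieldD(4)[OF SF_subfield] SF_power)
  also have "\<dots> = ev q c l (\<sigma> x)"
    unfolding ev_def using cS x c
    by (intro sum.cong refl) (simp add: Gal_D(3)[OF s] SF_power Gal_power[OF s] Gal_D(4)[OF s])
  finally show ?thesis .
qed

lemma Gal_V: assumes s: "\<sigma> \<in> carrier (Gal SF L)" and x: "x \<in> V" shows "\<sigma> x \<in> V"
proof -
  have "cE n l \<in> L" for l unfolding cE_def using dc_kg kg_L by blast
  then have "ev q (cE n) (n * m * d) (\<sigma> x) = \<sigma> (ev q (cE n) (n * m * d) x)"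
    using Gal_ev[OF s] x V_SF by (metis subsetD)
  also have "ev q (cE n) (n * m * d) x = 0" using x by (simp add: V_def Ep_def poly_ap)
  also have "\<sigma> 0 = 0" using Gal_D(4)[OF s] is_subfieldD(1)[OF L_subfield] by blast
  finally show ?thesis by (simp add: V_def Ep_def poly_ap)
qed

text \<open>The coefficients of the twisted module lie in k[g], hence in \<open>L\<close>, so
  automorphisms over \<open>L\<close> are linear for its action.\<close>

lemma Gal_comb:
  assumes s: "\<sigma> \<in> carrier (Gal SF L)" and x: "basis x"
  shows "\<sigma> (comb x a) = comb (\<lambda>i. \<sigma> (x i)) a"
proof -
  have xV: "x i \<in> V" if "i < m" for i using x that by (simp add: basis_def)
  have "\<sigma> (comb x a) = (\<Sum>i<m. \<sigma> (act gN (a i) (x i)))"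
    unfolding comb_def using xV V_act V_SF by (intro Gal_sum[OF s]) blast
  also have "\<dots> = (\<Sum>i<m. act gN (a i) (\<sigma> (x i)))"
  proof (intro sum.cong refl)
    fix i assume "i \<in> {..<m}"
    then have "x i \<in> SF" using xV V_SF by blast
    moreover have "dc gN (a i) j \<in> L" for j using dc_kg kg_L by blast
    ultimately show "\<sigma> (act gN (a i) (x i)) = act gN (a i) (\<sigma> (x i))"
      unfolding act_ev by (intro Gal_ev[OF s])
  qed
  finally show ?thesis unfolding comb_def .
qed

lemma Gal_comp:
  assumes s: "\<sigma> \<in> carrier (Gal SF L)" and t: "\<tau> \<in> carrier (Gal SF L)"
  shows "\<sigma> \<circ> \<tau> \<in> carrier (Gal SF L)"
proof -
  have "bij_betw (\<sigma> \<circ> \<tau>) SF SF" using Gal_D(1)[OF t] Gal_D(1)[OF s] by (rule bij_betw_trans)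
  then show ?thesis unfolding Gal_def
    using Gal_D[OF s] Gal_D[OF t] by simp
qed

lemma Gal_inverse:
  assumes s: "\<sigma> \<in> carrier (Gal SF L)"
  shows "\<exists>\<tau>\<in>carrier (Gal SF L). \<sigma> \<circ> \<tau> = id \<and> \<tau> \<circ> \<sigma> = id"
proof -
  define \<tau> where "\<tau> y = (if y \<in> SF then inv_into SF \<sigma> y else y)" for y
  have b: "bij_betw \<sigma> SF SF" by (rule Gal_D(1)[OF s])
  have \<tau>S: "\<tau> y \<in> SF" "\<sigma> (\<tau> y) = y" if "y \<in> SF" for y
    using b that unfolding \<tau>_def bij_betw_def by (auto intro: inv_into_into f_inv_into_f)
  have \<sigma>\<tau>: "\<tau> (\<sigma> y) = y" if "y \<in> SF" for y
    using b that Gal_D(6)[OF s that] unfolding \<tau>_def bij_betw_def by (simp add: inv_into_f_f)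
  have inj: "y = z" if "\<sigma> y = \<sigma> z" "y \<in> SF" "z \<in> SF" for y z using \<sigma>\<tau> that by metis
  have 1: "\<tau> (y + z) = \<tau> y + \<tau> z" "\<tau> (y * z) = \<tau> y * \<tau> z" if "y \<in> SF" "z \<in> SF" for y z
  proof -
    have S: "\<tau> y + \<tau> z \<in> SF" "\<tau> y * \<tau> z \<in> SF" "y + z \<in> SF" "y * z \<in> SF"
      using that \<tau>S(1) is_subfieldD(3,4)[OF SF_subfield] by blast+
    show "\<tau> (y + z) = \<tau> y + \<tau> z"
      by (rule inj) (simp_all add: that S \<tau>S Gal_D(2)[OF s])
    show "\<tau> (y * z) = \<tau> y * \<tau> z"
      by (rule inj) (simp_all add: that S \<tau>S Gal_D(3)[OF s])
  qed
  have 2: "\<tau> y = y" if "y \<in> L" for y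
    using \<sigma>\<tau>[of y] Gal_D(4)[OF s that] that L_SF by auto
  have 3: "bij_betw \<tau> SF SF"
    by (rule bij_betw_byWitness[where f' = \<sigma>]) (use \<tau>S \<sigma>\<tau> Gal_D(6)[OF s] in auto)
  have "\<tau> \<in> carrier (Gal SF L)" unfolding Gal_def using 1 2 3 by (simp add: \<tau>_def)
  moreover have "\<sigma> \<circ> \<tau> = id"
  proof
    fix y show "(\<sigma> \<circ> \<tau>) y = id y" using \<tau>S Gal_D(5)[OF s] by (cases "y \<in> SF") (auto simp: \<tau>_def)
  qed
  moreover have "\<tau> \<circ> \<sigma> = id"
  proof
    fix y show "(\<tau> \<circ> \<sigma>) y = id y" using \<sigma>\<tau> Gal_D(5)[OF s] by (cases "y \<in> SF") (auto simp: \<tau>_def)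
  qed
  ultimately show ?thesis by blast
qed

text \<open>The set where two automorphisms agree is a subfield containing \<open>L\<close> and, by
  linearity, \<open>V\<close>.\<close>

lemma Gal_ext:
  assumes s: "\<sigma> \<in> carrier (Gal SF L)" and t: "\<tau> \<in> carrier (Gal SF L)" and x: "basis x"
    and eq: "\<And>j. j < m \<Longrightarrow> \<sigma> (x j) = \<tau> (x j)"
  shows "\<sigma> = \<tau>"
proof
  fix y
  let ?F = "{y \<in> SF. \<sigma> y = \<tau> y}"
  have "is_subfield ?F" unfolding is_subfield_def
  proof (intro conjI ballI)
    show "0 \<in> ?F" "1 \<in> ?F"
      using is_subfieldD(1,2)[OF SF_subfield] is_subfieldD(1,2)[OF L_subfield] Gal_D(4)[OF s] Gal_D(4)[OF t] by auto
  next
    fix y z assume yz: "y \<in> ?F" "z \<in> ?F"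
    then show "y + z \<in> ?F" "y * z \<in> ?F"
      using is_subfieldD(3,4)[OF SF_subfield] Gal_D(2,3)[OF s, of y z] Gal_D(2,3)[OF t, of y z] by auto
  next
    fix y assume y: "y \<in> ?F"
    have neg1: "- 1 \<in> L" using is_subfieldD(2,5)[OF L_subfield] by blast
    have "- y \<in> SF" "inverse y \<in> SF" using y is_subfieldD(5,6)[OF SF_subfield] by auto
    moreover have "\<sigma> (- y) = \<tau> (- y)"
      using Gal_D(3)[OF s, of "- 1" y] Gal_D(3)[OF t, of "- 1" y] y Gal_D(4)[OF s neg1] Gal_D(4)[OF t neg1] neg1 L_SF by auto
    moreover have "\<sigma> (inverse y) = \<tau> (inverse y)"
    proof (cases "y = 0")
      case True
      then show ?thesis using y by simp
    next
      case False
      have u: "\<rho> (inverse y) = inverse (\<rho> y)" if r: "\<rho> \<in> carrier (Gal SF L)" for \<rho>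
      proof -
        have "\<rho> y * \<rho> (inverse y) = \<rho> (y * inverse y)" using y \<open>inverse y \<in> SF\<close> Gal_D(3)[OF r] by simp
        also have "\<dots> = 1" using False Gal_D(4)[OF r] is_subfieldD(2)[OF L_subfield] by simp
        finally show ?thesis by (metis inverse_unique)
      qed
      show ?thesis using u[OF s] u[OF t] y by simp
    qed
    ultimately show "- y \<in> ?F" "inverse y \<in> ?F" by auto
  qed
  moreover have "L \<subseteq> ?F" using L_SF Gal_D(4)[OF s] Gal_D(4)[OF t] by auto
  moreover have "V \<subseteq> ?F"
  proof
    fix v assume v: "v \<in> V"
    then obtain a where a: "v = comb x a" using comb_bij[OF x] unfolding bij_betw_def by (metis imageE)
    have "\<sigma> v = \<tau> v" unfolding a Gal_comb[OF s x] Gal_comb[OF t x] unfolding comb_def using eq by simp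
    then show "v \<in> ?F" using v V_SF by blast
  qed
  ultimately have "SF \<subseteq> ?F" unfolding SF_def[symmetric] using gen_field_least[of ?F "L \<union> V"] by (simp add: SF_def)
  then show "\<sigma> y = \<tau> y" using Gal_D(5)[OF s] Gal_D(5)[OF t] by (cases "y \<in> SF") auto
qed

end

section \<open>Automorphisms from the ring of pairs\<close>

context supersingular
begin

text \<open>Graph of the automorphism to be built, which carries the basis \<open>X True\<close> to
  \<open>X False\<close>. Diagonal denominators from k[g] suffice for a field, by
  \<open>\<Gamma>_inverse\<close>.\<close>

definition \<Gamma> :: "(bool \<Rightarrow> nat \<Rightarrow> 'a) \<Rightarrow> ('a \<times> 'a) set" where
  "\<Gamma> X = {(f True / h, f False / h) | f h. filt Kh (Zh X) 0 f \<and> h \<in> kg \<and> h \<noteq> 0}"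

lemma \<Gamma>_I: "filt Kh (Zh X) 0 f \<Longrightarrow> h \<in> kg \<Longrightarrow> h \<noteq> 0 \<Longrightarrow> (f True / h, f False / h) \<in> \<Gamma> X"
  unfolding \<Gamma>_def by blast

lemma \<Gamma>_I1: "filt Kh (Zh X) 0 f \<Longrightarrow> (f True, f False) \<in> \<Gamma> X"
  using \<Gamma>_I[of X f 1] is_subringD(2)[OF kg_subring] by simp

lemma \<Gamma>_converse: "(y, z) \<in> \<Gamma> X \<longleftrightarrow> (z, y) \<in> \<Gamma> (\<lambda>b. X (\<not> b))"
proof -
  have sw: "filt Kh (Zh (\<lambda>b. X (\<not> b))) 0 (\<lambda>b. f (\<not> b))" if "filt Kh (Zh X) 0 f" for f X
    using that by (rule filt_hom[where h = "\<lambda>f b. f (\<not> b)", rotated -1]) (auto simp: Kh_def Zh_def xh_def fun_eq_iff)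
  have "(z, y) \<in> \<Gamma> (\<lambda>b. X (\<not> b))" if yz: "(y, z) \<in> \<Gamma> X" for y z X
  proof -
    obtain f h where f: "filt Kh (Zh X) 0 f" "h \<in> kg" "h \<noteq> 0" "y = f True / h" "z = f False / h"
      using yz unfolding \<Gamma>_def by blast
    then show ?thesis using \<Gamma>_I[OF sw[OF f(1)] f(2,3)] by simp
  qed
  from this[of y z X] this[of z y "\<lambda>b. X (\<not> b)"] show ?thesis by auto
qed

context
  fixes X :: "bool \<Rightarrow> nat \<Rightarrow> 'a"
  assumes X: "\<And>b. basis (X b)"
begin

lemma \<Gamma>_zero: "(0, y) \<in> \<Gamma> X \<Longrightarrow> y = 0"
proof -
  assume "(0, y) \<in> \<Gamma> X"
  then obtain f h where f: "filt Kh (Zh X) 0 f" "h \<noteq> 0" "0 = f True / h" "y = f False / h" unfolding \<Gamma>_def by blast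
  then have "f True = 0" by simp
  then have "f False = 0" by (rule transfer[OF X f(1)])
  then show "y = 0" using f by simp
qed

lemma \<Gamma>_ring:
  assumes "(y, y') \<in> \<Gamma> X" "(z, z') \<in> \<Gamma> X"
  shows "(y + z, y' + z') \<in> \<Gamma> X" "(y * z, y' * z') \<in> \<Gamma> X" "(- y, - y') \<in> \<Gamma> X"
proof -
  obtain f h f2 h2 where f: "filt Kh (Zh X) 0 f" "h \<in> kg" "h \<noteq> 0" "y = f True / h" "y' = f False / h"
    "filt Kh (Zh X) 0 f2" "h2 \<in> kg" "h2 \<noteq> 0" "z = f2 True / h2" "z' = f2 False / h2"
    using assms unfolding \<Gamma>_def by blast
  have hh: "h * h2 \<in> kg" "h * h2 \<noteq> 0" using f is_subringD(4)[OF kg_subring] by auto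
  have "filt Kh (Zh X) 0 (f * (\<lambda>_. h2) + f2 * (\<lambda>_. h))"
    using f by (intro filt.add filt_mult_left[OF Kh_subring] kg_filt)
  from \<Gamma>_I[OF this hh] show "(y + z, y' + z') \<in> \<Gamma> X" using f by (simp add: add_frac_eq)
  have "filt Kh (Zh X) 0 (f * f2)" using f by (intro filt_mult_left[OF Kh_subring])
  from \<Gamma>_I[OF this hh] show "(y * z, y' * z') \<in> \<Gamma> X" using f by simp
  from \<Gamma>_I[OF filt_uminus[OF Kh_subring f(1)] f(2,3)] show "(- y, - y') \<in> \<Gamma> X" using f by simp
qed

lemma \<Gamma>_const: "c \<in> kg \<Longrightarrow> (c, c) \<in> \<Gamma> X"
  using \<Gamma>_I1[OF kg_filt] by simp

lemma \<Gamma>_unique: "(y, z) \<in> \<Gamma> X \<Longrightarrow> (y, z') \<in> \<Gamma> X \<Longrightarrow> z = z'"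
  using \<Gamma>_ring(1)[OF _ \<Gamma>_ring(3), of y z y z' y z'] \<Gamma>_zero[of "z - z'"] by simp

text \<open>Carries a cofactor found in one field over to the ring of pairs.\<close>

lemma filt_lift: "filt k (Z (X True)) l y \<Longrightarrow> \<exists>f. filt Kh (Zh X) l f \<and> f True = y"
proof (induction rule: filt.induct)
  case (const c)
  then show ?case by (intro exI[of _ "\<lambda>_. c"]) (auto intro: filt.const simp: Kh_def)
next
  case (gen z)
  then consider i where "i \<in> I" "z = g i - g0 i" | j where "j \<in> J" "z = X True j" unfolding Z_def by blast
  then show ?case
  proof cases
    case 1
    then show ?thesis by (intro exI[of _ "\<lambda>_. g i - g0 i"] conjI filt.gen) (auto simp: Zh_def)
  next
    case 2
    have "xh X j \<in> Zh X" using 2(1) unfolding Zh_def by blast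
    moreover have "xh X j True = z" using 2(2) by (simp add: xh_def)
    ultimately show ?thesis by (blast intro: filt.gen)
  qed
next
  case (zero l) then show ?case by (intro exI[of _ 0] conjI filt.zero) simp
next
  case (add l x y)
  then obtain f f' where "filt Kh (Zh X) l f" "f True = x" "filt Kh (Zh X) l f'" "f' True = y" by blast
  then show ?case by (intro exI[of _ "f + f'"] conjI filt.add) simp_all
next
  case (mult l x l' y)
  then obtain f f' where "filt Kh (Zh X) l f" "f True = x" "filt Kh (Zh X) l' f'" "f' True = y" by blast
  then show ?case by (intro exI[of _ "f * f'"] conjI filt.mult) simp_all
next
  case (weaken l x) then show ?case by (auto intro: filt.weaken)
qed

lemma local_kg: "local_coords.kg k I g g0 = kg"
proof -
  interpret T: local_coords k I J g "X True" g0 B by (rule local_coords[OF X])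
  let ?R = "lifted k I g g0"
  show ?thesis
  proof
    show "T.kg \<subseteq> kg"
    proof
      fix y assume "y \<in> T.kg"
      then obtain F where F: "F \<in> ?R" "y = poly F 1" unfolding T.kg_def by blast
      from F(1) have "poly F 1 \<in> kg" unfolding lifted_def
        by (induction rule: ring_hull.induct) (auto simp: k_kg g_kg is_subringD[OF kg_subring] simp del: One_nat_def)
      then show "y \<in> kg" using F by simp
    qed
    show "kg \<subseteq> T.kg" unfolding kg_def
    proof (rule ring_hull_subset[OF T.kg_subring], safe)
      fix c assume "c \<in> k"
      then show "c \<in> T.kg" using T.kg_I[OF T.Kt_const, of c] by simp
    next
      fix i assume "i \<in> I"
      then show "g i \<in> T.kg" using T.kg_I[OF T.Kt_gen, of i] by simp
    qed
  qed
qed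

text \<open>In the first field the numerator has a cofactor v whose product with it is some nonzero
  \<gamma> in k[g]. After lifting v to a pair, this identity passes to the second component by
  \<open>transfer\<close>, and h v / \<gamma> is the inverse in both.\<close>

lemma \<Gamma>_inverse:
  assumes yz: "(y, z) \<in> \<Gamma> X"
  shows "(inverse y, inverse z) \<in> \<Gamma> X"
proof (cases "y = 0")
  case True
  then have "z = 0" using \<Gamma>_zero yz by simp
  then show ?thesis using yz True by simp
next
  case False
  interpret T: local_coords k I J g "X True" g0 B by (rule local_coords[OF X])
  obtain f h where f: "filt Kh (Zh X) 0 f" "h \<in> kg" "h \<noteq> 0" "y = f True / h" "z = f False / h"
    using yz unfolding \<Gamma>_def by blast
  have fT: "filt k T.Z 0 (f True)" using filt_eval[OF f(1), of True] by (simp add: Z_def)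
  moreover have "f True \<noteq> 0" using False f by auto
  ultimately obtain v \<gamma> where v: "filt k T.Z 0 v" "\<gamma> \<in> T.kg" "\<gamma> \<noteq> 0" "f True * v = \<gamma>"
    using T.algebraic_cofactor by blast
  have \<gamma>: "\<gamma> \<in> kg" using v(2) local_kg by simp
  obtain w where w: "filt Kh (Zh X) 0 w" "w True = v" using filt_lift[of 0 v] v(1) by (auto simp: Z_def)
  have "filt Kh (Zh X) 0 (f * w - (\<lambda>_. \<gamma>))"
    using f(1) w(1) \<gamma> by (intro filt_diff[OF Kh_subring] filt_mult_left[OF Kh_subring] kg_filt)
  moreover have "(f * w - (\<lambda>_. \<gamma>)) True = 0" using v w by simp
  ultimately have "(f * w - (\<lambda>_. \<gamma>)) False = 0" by (rule transfer[OF X])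
  then have F: "f False * w False = \<gamma>" by simp
  have "filt Kh (Zh X) 0 ((\<lambda>_. h) * w)" using f w by (intro filt_mult_left[OF Kh_subring] kg_filt)
  from \<Gamma>_I[OF this \<gamma> v(3)] have "(h * v / \<gamma>, h * w False / \<gamma>) \<in> \<Gamma> X" by (simp add: w)
  moreover have "h * v / \<gamma> = inverse y"
    using v(3) by (simp add: f(4) v(4)[symmetric])
  moreover have "h * w False / \<gamma> = inverse z"
  proof -
    have "w False \<noteq> 0" using F v(3) by auto
    then show ?thesis by (simp add: f(5) F[symmetric])
  qed
  ultimately show ?thesis by simp
qed

lemma \<Gamma>_L: "c \<in> L \<Longrightarrow> (c, c) \<in> \<Gamma> X"
proof -
  have "is_subfield {c. (c, c) \<in> \<Gamma> X}" unfolding is_subfield_def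
    using \<Gamma>_ring \<Gamma>_inverse \<Gamma>_const is_subringD(1,2)[OF kg_subring] by auto
  moreover have "k \<union> g ` I \<subseteq> {c. (c, c) \<in> \<Gamma> X}" using \<Gamma>_const k_kg g_kg by auto
  ultimately have "L \<subseteq> {c. (c, c) \<in> \<Gamma> X}" unfolding L_def by (rule gen_field_least)
  then show "c \<in> L \<Longrightarrow> (c, c) \<in> \<Gamma> X" by blast
qed

lemma \<Gamma>_comb: "(comb (X True) a, comb (X False) a) \<in> \<Gamma> X"
  using \<Gamma>_I1[OF XI_filt[OF XI_comb]] by simp

lemma \<Gamma>_domain: "SF \<subseteq> Domain (\<Gamma> X)"
  unfolding SF_def
proof (rule gen_field_least)
  show "is_subfield (Domain (\<Gamma> X))" unfolding is_subfield_def
  proof (intro conjI ballI)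
    show "0 \<in> Domain (\<Gamma> X)" "1 \<in> Domain (\<Gamma> X)" using \<Gamma>_const is_subringD(1,2)[OF kg_subring] by blast+
  next
    fix y z assume "y \<in> Domain (\<Gamma> X)" "z \<in> Domain (\<Gamma> X)"
    then show "y + z \<in> Domain (\<Gamma> X)" "y * z \<in> Domain (\<Gamma> X)" using \<Gamma>_ring by blast+
  next
    fix y assume "y \<in> Domain (\<Gamma> X)"
    then show "- y \<in> Domain (\<Gamma> X)" "inverse y \<in> Domain (\<Gamma> X)" using \<Gamma>_ring \<Gamma>_inverse by blast+
  qed
  have "V \<subseteq> Domain (\<Gamma> X)"
  proof
    fix v assume "v \<in> V"
    then obtain a where "v = comb (X True) a" using comb_bij[OF X, of True] unfolding bij_betw_def by (metis imageE)
    then show "v \<in> Domain (\<Gamma> X)" using \<Gamma>_comb by blast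
  qed
  then show "L \<union> V \<subseteq> Domain (\<Gamma> X)" using \<Gamma>_L by blast
qed

lemma \<Gamma>_range: "(y, z) \<in> \<Gamma> X \<Longrightarrow> z \<in> SF"
proof -
  assume "(y, z) \<in> \<Gamma> X"
  then obtain f h where f: "filt Kh (Zh X) 0 f" "h \<in> kg" "h \<noteq> 0" "z = f False / h" unfolding \<Gamma>_def by blast
  have R: "is_subring SF" by (rule subfield_subring[OF SF_subfield])
  have "\<And>l y. filt k (Z (X False)) l y \<Longrightarrow> y \<in> SF"
  proof -
    fix l y assume "filt k (Z (X False)) l y"
    then show "y \<in> SF"
    proof (induction rule: filt.induct)
      case (const c) then show ?case using k_kg kg_SF by blast
    next
      case (gen z)
      have "X False j \<in> SF" if "j \<in> J" for j using X[of False] that V_SF unfolding basis_def by auto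
      moreover have "g i - g0 i \<in> SF" if "i \<in> I" for i
        using that g_kg k_kg[OF g0_k] kg_SF is_subringD(6)[OF R] by blast
      ultimately show ?case using gen unfolding Z_def by blast
    qed (auto intro: is_subringD[OF R])
  qed
  then have "f False \<in> SF" using filt_eval[OF f(1), of False] by blast
  moreover have "inverse h \<in> SF" using f kg_SF is_subfieldD(6)[OF SF_subfield] by blast
  ultimately show "z \<in> SF" unfolding f(4) divide_inverse by (rule is_subringD(4)[OF R])
qed

end

text \<open>\<open>transfer\<close> makes \<Gamma> single valued, and closure under field operations
  puts \<open>SF\<close> into its domain. Exchanging the bases gives the converse relation, which
  supplies injectivity and surjectivity.\<close>

lemma automorphism_exists:
  assumes x: "basis x" and x': "basis x'"
  shows "\<exists>\<sigma>\<in>carrier (Gal SF L). \<forall>j<m. \<sigma> (x j) = x' j"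
proof -
  define X where "X b = (if b then x else x')" for b
  have X: "basis (X b)" for b using x x' by (simp add: X_def)
  have X': "basis (X (\<not> b))" for b by (rule X)
  note ring = \<Gamma>_ring[of X, OF X] and dom = \<Gamma>_domain[of X, OF X] and uniq = \<Gamma>_unique[of X, OF X]
    and rng = \<Gamma>_range[of X, OF X]
  define \<sigma> where "\<sigma> y = (if y \<in> SF then THE z. (y, z) \<in> \<Gamma> X else y)" for y
  have \<sigma>: "(y, \<sigma> y) \<in> \<Gamma> X" if y: "y \<in> SF" for y
  proof -
    obtain z where "(y, z) \<in> \<Gamma> X" using dom y by blast
    then show ?thesis unfolding \<sigma>_def using y uniq by (simp add: theI[of "\<lambda>z. (y, z) \<in> \<Gamma> X" z])
  qed
  have \<sigma>_eq: "\<sigma> y = z" if "y \<in> SF" "(y, z) \<in> \<Gamma> X" for y z using uniq[OF \<sigma>[OF that(1)] that(2)] .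
  have \<sigma>_SF: "\<sigma> y \<in> SF" if "y \<in> SF" for y using rng[OF \<sigma>[OF that]] .
  have "bij_betw \<sigma> SF SF" unfolding bij_betw_def
  proof
    show "inj_on \<sigma> SF"
    proof (rule inj_onI)
      fix y z assume yz: "y \<in> SF" "z \<in> SF" "\<sigma> y = \<sigma> z"
      have "(\<sigma> y, y) \<in> \<Gamma> (\<lambda>b. X (\<not> b))" "(\<sigma> y, z) \<in> \<Gamma> (\<lambda>b. X (\<not> b))"
        using \<sigma>[OF yz(1)] \<sigma>[OF yz(2)] yz(3) \<Gamma>_converse by metis+
      then show "y = z" by (rule \<Gamma>_unique[of "\<lambda>b. X (\<not> b)", OF X'])
    qed
    show "\<sigma> ` SF = SF"
    proof (intro subset_antisym subsetI)
      fix z assume z: "z \<in> SF"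
      then obtain y where "(z, y) \<in> \<Gamma> (\<lambda>b. X (\<not> b))" using \<Gamma>_domain[of "\<lambda>b. X (\<not> b)", OF X'] by blast
      moreover from this have "y \<in> SF" by (rule \<Gamma>_range[of "\<lambda>b. X (\<not> b)", OF X'])
      ultimately show "z \<in> \<sigma> ` SF" using \<sigma>_eq[of y z] \<Gamma>_converse[of y z X] by blast
    qed (use \<sigma>_SF in blast)
  qed
  moreover have "\<sigma> (y + z) = \<sigma> y + \<sigma> z" "\<sigma> (y * z) = \<sigma> y * \<sigma> z" if "y \<in> SF" "z \<in> SF" for y z
    using that is_subfieldD(3,4)[OF SF_subfield that] ring[OF \<sigma>[OF that(1)] \<sigma>[OF that(2)]] \<sigma>_eq by blast+
  moreover have "\<sigma> y = y" if "y \<in> L" for y using \<sigma>_eq \<Gamma>_L[of X, OF X that] that L_SF by blast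
  ultimately have "\<sigma> \<in> carrier (Gal SF L)" unfolding Gal_def by (simp add: \<sigma>_def)
  moreover have "\<sigma> (x j) = x' j" if j: "j < m" for j
  proof (rule \<sigma>_eq)
    show "x j \<in> SF" using x j V_SF unfolding basis_def by blast
    show "(x j, x' j) \<in> \<Gamma> X"
      using \<Gamma>_comb[of X, OF X, of "\<lambda>i. if i = j then 1 else 0"] by (simp add: comb_unit[OF j] X_def)
  qed
  ultimately show ?thesis by blast
qed

text \<open>Send an automorphism to its matrix in a fixed basis. The image of the basis determines
  the automorphism, and an invertible matrix produces another basis, hence an automorphism by
  \<open>automorphism_exists\<close>.\<close>

theorem Gal_iso_GL: "Gal SF L \<cong> GL_mod m Qn"
proof -
  obtain x where x: "basis x" using basis_exists by blast
  have xV: "x j \<in> V" if "j < m" for j using x that by (simp add: basis_def)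
  define \<mu> where "\<mu> \<sigma> = (THE M. M \<in> mat_red m Qn \<and> (\<forall>j<m. matc x M j = \<sigma> (x j)))" for \<sigma>
  have \<mu>: "\<mu> \<sigma> \<in> mat_red m Qn" "\<And>j. j < m \<Longrightarrow> matc x (\<mu> \<sigma>) j = \<sigma> (x j)" if s: "\<sigma> \<in> carrier (Gal SF L)" for \<sigma>
  proof -
    obtain M where M: "M \<in> mat_red m Qn" "\<forall>j<m. matc x M j = \<sigma> (x j)"
      using matc_exists[OF x, of "\<lambda>j. \<sigma> (x j)"] Gal_V[OF s xV] by blast
    have "\<mu> \<sigma> \<in> mat_red m Qn \<and> (\<forall>j<m. matc x (\<mu> \<sigma>) j = \<sigma> (x j))" unfolding \<mu>_def
    proof (rule theI[of _ M])
      show "M \<in> mat_red m Qn \<and> (\<forall>j<m. matc x M j = \<sigma> (x j))" using M by blast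
      fix M' assume "M' \<in> mat_red m Qn \<and> (\<forall>j<m. matc x M' j = \<sigma> (x j))"
      then show "M' = M" using M by (intro matc_inj[OF x]) auto
    qed
    then show "\<mu> \<sigma> \<in> mat_red m Qn" "\<And>j. j < m \<Longrightarrow> matc x (\<mu> \<sigma>) j = \<sigma> (x j)" by blast+
  qed
  have mult_red: "mat_mult_mod m Qn M M' \<in> mat_red m Qn" for M M' by (auto simp: mat_red_def mat_mult_mod_def)
  have one_red: "mat_one_mod m Qn \<in> mat_red m Qn" by (auto simp: mat_red_def mat_one_mod_def)
  have \<mu>_comp: "\<mu> (\<sigma> \<circ> \<tau>) = mat_mult_mod m Qn (\<mu> \<sigma>) (\<mu> \<tau>)"
    if s: "\<sigma> \<in> carrier (Gal SF L)" and t: "\<tau> \<in> carrier (Gal SF L)" for \<sigma> \<tau>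
  proof (rule matc_inj[OF x \<mu>(1)[OF Gal_comp[OF s t]] mult_red])
    fix j assume j: "j < m"
    have "matc x (\<mu> (\<sigma> \<circ> \<tau>)) j = \<sigma> (\<tau> (x j))" using \<mu>(2)[OF Gal_comp[OF s t] j] by simp
    also have "\<tau> (x j) = comb x (\<lambda>i. \<mu> \<tau> i j)" using \<mu>(2)[OF t j] by (simp add: matc_def)
    also have "\<sigma> \<dots> = comb (\<lambda>i. \<sigma> (x i)) (\<lambda>i. \<mu> \<tau> i j)" by (rule Gal_comb[OF s x])
    also have "\<dots> = comb (matc x (\<mu> \<sigma>)) (\<lambda>i. \<mu> \<tau> i j)" unfolding comb_def using \<mu>(2)[OF s] by simp
    also have "\<dots> = matc x (mat_mult_mod m Qn (\<mu> \<sigma>) (\<mu> \<tau>)) j" by (rule matc_mult[OF x j])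
    finally show "matc x (\<mu> (\<sigma> \<circ> \<tau>)) j = matc x (mat_mult_mod m Qn (\<mu> \<sigma>) (\<mu> \<tau>)) j" .
  qed
  have id: "id \<in> carrier (Gal SF L)" by (auto simp: Gal_def)
  have \<mu>_id: "\<mu> id = mat_one_mod m Qn"
    by (rule matc_inj[OF x \<mu>(1)[OF id] one_red]) (simp add: \<mu>(2)[OF id] matc_one[OF x])
  have \<mu>_GL: "\<mu> \<sigma> \<in> carrier (GL_mod m Qn)" if s: "\<sigma> \<in> carrier (Gal SF L)" for \<sigma>
  proof -
    obtain \<tau> where t: "\<tau> \<in> carrier (Gal SF L)" "\<sigma> \<circ> \<tau> = id" "\<tau> \<circ> \<sigma> = id" using Gal_inverse[OF s] by blast
    have "mat_mult_mod m Qn (\<mu> \<sigma>) (\<mu> \<tau>) = mat_one_mod m Qn" "mat_mult_mod m Qn (\<mu> \<tau>) (\<mu> \<sigma>) = mat_one_mod m Qn"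
      using \<mu>_comp[OF s t(1)] \<mu>_comp[OF t(1) s] t \<mu>_id by simp_all
    then show ?thesis using \<mu>(1)[OF s] \<mu>(1)[OF t(1)] by (auto simp: GL_mod_def)
  qed
  have "\<mu> \<in> hom (Gal SF L) (GL_mod m Qn)"
    using \<mu>_GL \<mu>_comp by (auto simp: hom_def Gal_def GL_mod_def)
  moreover have "bij_betw \<mu> (carrier (Gal SF L)) (carrier (GL_mod m Qn))"
    unfolding bij_betw_def
  proof
    show "inj_on \<mu> (carrier (Gal SF L))"
    proof (rule inj_onI)
      fix \<sigma> \<tau> assume st: "\<sigma> \<in> carrier (Gal SF L)" "\<tau> \<in> carrier (Gal SF L)" "\<mu> \<sigma> = \<mu> \<tau>"
      then show "\<sigma> = \<tau>" using \<mu>(2) by (intro Gal_ext[OF st(1,2) x]) metis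
    qed
    show "\<mu> ` carrier (Gal SF L) = carrier (GL_mod m Qn)"
    proof (intro subset_antisym subsetI)
      fix M assume M: "M \<in> carrier (GL_mod m Qn)"
      obtain \<sigma> where s: "\<sigma> \<in> carrier (Gal SF L)" "\<forall>j<m. \<sigma> (x j) = matc x M j"
        using automorphism_exists[OF x matc_basis[OF x M]] by blast
      have "M \<in> mat_red m Qn" using M by (auto simp: GL_mod_def)
      then have "\<mu> \<sigma> = M" using s \<mu>[OF s(1)] by (intro matc_inj[OF x]) auto
      then show "M \<in> \<mu> ` carrier (Gal SF L)" using s by blast
    qed (use \<mu>_GL in blast)
  qed
  ultimately show ?thesis unfolding is_iso_def iso_def by blast
qed

end

text \<open>All fields are subfields of one algebraically closed \<open>'a\<close>. Hence
  \<open>alg_closure_of e\<close> is an algebraic closure of the finite field, and also of its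
  finite extension A/P, which the root \<open>tb\<close> of \<open>P\<close> embeds into it.\<close>

theorem theorem6p1:
  fixes e :: "'f::{finite, field} \<Rightarrow> 'a::alg_closed_field"
    and P :: "'f poly" and tb :: 'a and g :: "nat \<Rightarrow> 'a" and r n :: nat
  assumes r: "r \<ge> 2" and n: "n \<ge> 1"
    and e: "field_emb e"
    and P_monic: "lead_coeff P = 1" and P_irr: "irreducible P" and P_ne_t: "P \<noteq> [:0, 1:]"
    and tb: "poly (map_poly e P) tb = 0"
    and g_indep: "alg_indep (alg_closure_of e) g {1..<r}"
  shows "let q = card (UNIV :: 'f set);
             L = gen_field (alg_closure_of e \<union> g ` {1..<r});
             E = drin_et e (drin_t q r tb g) q P n;
             SF = gen_field (L \<union> {x. poly E x = 0})
         in Gal SF L \<cong> GL_mod (r - 1) (P ^ n)"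
proof -
  interpret drinfeld e P tb g r n
    using r n e P_monic P_irr tb g_indep by unfold_locales
  obtain g0 where "\<And>i. i \<in> {1..<r} \<Longrightarrow> g0 i \<in> k" "\<And>x. act g0 (P ^ n) x = x ^ q ^ (r * d * n)"
    "\<And>i. i \<in> {1..<r} \<Longrightarrow> g0 i ^ q ^ (r * d * n) = g0 i"
    using supersingular_exists by blast
  then interpret supersingular e P tb g r n g0 by unfold_locales
  show ?thesis
    using Gal_iso_GL
    unfolding Let_def SF_def L_def V_def drin_et_eq[symmetric] m_def q_def k_def .
qed

end
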